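(* Let $G$ be a graph with Tyshkevich decomposition $G = G_n \circ \cdots \circ G_0$. Then $G \in HCU$ if and only if $G_i \in \mathcal{I}$ for every $i \in \{0,\dots,n\}$.
   Context: All graphs are finite and simple. A \emph{unigraph} is a graph that is isomorphic to every graph with the same degree sequence. $HCU$ is the class of all graphs that are induced subgraphs of some unigraph. A \emph{split graph} is a graph whose vertex set can be partitioned as $K \cup S$ with $K$ a clique and $S$ a stable (independent) set ($K$ or $S$ may be empty); such a partition is a $KS$-partition. For a split graph $G$ with fixed $KS$-partition $K\cup S$ and any graph $H$, the (Tyshkevich) composition $G \circ H = (G,K,S)\circ H$ is the graph obtained from the disjoint union of $G$ and $H$ by joining every vertex of $K$ to every vertex of $H$. If $H$ is split with fixed $KS$-partition $K_H\cup S_H$, then $G\circ H$ is given the $KS$-partition $(K\cup K_H)\cup(S\cup S_H)$. The operation is associative, so $G_n\circ\cdots\circ G_1\circ G_0$ is defined whenever $G_n,\dots,G_1$ are split graphs with fixed $KS$-partitions and $G_0$ is any graph. A graph $G$ is \emph{decomposable} if $G = G_1\circ G_0$ for some nonempty (having at least one vertex) graphs $G_1,G_0$, where $G_1$ is a split graph with some $KS$-partition; otherwise it is \emph{indecomposable}. The \emph{(Tyshkevich) decomposition} of $G$ is the expression $G=G_n\circ\cdots\circ G_0$ in which all $G_i$ are nonempty and indecomposable (and $G_n,\dots,G_1$ are split with fixed $KS$-partitions); it is known to exist and to be unique up to isomorphism. $\mathcal{I}$ is the set of indecomposable graphs that are induced subgraphs of some unigraph. *)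

theory Defs
  imports Main "HOL-Library.Multiset"
begin

record 'a graph =
  verts :: "'a set"
  adj :: "'a \<Rightarrow> 'a \<Rightarrow> bool"

definition simple_graph :: "'a graph \<Rightarrow> bool" where
  "simple_graph G \<longleftrightarrow>
     finite (verts G) \<and>
     (\<forall>x y. adj G x y \<longrightarrow> x \<in> verts G \<and> y \<in> verts G) \<and>
     (\<forall>x y. adj G x y \<longrightarrow> adj G y x) \<and>
     (\<forall>x. \<not> adj G x x)"

definition isomorphic :: "'a graph \<Rightarrow> 'b graph \<Rightarrow> bool" where
  "isomorphic G H \<longleftrightarrow>
     (\<exists>f. bij_betw f (verts G) (verts H) \<and>
          (\<forall>x\<in>verts G. \<forall>y\<in>verts G. adj G x y \<longleftrightarrow> adj H (f x) (f y)))"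

definition degree :: "'a graph \<Rightarrow> 'a \<Rightarrow> nat" where
  "degree G v = card {u \<in> verts G. adj G v u}"

text \<open>Degree sequences are compared regardless of the order of the vertices, hence as multisets.\<close>

definition degree_sequence :: "'a graph \<Rightarrow> nat multiset" where
  "degree_sequence G = image_mset (degree G) (mset_set (verts G))"

definition induced_subgraph :: "'a graph \<Rightarrow> 'a set \<Rightarrow> 'a graph" where
  "induced_subgraph G W = \<lparr>verts = W, adj = (\<lambda>x y. x \<in> W \<and> y \<in> W \<and> adj G x y)\<rparr>"

text \<open>HOL cannot quantify over the graphs of all types at once. In \<open>unigraph\<close> and \<open>HCU\<close> the
  quantified graphs have vertices of type \<^typ>\<open>nat\<close>; this loses nothing, because every finite graph
  is isomorphic to one of these.\<close>

definition unigraph :: "'a graph \<Rightarrow> bool" where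
  "unigraph G \<longleftrightarrow> simple_graph G \<and>
     (\<forall>H :: nat graph. simple_graph H \<and> degree_sequence H = degree_sequence G \<longrightarrow> isomorphic G H)"

definition HCU :: "'a graph set" where
  "HCU = {G. simple_graph G \<and>
     (\<exists>(U :: nat graph) W. unigraph U \<and> W \<subseteq> verts U \<and> isomorphic G (induced_subgraph U W))}"

definition clique :: "'a graph \<Rightarrow> 'a set \<Rightarrow> bool" where
  "clique G K \<longleftrightarrow> (\<forall>x\<in>K. \<forall>y\<in>K. x \<noteq> y \<longrightarrow> adj G x y)"

definition stable :: "'a graph \<Rightarrow> 'a set \<Rightarrow> bool" where
  "stable G S \<longleftrightarrow> (\<forall>x\<in>S. \<forall>y\<in>S. \<not> adj G x y)"

definition KS_partition :: "'a graph \<Rightarrow> 'a set \<Rightarrow> 'a set \<Rightarrow> bool" where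
  "KS_partition G K S \<longleftrightarrow>
     verts G = K \<union> S \<and> K \<inter> S = {} \<and> clique G K \<and> stable G S"

text \<open>\<open>compose G K H\<close> is the composition \<open>(G, K, S) \<circ> H\<close>, for which \<open>S = verts G - K\<close> is not
  needed as an argument. It is built on the plain union of the vertex sets and therefore is only
  meaningful when \<^term>\<open>verts G\<close> and \<^term>\<open>verts H\<close> are disjoint, which is required wherever it
  is used; equalities between graphs and compositions are read up to isomorphism.\<close>

definition compose :: "'a graph \<Rightarrow> 'a set \<Rightarrow> 'a graph \<Rightarrow> 'a graph" where
  "compose G K H =
     \<lparr>verts = verts G \<union> verts H,
      adj = (\<lambda>x y. adj G x y \<or> adj H x y \<or>
                   (x \<in> K \<and> y \<in> verts H) \<or> (x \<in> verts H \<and> y \<in> K))\<rparr>"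

text \<open>\<open>iterated_compose P K n\<close> is \<open>P n \<circ> (\<dots> \<circ> (P 1 \<circ> P 0))\<close>.\<close>

primrec iterated_compose :: "(nat \<Rightarrow> 'a graph) \<Rightarrow> (nat \<Rightarrow> 'a set) \<Rightarrow> nat \<Rightarrow> 'a graph" where
  "iterated_compose P K 0 = P 0"
| "iterated_compose P K (Suc n) = compose (P (Suc n)) (K (Suc n)) (iterated_compose P K n)"

text \<open>The factors may be taken over the vertex type of \<open>G\<close>: an isomorphism transports them to
  induced subgraphs of \<open>G\<close>.\<close>

definition decomposable :: "'a graph \<Rightarrow> bool" where
  "decomposable G \<longleftrightarrow>
     (\<exists>(G1 :: 'a graph) K S (G0 :: 'a graph).
        simple_graph G1 \<and> simple_graph G0 \<and>
        verts G1 \<noteq> {} \<and> verts G0 \<noteq> {} \<and> verts G1 \<inter> verts G0 = {} \<and>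
        KS_partition G1 K S \<and> isomorphic G (compose G1 K G0))"

definition indecomposable :: "'a graph \<Rightarrow> bool" where
  "indecomposable G \<longleftrightarrow> simple_graph G \<and> \<not> decomposable G"

text \<open>\<open>P n, \<dots>, P 0\<close> are the components, and \<open>K i\<close>, \<open>S i\<close> the fixed partition of \<open>P i\<close> for
  \<open>1 \<le> i \<le> n\<close>. The values of \<open>K\<close> and \<open>S\<close> at \<open>0\<close>, and of \<open>P\<close>, \<open>K\<close>, \<open>S\<close> beyond \<open>n\<close>, are
  irrelevant.\<close>

definition tyshkevich_decomposition ::
    "'a graph \<Rightarrow> nat \<Rightarrow> (nat \<Rightarrow> 'b graph) \<Rightarrow> (nat \<Rightarrow> 'b set) \<Rightarrow> (nat \<Rightarrow> 'b set) \<Rightarrow> bool" where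
  "tyshkevich_decomposition G n P K S \<longleftrightarrow>
     (\<forall>i\<le>n. simple_graph (P i) \<and> verts (P i) \<noteq> {} \<and> indecomposable (P i)) \<and>
     (\<forall>i\<in>{1..n}. KS_partition (P i) (K i) (S i)) \<and>
     (\<forall>i\<le>n. \<forall>j\<le>n. i \<noteq> j \<longrightarrow> verts (P i) \<inter> verts (P j) = {}) \<and>
     isomorphic G (iterated_compose P K n)"

definition indecomposable_HCU :: "'a graph set"  ("\<I>") where
  "\<I> = {G. indecomposable G \<and> G \<in> HCU}"

end

theory Submission
  imports Defs
begin

text \<open>One direction only uses that the hereditary closure is hereditary: every component is an
induced subgraph of the composition.

For the converse, the components are composed one after the other, from the innermost
outwards. Let \<open>Q\<close> be an induced subgraph of a unigraph \<open>U\<close>, and let \<open>P\<close> be the next component,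
an indecomposable split graph with clique \<open>K\<close> and stable set \<open>S\<close>. Suppose that \<open>P\<close> sits inside
a split graph \<open>A \<union> B\<close>, with \<open>K\<close> in the clique \<open>A\<close> and \<open>S\<close> in the stable set \<open>B\<close>, whose
bipartite part is determined by its degrees (\<open>bipartite_unique\<close>). Then the composition of that
split graph with \<open>U\<close> is again a unigraph, because the difference between the degree sums over
\<open>A\<close> and over \<open>B\<close> is as large as it can be, which forces the shape of a composition on every
realization of its degrees (\<open>composed_degrees\<close>, \<open>uniquely_realized_sum_compose\<close>). It contains
\<open>P \<circ> Q\<close>.

It remains to find \<open>A\<close> and \<open>B\<close>. All that is given is a unigraph, possibly far from being
split, that contains \<open>P\<close>. If no vertex of \<open>K\<close> has the same degree in that unigraph as a vertex
of \<open>S\<close>, then \<open>A\<close> can be the set of all vertices whose degree occurs in \<open>K\<close>, and \<open>B\<close> the set of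
all other vertices: an isomorphism between two realizations preserves degrees, hence preserves
\<open>A\<close> and \<open>B\<close>. If \<open>K\<close> or \<open>S\<close> has at most two vertices, then \<open>P\<close> itself can be taken: unless one
side is empty, each vertex of the other side has exactly one neighbour among these two. The
heart of the proof is \<open>split_degrees_disjoint\<close>: if \<open>K\<close> and \<open>S\<close> both have at least three
vertices, then a vertex of \<open>K\<close> and one of \<open>S\<close> never have the same degree. This replaces the
classification of the unigraphs that are not split.

The tool for it is the switch that replaces two edges \<open>ab\<close>, \<open>cd\<close> by two non-edges \<open>ac\<close>, \<open>bd\<close>.
It preserves all degrees, so in a unigraph it preserves every invariant. Three invariants
suffice: the sum of the products of the degrees over the edges, the sum of the squares of the
numbers of neighbours in a given degree class, and the number of triangles. They show that in
a degree class \<open>M\<close> that is neither a clique nor stable the degrees inside \<open>M\<close> take at most two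
values \<open>r\<close> and \<open>r - 1\<close>, and that every vertex outside \<open>M\<close> is adjacent to all of \<open>M\<close> or to none
of it, with at most one exception, which is adjacent exactly to the vertices of inner degree
\<open>r - 1\<close> (\<open>nearly_regular_class_exists\<close>). If \<open>M\<close> meets both \<open>K\<close> and \<open>S\<close>, then, since \<open>P\<close> is
indecomposable, all of \<open>P\<close> except possibly one vertex lies in \<open>M\<close>; as \<open>K\<close> and \<open>S\<close> have at
least three vertices, \<open>r\<close> is at least \<open>3\<close>, in the graph and in its complement. On the other
hand, in whichever of the two is the sparser one inside \<open>M\<close>, some realization has a large
clique in \<open>M\<close> that sends at most one edge per vertex to the rest of \<open>M\<close>
(\<open>clique_realization\<close>), and a switch between such a clique and the rest changes the number of
triangles (\<open>nearly_regular_class_sparse\<close>).\<close>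

section \<open>Graphs with a unique realization\<close>

definition graph_on :: "'a set \<Rightarrow> ('a \<Rightarrow> 'a \<Rightarrow> bool) \<Rightarrow> bool" where
  "graph_on V E \<longleftrightarrow> finite V \<and> (\<forall>x y. E x y \<longrightarrow> x \<in> V \<and> y \<in> V) \<and>
     (\<forall>x y. E x y \<longrightarrow> E y x) \<and> (\<forall>x. \<not> E x x)"

definition nbrs :: "('a \<Rightarrow> 'a \<Rightarrow> bool) \<Rightarrow> 'a \<Rightarrow> 'a set" where
  "nbrs E x = {y. E x y}"

definition deg :: "('a \<Rightarrow> 'a \<Rightarrow> bool) \<Rightarrow> 'a \<Rightarrow> nat" where
  "deg E x = card (nbrs E x)"

text \<open>Isomorphism is only required against realizations on the same vertex set in which each vertex
keeps its degree. For finite graphs this is the property of being a unigraph, in a form that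
does not depend on the vertex type and that switches and complements can be applied to
directly.\<close>

definition uniquely_realized :: "'a set \<Rightarrow> ('a \<Rightarrow> 'a \<Rightarrow> bool) \<Rightarrow> bool" where
  "uniquely_realized V E \<longleftrightarrow> graph_on V E \<and>
     (\<forall>E'. graph_on V E' \<and> (\<forall>x\<in>V. deg E' x = deg E x) \<longrightarrow>
        (\<exists>f. bij_betw f V V \<and> (\<forall>x\<in>V. \<forall>y\<in>V. E x y \<longleftrightarrow> E' (f x) (f y))))"

lemma graph_on_finite: "graph_on V E \<Longrightarrow> finite V"
  and graph_on_sym: "graph_on V E \<Longrightarrow> E x y \<longleftrightarrow> E y x"
  and graph_on_irrefl: "graph_on V E \<Longrightarrow> \<not> E x x"
  and graph_on_in: "graph_on V E \<Longrightarrow> E x y \<Longrightarrow> x \<in> V \<and> y \<in> V"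
  by (auto simp: graph_on_def)

lemma in_nbrs [simp]: "y \<in> nbrs E x \<longleftrightarrow> E x y"
  by (simp add: nbrs_def)

lemma nbrs_subset: "graph_on V E \<Longrightarrow> nbrs E x \<subseteq> V"
  by (auto simp: graph_on_def)

lemma finite_nbrs: "graph_on V E \<Longrightarrow> finite (nbrs E x)"
  by (meson finite_subset nbrs_subset graph_on_finite)

lemma uniquely_realized_graph: "uniquely_realized V E \<Longrightarrow> graph_on V E"
  by (simp add: uniquely_realized_def)

lemma isomorphism_nbrs:
  assumes "graph_on V E" "graph_on V' E'" "bij_betw f V V'"
    "\<forall>x\<in>V. \<forall>y\<in>V. E x y \<longleftrightarrow> E' (f x) (f y)" "x \<in> V"
  shows "nbrs E' (f x) = f ` nbrs E x"
proof -
  have "y \<in> f ` nbrs E x" if "E' (f x) y" for y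
  proof -
    have "y \<in> f ` V"
      using graph_on_in[OF assms(2) that] bij_betw_imp_surj_on[OF assms(3)] by simp
    then obtain z where z: "z \<in> V" "y = f z" by blast
    then have "E x z" using that assms(4,5) by blast
    then show ?thesis using z(2) by simp
  qed
  moreover have "E' (f x) (f z)" if "E x z" for z
    using that assms(1,4,5) by (meson graph_on_in)
  ultimately show ?thesis by auto
qed

lemma isomorphism_deg:
  assumes "graph_on V E" "graph_on V' E'" "bij_betw f V V'"
    "\<forall>x\<in>V. \<forall>y\<in>V. E x y \<longleftrightarrow> E' (f x) (f y)" "x \<in> V"
  shows "deg E' (f x) = deg E x"
proof -
  have "inj_on f (nbrs E x)"
    using inj_on_subset[OF bij_betw_imp_inj_on[OF assms(3)] nbrs_subset[OF assms(1)]] .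
  then show ?thesis
    unfolding deg_def isomorphism_nbrs[OF assms] by (rule card_image)
qed

lemma uniquely_realized_same_degrees:
  assumes U: "uniquely_realized V E" and G: "graph_on V E'" and D: "\<forall>x\<in>V. deg E' x = deg E x"
  shows "uniquely_realized V E'"
  unfolding uniquely_realized_def
proof (intro conjI allI impI G)
  fix E'' assume E'': "graph_on V E'' \<and> (\<forall>x\<in>V. deg E'' x = deg E' x)"
  obtain f where f: "bij_betw f V V" "\<forall>x\<in>V. \<forall>y\<in>V. E x y \<longleftrightarrow> E' (f x) (f y)"
    using U G D unfolding uniquely_realized_def by blast
  have "graph_on V E'' \<and> (\<forall>x\<in>V. deg E'' x = deg E x)" using E'' D by simp
  then obtain g where g: "bij_betw g V V" "\<forall>x\<in>V. \<forall>y\<in>V. E x y \<longleftrightarrow> E'' (g x) (g y)"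
    using U unfolding uniquely_realized_def by blast
  let ?i = "inv_into V f"
  have i: "bij_betw ?i V V" using f(1) by (rule bij_betw_inv_into)
  have "E' x y \<longleftrightarrow> E'' ((g \<circ> ?i) x) ((g \<circ> ?i) y)" if "x \<in> V" "y \<in> V" for x y
  proof -
    have "f (?i x) = x" "f (?i y) = y" "?i x \<in> V" "?i y \<in> V"
      using that f(1) i by (auto simp: bij_betw_inv_into_right bij_betwE)
    then show ?thesis using f(2) g(2) by fastforce
  qed
  moreover have "bij_betw (g \<circ> ?i) V V" using i g(1) by (rule bij_betw_trans)
  ultimately show "\<exists>f. bij_betw f V V \<and> (\<forall>x\<in>V. \<forall>y\<in>V. E' x y \<longleftrightarrow> E'' (f x) (f y))" by blast
qed

definition complement :: "'a set \<Rightarrow> ('a \<Rightarrow> 'a \<Rightarrow> bool) \<Rightarrow> 'a \<Rightarrow> 'a \<Rightarrow> bool" where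
  "complement V E x y \<longleftrightarrow> x \<in> V \<and> y \<in> V \<and> x \<noteq> y \<and> \<not> E x y"

lemma graph_on_complement: "graph_on V E \<Longrightarrow> graph_on V (complement V E)"
  by (auto simp: graph_on_def complement_def)

lemma card_nbrs_complement:
  assumes G: "graph_on V E" and M: "M \<subseteq> V" and x: "x \<in> M"
  shows "card (nbrs (complement V E) x \<inter> M) + card (nbrs E x \<inter> M) + 1 = card M"
proof -
  have f: "finite M" using G M graph_on_finite finite_subset by blast
  have "M = insert x ((nbrs (complement V E) x \<inter> M) \<union> (nbrs E x \<inter> M))"
    using x M by (auto simp: complement_def)
  moreover have "x \<notin> (nbrs (complement V E) x \<inter> M) \<union> (nbrs E x \<inter> M)"
    using G by (auto simp: complement_def graph_on_def)
  moreover have "(nbrs (complement V E) x \<inter> M) \<inter> (nbrs E x \<inter> M) = {}"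
    by (auto simp: complement_def)
  ultimately show ?thesis
    by (metis (no_types, lifting) Suc_eq_plus1 card_Un_disjoint card_insert_disjoint f finite_Int
        finite_UnI inf.commute)
qed

lemma deg_complement:
  assumes G: "graph_on V E" and x: "x \<in> V"
  shows "deg (complement V E) x + deg E x + 1 = card V"
  using card_nbrs_complement[OF G subset_refl x] nbrs_subset[OF G, of x]
    nbrs_subset[OF graph_on_complement[OF G], of x]
  by (simp add: deg_def inf.absorb1)

lemma uniquely_realized_complement:
  assumes U: "uniquely_realized V E"
  shows "uniquely_realized V (complement V E)"
  unfolding uniquely_realized_def
proof (intro conjI allI impI)
  have G: "graph_on V E" using U by (rule uniquely_realized_graph)
  show "graph_on V (complement V E)" using G by (rule graph_on_complement)
  fix E' assume "graph_on V E' \<and> (\<forall>x\<in>V. deg E' x = deg (complement V E) x)"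
  then have G': "graph_on V E'" and D: "\<And>x. x \<in> V \<Longrightarrow> deg E' x = deg (complement V E) x" by auto
  have "deg (complement V E') x = deg E x" if "x \<in> V" for x
    using deg_complement[OF G that] deg_complement[OF G' that] D[OF that] by linarith
  then obtain f where f: "bij_betw f V V"
      "\<forall>x\<in>V. \<forall>y\<in>V. E x y \<longleftrightarrow> complement V E' (f x) (f y)"
    using U graph_on_complement[OF G'] unfolding uniquely_realized_def by blast
  have "complement V E x y \<longleftrightarrow> E' (f x) (f y)" if "x \<in> V" "y \<in> V" for x y
  proof -
    have "f x \<in> V" "f y \<in> V" "f x = f y \<longleftrightarrow> x = y"
      using f(1) that by (auto simp: bij_betw_def inj_on_def)
    then show ?thesis using f(2) that G' by (auto simp: complement_def graph_on_def)
  qed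
  then show "\<exists>f. bij_betw f V V \<and> (\<forall>x\<in>V. \<forall>y\<in>V. complement V E x y \<longleftrightarrow> E' (f x) (f y))"
    using f(1) by blast
qed


section \<open>Switching alternating four-cycles\<close>

text \<open>The alternating four-cycle is \<open>a b d c\<close>; its opposite pairs are \<open>a, d\<close> and \<open>b, c\<close>.\<close>

definition alternating :: "('a \<Rightarrow> 'a \<Rightarrow> bool) \<Rightarrow> 'a \<Rightarrow> 'a \<Rightarrow> 'a \<Rightarrow> 'a \<Rightarrow> bool" where
  "alternating E a b c d \<longleftrightarrow> E a b \<and> E c d \<and> \<not> E a c \<and> \<not> E b d \<and> a \<noteq> c \<and> b \<noteq> d"

definition switch :: "('a \<Rightarrow> 'a \<Rightarrow> bool) \<Rightarrow> 'a \<Rightarrow> 'a \<Rightarrow> 'a \<Rightarrow> 'a \<Rightarrow> 'a \<Rightarrow> 'a \<Rightarrow> bool" where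
  "switch E a b c d x y \<longleftrightarrow>
     (E x y \<and> {x, y} \<noteq> {a, b} \<and> {x, y} \<noteq> {c, d}) \<or> {x, y} = {a, c} \<or> {x, y} = {b, d}"

lemma alternating_distinct:
  assumes "graph_on V E" "alternating E a b c d"
  shows "a \<in> V" "b \<in> V" "c \<in> V" "d \<in> V" "a \<noteq> b" "a \<noteq> c" "a \<noteq> d" "b \<noteq> c" "b \<noteq> d" "c \<noteq> d"
  using assms by (auto simp: alternating_def graph_on_def)

lemma graph_on_switch:
  assumes "graph_on V E" "alternating E a b c d"
  shows "graph_on V (switch E a b c d)"
proof -
  have "switch E a b c d y x" if "switch E a b c d x y" for x y
    using that graph_on_sym[OF assms(1), of x y] insert_commute[of x y "{}"]
    unfolding switch_def by metis
  moreover have "\<not> switch E a b c d x x" for x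
    using alternating_distinct[OF assms] assms(1) by (auto simp: switch_def graph_on_def)
  moreover have "x \<in> V \<and> y \<in> V" if "switch E a b c d x y" for x y
    using that alternating_distinct[OF assms] assms(1)
    by (auto simp: switch_def doubleton_eq_iff graph_on_def)
  ultimately show ?thesis using assms(1) unfolding graph_on_def by blast
qed

lemma nbrs_switch:
  assumes G: "graph_on V E" and A: "alternating E a b c d"
  shows "nbrs (switch E a b c d) a = insert c (nbrs E a - {b})"
    "nbrs (switch E a b c d) b = insert d (nbrs E b - {a})"
    "nbrs (switch E a b c d) c = insert a (nbrs E c - {d})"
    "nbrs (switch E a b c d) d = insert b (nbrs E d - {c})"
    "x \<notin> {a, b, c, d} \<Longrightarrow> nbrs (switch E a b c d) x = nbrs E x"
  using alternating_distinct[OF assms] G A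
  by (auto simp: switch_def doubleton_eq_iff alternating_def graph_on_def)

lemma sum_nbrs_switch:
  fixes w :: "'a \<Rightarrow> int"
  assumes G: "graph_on V E" and A: "alternating E a b c d"
  shows "sum w (nbrs (switch E a b c d) a) = sum w (nbrs E a) - w b + w c"
    "sum w (nbrs (switch E a b c d) b) = sum w (nbrs E b) - w a + w d"
    "sum w (nbrs (switch E a b c d) c) = sum w (nbrs E c) - w d + w a"
    "sum w (nbrs (switch E a b c d) d) = sum w (nbrs E d) - w c + w b"
  using A G finite_nbrs[OF G]
  by (auto simp: nbrs_switch[OF G A] sum.insert_if sum_diff1 alternating_def graph_on_sym[OF G])

lemma deg_switch:
  assumes G: "graph_on V E" and A: "alternating E a b c d"
  shows "deg (switch E a b c d) x = deg E x"
proof -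
  have e: "int (deg E' y) = sum (\<lambda>_. 1) (nbrs E' y)" for E' and y :: 'a by (simp add: deg_def)
  have "int (deg (switch E a b c d) x) = int (deg E x)"
    unfolding e using sum_nbrs_switch[OF G A, of "\<lambda>_. 1"] nbrs_switch(5)[OF G A, of x]
    by (cases "x \<in> {a, b, c, d}") auto
  then show ?thesis by simp
qed

lemma uniquely_realized_switch:
  assumes "uniquely_realized V E" "alternating E a b c d"
  shows "uniquely_realized V (switch E a b c d)"
  using assms deg_switch graph_on_switch uniquely_realized_graph uniquely_realized_same_degrees
  by metis

lemma degree_invariant:
  fixes g :: "nat \<Rightarrow> int \<Rightarrow> int" and h :: "nat \<Rightarrow> int"
  assumes U: "uniquely_realized V E" and G': "graph_on V E'"
    and D: "\<And>x. x \<in> V \<Longrightarrow> deg E' x = deg E x"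
  shows "(\<Sum>x\<in>V. g (deg E x) (\<Sum>y\<in>nbrs E' x. h (deg E y))) =
    (\<Sum>x\<in>V. g (deg E x) (\<Sum>y\<in>nbrs E x. h (deg E y)))"
proof -
  have G: "graph_on V E" using U by (rule uniquely_realized_graph)
  obtain f where f: "bij_betw f V V" "\<forall>x\<in>V. \<forall>y\<in>V. E x y \<longleftrightarrow> E' (f x) (f y)"
    using U G' D unfolding uniquely_realized_def by blast
  have fd: "deg E (f x) = deg E x" if "x \<in> V" for x
    using isomorphism_deg[OF G G' f that] D[of "f x"] f(1) that by (metis bij_betwE)
  have s: "(\<Sum>y\<in>nbrs E' (f x). h (deg E y)) = (\<Sum>y\<in>nbrs E x. h (deg E y))" if "x \<in> V" for x
  proof -
    have "inj_on f (nbrs E x)"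
      using inj_on_subset[OF bij_betw_imp_inj_on[OF f(1)] nbrs_subset[OF G]] .
    then have "(\<Sum>y\<in>nbrs E' (f x). h (deg E y)) = (\<Sum>y\<in>nbrs E x. h (deg E (f y)))"
      unfolding isomorphism_nbrs[OF G G' f that] by (simp add: sum.reindex)
    also have "\<dots> = (\<Sum>y\<in>nbrs E x. h (deg E y))"
      using fd nbrs_subset[OF G, of x] by (intro sum.cong) auto
    finally show ?thesis .
  qed
  have "(\<Sum>x\<in>V. g (deg E x) (\<Sum>y\<in>nbrs E' x. h (deg E y))) =
      (\<Sum>x\<in>V. g (deg E (f x)) (\<Sum>y\<in>nbrs E' (f x). h (deg E y)))"
    using sum.reindex_bij_betw[OF f(1), of "\<lambda>x. g (deg E x) (\<Sum>y\<in>nbrs E' x. h (deg E y))"] by simp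
  then show ?thesis using fd s by simp
qed

lemma sum_four:
  fixes F :: "'a \<Rightarrow> int"
  assumes "finite V" "a \<in> V" "b \<in> V" "c \<in> V" "d \<in> V"
    "a \<noteq> b" "a \<noteq> c" "a \<noteq> d" "b \<noteq> c" "b \<noteq> d" "c \<noteq> d"
  shows "sum F V = F a + F b + F c + F d + sum F (V - {a, b, c, d})"
proof -
  have "sum F V = sum F {a, b, c, d} + sum F (V - {a, b, c, d})"
    using assms by (metis add.commute empty_subsetI insert_subset sum.subset_diff)
  then show ?thesis using assms by simp
qed

text \<open>A general invariant of switches, from which two particular ones are drawn. An isomorphism
preserves, at each vertex, the degree and the sum of a weight of the degrees of the
neighbours, and a switch changes these data at its four corners only.\<close>

lemma switch_invariant:
  fixes g :: "nat \<Rightarrow> int \<Rightarrow> int" and h :: "nat \<Rightarrow> int"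
  assumes U: "uniquely_realized V E" and A: "alternating E a b c d"
  defines "w \<equiv> \<lambda>x. h (deg E x)"
  defines "p \<equiv> \<lambda>x. \<Sum>y\<in>nbrs E x. w y"
  shows "g (deg E a) (p a - w b + w c) + g (deg E b) (p b - w a + w d) +
      g (deg E c) (p c - w d + w a) + g (deg E d) (p d - w c + w b) =
    g (deg E a) (p a) + g (deg E b) (p b) + g (deg E c) (p c) + g (deg E d) (p d)"
proof -
  have G: "graph_on V E" using U by (rule uniquely_realized_graph)
  let ?S = "switch E a b c d"
  note dist = alternating_distinct[OF G A]
  note eq = degree_invariant[OF U graph_on_switch[OF G A] deg_switch[OF G A], of g h]
  note s = sum_nbrs_switch[OF G A, of w]
  have r: "(\<Sum>x\<in>V - {a, b, c, d}. g (deg E x) (\<Sum>y\<in>nbrs ?S x. h (deg E y))) =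
      (\<Sum>x\<in>V - {a, b, c, d}. g (deg E x) (\<Sum>y\<in>nbrs E x. h (deg E y)))"
    using nbrs_switch(5)[OF G A] by (intro sum.cong) auto
  show ?thesis
    using eq r s unfolding sum_four[OF graph_on_finite[OF G] dist] p_def w_def by simp
qed

text \<open>The invariant is the sum of \<open>deg x * deg y\<close> over all edges \<open>xy\<close>: a switch changes it by a
multiple of the product of the two differences between the degrees of opposite corners.\<close>

lemma alternating_same_degree:
  assumes U: "uniquely_realized V E" and A: "alternating E a b c d"
  shows "deg E a = deg E d \<or> deg E b = deg E c"
proof -
  let ?w = "\<lambda>x. int (deg E x)" and ?p = "\<lambda>x. \<Sum>y\<in>nbrs E x. int (deg E y)"
  have "?w a * (?p a - ?w b + ?w c) + ?w b * (?p b - ?w a + ?w d) +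
      ?w c * (?p c - ?w d + ?w a) + ?w d * (?p d - ?w c + ?w b) =
      ?w a * ?p a + ?w b * ?p b + ?w c * ?p c + ?w d * ?p d"
    using switch_invariant[OF U A, of "\<lambda>k s. int k * s" int] by simp
  then have "(?w a - ?w d) * (?w c - ?w b) = 0" by (simp add: algebra_simps)
  then show ?thesis by auto
qed

text \<open>The invariant is the sum over all vertices of the square of the number of neighbours of
degree \<open>k\<close>. The switch raises this number by one at \<open>a\<close>, lowers it by one at \<open>d\<close>, and changes
it nowhere else, so the two numbers can only be exchanged.\<close>

lemma alternating_count_in_class:
  assumes U: "uniquely_realized V E" and A: "alternating E a b c d"
    and deg: "deg E a = k" "deg E d = k" "deg E c = k" "deg E b \<noteq> k"
  shows "card (nbrs E d \<inter> {x. deg E x = k}) = card (nbrs E a \<inter> {x. deg E x = k}) + 1"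
proof -
  have G: "graph_on V E" using U by (rule uniquely_realized_graph)
  let ?w = "\<lambda>x. of_bool (deg E x = k) :: int"
  have p: "(\<Sum>y\<in>nbrs E x. ?w y) = int (card (nbrs E x \<inter> {x. deg E x = k}))" for x
    using finite_nbrs[OF G, of x] by (simp add: sum.If_cases of_bool_def)
  let ?p = "\<lambda>x. \<Sum>y\<in>nbrs E x. ?w y"
  have "(?p a - ?w b + ?w c)\<^sup>2 + (?p b - ?w a + ?w d)\<^sup>2 + (?p c - ?w d + ?w a)\<^sup>2 +
      (?p d - ?w c + ?w b)\<^sup>2 = (?p a)\<^sup>2 + (?p b)\<^sup>2 + (?p c)\<^sup>2 + (?p d)\<^sup>2"
    by (rule switch_invariant[OF U A, of "\<lambda>k s. s\<^sup>2" "\<lambda>n. of_bool (n = k)"])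
  then have "2 * ?p a + 2 - 2 * ?p d = 0"
    using deg by (simp add: power2_eq_square algebra_simps)
  then have "?p d = ?p a + 1" by linarith
  then show ?thesis unfolding p by linarith
qed

section \<open>Triangles\<close>

definition triangles :: "'a set \<Rightarrow> ('a \<Rightarrow> 'a \<Rightarrow> bool) \<Rightarrow> 'a set set" where
  "triangles V E = {T. T \<subseteq> V \<and> card T = 3 \<and> (\<forall>x\<in>T. \<forall>y\<in>T. x \<noteq> y \<longrightarrow> E x y)}"

text \<open>A switch is compared with the original graph through the graph that lacks both removed edges;
adding the edges one by one makes the triangles easy to count.\<close>

definition add_edge :: "('a \<Rightarrow> 'a \<Rightarrow> bool) \<Rightarrow> 'a \<Rightarrow> 'a \<Rightarrow> 'a \<Rightarrow> 'a \<Rightarrow> bool" where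
  "add_edge E p q x y \<longleftrightarrow> E x y \<or> {x, y} = {p, q}"

lemma graph_on_add_edge:
  "graph_on V E \<Longrightarrow> p \<in> V \<Longrightarrow> q \<in> V \<Longrightarrow> p \<noteq> q \<Longrightarrow> graph_on V (add_edge E p q)"
  unfolding graph_on_def add_edge_def by (auto simp: doubleton_eq_iff)

lemma card_triangles_add_edge:
  assumes G: "graph_on V E" and pq: "p \<in> V" "q \<in> V" "p \<noteq> q" "\<not> E p q"
  shows "card (triangles V (add_edge E p q)) = card (triangles V E) + card {z. E p z \<and> E q z}"
proof -
  let ?W = "{z. E p z \<and> E q z}" and ?f = "\<lambda>z. {p, q, z}"
  have qp: "\<not> E q p" using pq G by (auto simp: graph_on_def)
  have fin: "finite (triangles V E)" "finite ?W"
    using G by (auto simp: triangles_def graph_on_def intro: finite_subset[of _ "Pow V"] finite_subset[of _ V])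
  have W: "z \<in> V" "z \<noteq> p" "z \<noteq> q" if "E p z" "E q z" for z
    using that G by (auto simp: graph_on_def)
  have inj: "inj_on ?f ?W"
    using W by (auto simp: inj_on_def)
  have disj: "triangles V E \<inter> ?f ` ?W = {}"
    using pq by (auto simp: triangles_def)
  have "T \<in> triangles V (add_edge E p q) \<longleftrightarrow> T \<in> triangles V E \<union> ?f ` ?W" for T
  proof
    assume T: "T \<in> triangles V (add_edge E p q)"
    show "T \<in> triangles V E \<union> ?f ` ?W"
    proof (cases "p \<in> T \<and> q \<in> T")
      case True
      have "card (T - {p, q}) = 1"
        using T True pq(3) by (simp add: triangles_def card_Diff_subset)
      then obtain z where z: "T - {p, q} = {z}" by (meson card_1_singletonE)
      then have Tz: "T = {p, q, z}" "z \<noteq> p" "z \<noteq> q" using True by auto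
      then have "add_edge E p q p z" "add_edge E p q q z" using T by (auto simp: triangles_def)
      then have "z \<in> ?W" using Tz by (auto simp: add_edge_def doubleton_eq_iff)
      then show ?thesis using Tz(1) by blast
    next
      case False
      then have "E x y" if "x \<in> T" "y \<in> T" "x \<noteq> y" for x y
        using T that by (auto simp: triangles_def add_edge_def doubleton_eq_iff)
      then show ?thesis using T by (auto simp: triangles_def)
    qed
  next
    assume "T \<in> triangles V E \<union> ?f ` ?W"
    then show "T \<in> triangles V (add_edge E p q)"
    proof
      assume "T \<in> triangles V E"
      then show ?thesis by (auto simp: triangles_def add_edge_def)
    next
      assume "T \<in> ?f ` ?W"
      then obtain z where z: "T = {p, q, z}" "E p z" "E q z" by auto
      then have "E z p" "E z q" "card T = 3" "T \<subseteq> V"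
        using W[of z] pq graph_on_sym[OF G] by auto
      then show ?thesis using z by (auto simp: triangles_def add_edge_def)
    qed
  qed
  then have "triangles V (add_edge E p q) = triangles V E \<union> ?f ` ?W" by blast
  then show ?thesis
    using disj fin inj by (simp add: card_Un_disjoint card_image)
qed

lemma card_triangles_invariant:
  assumes U: "uniquely_realized V E" and G': "graph_on V E'" and D: "\<And>x. x \<in> V \<Longrightarrow> deg E' x = deg E x"
  shows "card (triangles V E') = card (triangles V E)"
proof -
  obtain f where f: "bij_betw f V V" "\<forall>x\<in>V. \<forall>y\<in>V. E x y \<longleftrightarrow> E' (f x) (f y)"
    using U G' D unfolding uniquely_realized_def by blast
  have inj: "inj_on f V" and im: "f ` V = V" using f(1) by (auto simp: bij_betw_def)
  have "triangles V E' = (`) f ` triangles V E"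
  proof (intro set_eqI iffI)
    fix T assume T: "T \<in> triangles V E'"
    let ?S = "{x \<in> V. f x \<in> T}"
    have TS: "T = f ` ?S" using T im by (auto simp: triangles_def)
    have "card ?S = card T"
      using card_image[OF inj_on_subset[OF inj, of ?S]] TS by simp
    moreover have "E x y" if "x \<in> ?S" "y \<in> ?S" "x \<noteq> y" for x y
    proof -
      have "f x \<noteq> f y" using that inj by (auto simp: inj_on_def)
      then have "E' (f x) (f y)" using that T by (auto simp: triangles_def)
      then show ?thesis using that f(2) by blast
    qed
    ultimately have "?S \<in> triangles V E" using T by (auto simp: triangles_def)
    then show "T \<in> (`) f ` triangles V E" using TS by blast
  next
    fix T assume "T \<in> (`) f ` triangles V E"
    then obtain S where S: "T = f ` S" "S \<in> triangles V E" by blast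
    then have SV: "S \<subseteq> V" by (auto simp: triangles_def)
    have "card T = card S" using card_image[OF inj_on_subset[OF inj SV]] S by simp
    moreover have "E' (f x) (f y)" if "x \<in> S" "y \<in> S" "f x \<noteq> f y" for x y
    proof -
      have "E x y" using that S(2) by (auto simp: triangles_def)
      then show ?thesis using that f(2) SV by blast
    qed
    moreover have "T \<subseteq> V" using S(1) SV im by blast
    ultimately show "T \<in> triangles V E'" using S by (auto simp: triangles_def)
  qed
  moreover have "inj_on ((`) f) (triangles V E)"
    by (rule inj_on_subset[OF inj_on_image_Pow[OF inj]]) (auto simp: triangles_def)
  ultimately show ?thesis by (simp add: card_image)
qed

text \<open>The sum is the number of triangles that a switch destroys minus the number that it creates:
the triangles concerned consist of an affected edge and a vertex outside the four-cycle.\<close>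

lemma alternating_triangles:
  assumes U: "uniquely_realized V E" and A: "alternating E a b c d"
  shows "(\<Sum>x\<in>V - {a, b, c, d}. (of_bool (E x a) - of_bool (E x d)) *
    (of_bool (E x b) - of_bool (E x c))) = (0::int)"
proof -
  have G: "graph_on V E" using U by (rule uniquely_realized_graph)
  note dist = alternating_distinct[OF G A]
  note sym = graph_on_sym[OF G]
  have al: "E a b" "E b a" "E c d" "E d c" "\<not> E a c" "\<not> E c a" "\<not> E b d" "\<not> E d b"
    using A sym by (auto simp: alternating_def)
  define E0 where "E0 = (\<lambda>x y. E x y \<and> {x, y} \<noteq> {a, b} \<and> {x, y} \<noteq> {c, d})"
  have G0: "graph_on V E0"
    using G by (auto simp: graph_on_def E0_def insert_commute)
  have E: "add_edge (add_edge E0 a b) c d = E"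
    using al by (auto simp: add_edge_def E0_def fun_eq_iff doubleton_eq_iff)
  have S: "add_edge (add_edge E0 a c) b d = switch E a b c d"
    by (auto simp: add_edge_def E0_def switch_def fun_eq_iff)
  let ?W = "\<lambda>p q. {z \<in> V - {a, b, c, d}. E z p \<and> E z q}"
  have ir: "\<not> E x x" for x using G by (rule graph_on_irrefl)
  have Wab: "{z. E0 a z \<and> E0 b z} = ?W a b"
    and Wcd: "{z. add_edge E0 a b c z \<and> add_edge E0 a b d z} = ?W c d"
    and Wac: "{z. E0 a z \<and> E0 c z} = ?W a c"
    and Wbd: "{z. add_edge E0 a c b z \<and> add_edge E0 a c d z} = ?W b d"
    using al dist ir sym graph_on_in[OF G]
    by (auto simp: E0_def add_edge_def doubleton_eq_iff)
  have "card (triangles V E) = card (triangles V E0) + card (?W a b) + card (?W c d)"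
    using card_triangles_add_edge[OF G0, of a b]
      card_triangles_add_edge[OF graph_on_add_edge[OF G0, of a b], of c d] dist al
    unfolding E Wab Wcd by (simp add: E0_def add_edge_def doubleton_eq_iff)
  moreover have "card (triangles V (switch E a b c d)) =
      card (triangles V E0) + card (?W a c) + card (?W b d)"
    using card_triangles_add_edge[OF G0, of a c]
      card_triangles_add_edge[OF graph_on_add_edge[OF G0, of a c], of b d] dist al
    unfolding S Wac Wbd by (simp add: E0_def add_edge_def doubleton_eq_iff)
  ultimately have W: "card (?W a b) + card (?W c d) = card (?W a c) + card (?W b d)"
    using card_triangles_invariant[OF U graph_on_switch[OF G A] deg_switch[OF G A]] by simp
  have e: "int (card (?W p q)) = (\<Sum>x\<in>V - {a, b, c, d}. of_bool (E x p) * of_bool (E x q))" for p q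
  proof -
    have "(\<Sum>x\<in>V - {a, b, c, d}. of_bool (E x p) * of_bool (E x q) :: int) =
        (\<Sum>x\<in>V - {a, b, c, d}. of_bool (E x p \<and> E x q))"
      by (simp add: of_bool_conj)
    then show ?thesis using graph_on_finite[OF G] by (simp add: of_bool_def sum.If_cases Int_def)
  qed
  have "(\<Sum>x\<in>V - {a, b, c, d}. (of_bool (E x a) - of_bool (E x d)) *
      (of_bool (E x b) - of_bool (E x c))) =
      int (card (?W a b)) + int (card (?W c d)) - int (card (?W a c)) - int (card (?W b d))"
    unfolding e sum.distrib[symmetric] sum_subtractf[symmetric]
    by (intro sum.cong) (auto simp: algebra_simps)
  then show ?thesis using W by linarith
qed

text \<open>The triangle count is applied to the same four-cycle before and after another switch at \<open>u\<close>
and \<open>v\<close>, which exchanges \<open>q\<close> and \<open>s\<close> as their neighbours; only the terms of \<open>q\<close> and \<open>s\<close>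
differ.\<close>

lemma four_private_neighbours:
  assumes U: "uniquely_realized V E"
    and u: "E u p" "E u q" "\<not> E u r" "\<not> E u s" and v: "\<not> E v p" "\<not> E v q" "E v r" "E v s"
    and ne: "p \<noteq> q" "r \<noteq> s" "p \<noteq> v" "q \<noteq> v" "r \<noteq> u" "s \<noteq> u"
  shows "of_bool (E p q) + of_bool (E r s) = (of_bool (E p s) + of_bool (E q r) :: int)"
proof -
  have G: "graph_on V E" using U by (rule uniquely_realized_graph)
  note sym = graph_on_sym[OF G]
  have ir: "\<not> E x x" for x using G by (rule graph_on_irrefl)
  have A: "alternating E u p r v" and A': "alternating E u q s v"
    using u v ne sym by (auto simp: alternating_def)
  have inV: "u \<in> V" "v \<in> V" "p \<in> V" "q \<in> V" "r \<in> V" "s \<in> V"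
    using u v graph_on_in[OF G] by auto
  have dist: "distinct [u, v, p, q, r, s]"
    using u v ne ir sym by auto
  let ?S = "switch E u q s v"
  have US: "uniquely_realized V ?S" using U A' by (rule uniquely_realized_switch)
  have AS: "alternating ?S u p r v"
    using A dist u v sym by (auto simp: alternating_def switch_def doubleton_eq_iff)
  define F where "F = (\<lambda>(E :: 'a \<Rightarrow> 'a \<Rightarrow> bool) x. (of_bool (E x u) - of_bool (E x v)) *
    (of_bool (E x p) - of_bool (E x r)) :: int)"
  have split: "sum (F E') (V - {u, p, r, v}) = F E' q + F E' s + sum (F E') (V - {u, p, r, v} - {q, s})"
    for E' :: "'a \<Rightarrow> 'a \<Rightarrow> bool"
  proof -
    have fin: "finite (V - {u, p, r, v})" using graph_on_finite[OF G] by simp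
    have "sum (F E') (V - {u, p, r, v}) = sum (F E') {q, s} + sum (F E') (V - {u, p, r, v} - {q, s})"
      using sum.subset_diff[of "{q, s}" "V - {u, p, r, v}" "F E'"] fin inV dist by auto
    then show ?thesis using dist by simp
  qed
  have rest: "sum (F E) (V - {u, p, r, v} - {q, s}) = sum (F ?S) (V - {u, p, r, v} - {q, s})"
    using dist by (intro sum.cong) (auto simp: F_def switch_def doubleton_eq_iff)
  have "sum (F E) (V - {u, p, r, v}) = 0" "sum (F ?S) (V - {u, p, r, v}) = 0"
    using alternating_triangles[OF U A] alternating_triangles[OF US AS] by (auto simp: F_def)
  then have "F E q + F E s = F ?S q + F ?S s" using split rest by simp
  moreover have "F E q = of_bool (E q p) - of_bool (E q r)" "F E s = of_bool (E s r) - of_bool (E s p)"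
    using u v sym by (auto simp: F_def)
  moreover have "F ?S q = of_bool (E q r) - of_bool (E q p)" "F ?S s = of_bool (E s p) - of_bool (E s r)"
    using u v sym dist by (auto simp: F_def switch_def doubleton_eq_iff)
  ultimately show ?thesis using sym by (auto split: if_splits)
qed


section \<open>Degree classes\<close>

definition degree_class :: "'a set \<Rightarrow> ('a \<Rightarrow> 'a \<Rightarrow> bool) \<Rightarrow> 'a set \<Rightarrow> bool" where
  "degree_class V E M \<longleftrightarrow> uniquely_realized V E \<and> (\<exists>m\<in>V. M = {x \<in> V. deg E x = deg E m})"

definition inner :: "('a \<Rightarrow> 'a \<Rightarrow> bool) \<Rightarrow> 'a set \<Rightarrow> 'a \<Rightarrow> nat" where
  "inner E M x = card (nbrs E x \<inter> M)"

lemma degree_class_unique: "degree_class V E M \<Longrightarrow> uniquely_realized V E"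
  and degree_class_graph: "degree_class V E M \<Longrightarrow> graph_on V E"
  and degree_class_subset: "degree_class V E M \<Longrightarrow> M \<subseteq> V"
  by (auto simp: degree_class_def uniquely_realized_def)

lemma degree_class_finite: "degree_class V E M \<Longrightarrow> finite M"
  by (meson degree_class_graph degree_class_subset finite_subset graph_on_finite)

lemma degree_class_same: "degree_class V E M \<Longrightarrow> x \<in> M \<Longrightarrow> y \<in> M \<Longrightarrow> deg E x = deg E y"
  and degree_class_differ: "degree_class V E M \<Longrightarrow> x \<in> M \<Longrightarrow> y \<in> V - M \<Longrightarrow> deg E x \<noteq> deg E y"
  by (auto simp: degree_class_def)

lemma degree_class_same_degrees:
  assumes "degree_class V E M" "graph_on V E'" "\<And>x. x \<in> V \<Longrightarrow> deg E' x = deg E x"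
  shows "degree_class V E' M"
proof -
  obtain m where "m \<in> V" "M = {x \<in> V. deg E x = deg E m}"
    using assms(1) by (auto simp: degree_class_def)
  then have "m \<in> V \<and> M = {x \<in> V. deg E' x = deg E' m}" using assms(3) by auto
  then show ?thesis
    using uniquely_realized_same_degrees[of V E E'] assms by (auto simp: degree_class_def)
qed

lemma degree_class_switch:
  assumes "degree_class V E M" "alternating E a b c d"
  shows "degree_class V (switch E a b c d) M"
  using assms degree_class_same_degrees deg_switch graph_on_switch degree_class_graph by metis

lemma degree_class_complement:
  assumes "degree_class V E M"
  shows "degree_class V (complement V E) M"
proof -
  obtain m where M: "m \<in> V" "M = {x \<in> V. deg E x = deg E m}"
    using assms by (auto simp: degree_class_def)
  have G: "graph_on V E" using assms by (rule degree_class_graph)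
  have "deg E x = deg E m \<longleftrightarrow> deg (complement V E) x = deg (complement V E) m" if "x \<in> V" for x
    using deg_complement[OF G that] deg_complement[OF G M(1)] by linarith
  then have "M = {x \<in> V. deg (complement V E) x = deg (complement V E) m}" using M by auto
  then show ?thesis
    using uniquely_realized_complement[OF degree_class_unique[OF assms]] M(1)
    by (auto simp: degree_class_def)
qed

lemma inner_complement:
  assumes "degree_class V E M" "x \<in> M"
  shows "inner (complement V E) M x + inner E M x + 1 = card M"
  using card_nbrs_complement[OF degree_class_graph[OF assms(1)] degree_class_subset[OF assms(1)] assms(2)]
  by (simp add: inner_def)

lemma inner_switch:
  assumes C: "degree_class V E M" and A: "alternating E a b c d"
    and m: "a \<in> M \<longleftrightarrow> d \<in> M" "b \<in> M \<longleftrightarrow> c \<in> M"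
  shows "inner (switch E a b c d) M x = inner E M x"
proof -
  have G: "graph_on V E" using C by (rule degree_class_graph)
  have e: "int (inner E' M y) = (\<Sum>z\<in>nbrs E' y. of_bool (z \<in> M))" if "graph_on V E'" for E' and y :: 'a
    using finite_nbrs[OF that, of y] by (simp add: inner_def of_bool_def sum.If_cases)
  have "int (inner (switch E a b c d) M x) = int (inner E M x)"
    unfolding e[OF G] e[OF graph_on_switch[OF G A]]
    using sum_nbrs_switch[OF G A, of "\<lambda>z. of_bool (z \<in> M)"] nbrs_switch(5)[OF G A, of x] m
    by (cases "x \<in> {a, b, c, d}") auto
  then show ?thesis by simp
qed

lemma inner_outer:
  assumes C: "degree_class V E M" and "x \<in> M" "y \<in> M"
  shows "inner E M x + card (nbrs E x - M) = inner E M y + card (nbrs E y - M)"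
proof -
  have "inner E M z + card (nbrs E z - M) = deg E z" for z
    using finite_nbrs[OF degree_class_graph[OF C], of z] unfolding inner_def deg_def
    by (metis card_Int_Diff)
  then show ?thesis using degree_class_same[OF assms] by simp
qed

text \<open>Otherwise \<open>m x m' z\<close> gives an alternating four-cycle in which both opposite pairs consist of
one vertex in the class and one outside it.\<close>

lemma outer_neighbours_adjacent:
  assumes C: "degree_class V E M" and m: "m \<in> M" "m' \<in> M" "m \<noteq> m'" "\<not> E m m'"
    and x: "x \<notin> M" "E m x" and z: "z \<notin> M" "E m' z" and "x \<noteq> z"
  shows "E x z"
proof (rule ccontr)
  assume "\<not> E x z"
  then have A: "alternating E m x m' z" using assms by (auto simp: alternating_def)
  have "x \<in> V - M" "z \<in> V - M" using x z graph_on_in[OF degree_class_graph[OF C]] by auto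
  then show False
    using alternating_same_degree[OF degree_class_unique[OF C] A] degree_class_differ[OF C] m
    by metis
qed

lemma outer_non_neighbours_not_adjacent:
  assumes C: "degree_class V E M" and m: "m \<in> M" "m' \<in> M" "E m m'"
    and x: "x \<notin> M" "\<not> E m x" and z: "z \<notin> M" "\<not> E m' z"
  shows "\<not> E x z"
proof
  assume "E x z"
  moreover have "m \<noteq> x" "m' \<noteq> z" using m x z by auto
  ultimately have A: "alternating E m m' x z" using assms by (auto simp: alternating_def)
  have "x \<in> V - M" "z \<in> V - M" using x z graph_on_in[OF degree_class_graph[OF C] \<open>E x z\<close>] by auto
  then show False
    using alternating_same_degree[OF degree_class_unique[OF C] A] degree_class_differ[OF C] m
    by metis
qed

text \<open>The switch at the four vertices turns an edge that leaves the class at \<open>m\<close> into an inner one,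
and does the opposite at \<open>m'\<close>.\<close>

lemma inner_succ:
  assumes C: "degree_class V E M" and m: "m \<in> M" "m' \<in> M" and x: "x \<notin> M" "E m x" "\<not> E m' x"
    and y: "y \<in> M" "E m' y" "\<not> E m y" "y \<noteq> m"
  shows "inner E M m' = inner E M m + 1"
proof -
  have G: "graph_on V E" using C by (rule degree_class_graph)
  note sym = graph_on_sym[OF G]
  have A: "alternating E m x y m'" using assms sym by (auto simp: alternating_def)
  obtain k where k: "M = {v \<in> V. deg E v = k}" using C by (auto simp: degree_class_def)
  have "x \<in> V" using x graph_on_in[OF G] by auto
  then have "deg E m = k" "deg E m' = k" "deg E y = k" "deg E x \<noteq> k" using k m x y by auto
  moreover have "nbrs E v \<inter> {u. deg E u = k} = nbrs E v \<inter> M" for v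
    using k nbrs_subset[OF G] by blast
  ultimately show ?thesis
    using alternating_count_in_class[OF degree_class_unique[OF C] A] by (simp add: inner_def)
qed

lemma inner_le_succ:
  assumes C: "degree_class V E M" and m: "m \<in> M" "m' \<in> M"
  shows "inner E M m \<le> inner E M m' + 1"
proof (rule ccontr)
  assume "\<not> ?thesis"
  then have less: "inner E M m' + 1 < inner E M m" by simp
  have G: "graph_on V E" using C by (rule degree_class_graph)
  have f: "finite (nbrs E v)" for v using finite_nbrs[OF G] .
  have "\<not> nbrs E m \<inter> M \<subseteq> insert m' (nbrs E m' \<inter> M)"
  proof
    assume "nbrs E m \<inter> M \<subseteq> insert m' (nbrs E m' \<inter> M)"
    then have "inner E M m \<le> card (insert m' (nbrs E m' \<inter> M))"
      unfolding inner_def using f by (intro card_mono) auto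
    also have "\<dots> \<le> inner E M m' + 1" unfolding inner_def using card_insert_le_m1 f
      by (simp add: card_insert_if)
    finally show False using less by simp
  qed
  then obtain y where y: "y \<in> M" "E m y" "\<not> E m' y" "y \<noteq> m'"
    unfolding subset_iff by (metis Int_iff in_nbrs insert_iff)
  have "card (nbrs E m - M) < card (nbrs E m' - M)" using inner_outer[OF C m] less by linarith
  then have "\<not> nbrs E m' - M \<subseteq> nbrs E m - M"
    using f by (meson card_mono finite_Diff leD)
  then obtain x where "x \<notin> M" "E m' x" "\<not> E m x" by (auto simp: subset_iff)
  then show False using inner_succ[OF C m(2,1), of x y] y less by simp
qed

lemma separated_neighbours:
  assumes C: "degree_class V E M" and m: "m \<in> M" "m' \<in> M" and x: "x \<notin> M" "E m x" "\<not> E m' x"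
    and le: "inner E M m' \<le> inner E M m"
  shows "nbrs E m' \<inter> M - {m} \<subseteq> nbrs E m"
  using inner_succ[OF C m x] le by fastforce

text \<open>If a vertex outside the class distinguishes two vertices of equal inner degree, nothing
inside the class does: a vertex inside that did would make the inner degrees differ by one.\<close>

lemma separated_twins:
  assumes C: "degree_class V E M" and m: "m \<in> M" "m' \<in> M" and x: "x \<notin> M" "E m x" "\<not> E m' x"
    and eq: "inner E M m' = inner E M m"
  shows "nbrs E m' \<inter> M - {m} = nbrs E m \<inter> M - {m'}"
proof -
  have G: "graph_on V E" using C by (rule degree_class_graph)
  have f: "finite (nbrs E v)" for v using finite_nbrs[OF G] .
  have ir: "\<not> E v v" for v using G by (rule graph_on_irrefl)
  have sub: "nbrs E m' \<inter> M - {m} \<subseteq> nbrs E m \<inter> M - {m'}"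
    using separated_neighbours[OF C m x] eq ir by auto
  have "card (nbrs E m' \<inter> M - {m}) = inner E M m' - of_bool (E m' m)"
    and "card (nbrs E m \<inter> M - {m'}) = inner E M m - of_bool (E m m')"
    unfolding inner_def using m f by (auto simp: card_Diff_singleton_if)
  then have "card (nbrs E m' \<inter> M - {m}) = card (nbrs E m \<inter> M - {m'})"
    using eq graph_on_sym[OF G, of m m'] by simp
  then show ?thesis using card_subset_eq[OF _ sub] f by simp
qed

section \<open>The structure of a degree class\<close>

text \<open>Any two vertices of \<open>H\<close> on different sides of \<open>x\<close> are twins. As both sides are nonempty,
going back and forth between them carries every pair to the pair \<open>h, h'\<close>.\<close>

lemma separated_level_homogeneous:
  assumes C: "degree_class V E M" and H: "H \<subseteq> M" "\<And>p q. p \<in> H \<Longrightarrow> q \<in> H \<Longrightarrow> inner E M p = inner E M q"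
    and h: "h \<in> H" "h' \<in> H" and x: "x \<notin> M" "E h x" "\<not> E h' x"
    and pq: "p \<in> H" "q \<in> H" "p \<noteq> q"
  shows "E p q \<longleftrightarrow> E h h'"
proof -
  have sym: "E u v \<longleftrightarrow> E v u" for u v using C by (meson degree_class_graph graph_on_sym)
  have twin: "E z u \<longleftrightarrow> E z v"
    if "u \<in> H" "v \<in> H" "E u x" "\<not> E v x" "z \<in> H" "z \<noteq> u" "z \<noteq> v" for u v z
  proof -
    have "nbrs E v \<inter> M - {u} = nbrs E u \<inter> M - {v}"
      using separated_twins[OF C _ _ x(1) that(3,4) H(2)[OF that(2,1)]] that(1,2) H(1) by blast
    then have "z \<in> nbrs E v \<inter> M - {u} \<longleftrightarrow> z \<in> nbrs E u \<inter> M - {v}" by simp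
    then show ?thesis using that H(1) sym by auto
  qed
  have sep: "E u v \<longleftrightarrow> E h h'" if "u \<in> H" "v \<in> H" "E u x" "\<not> E v x" for u v
  proof -
    have "E u v \<longleftrightarrow> E u h'"
    proof (cases "u = h")
      case True
      show ?thesis
      proof (cases "v = h'")
        case False
        have "v \<noteq> h" using that(4) x(2) by auto
        have "E v h \<longleftrightarrow> E v h'" using twin[of h h' v] h x that False \<open>v \<noteq> h\<close> by auto
        moreover have "E h' u \<longleftrightarrow> E h' v" using twin[of u v h'] that h x False True by auto
        ultimately show ?thesis using True sym by metis
      qed simp
    next
      case False
      have "E u h \<longleftrightarrow> E u v" using twin[of h v u] that h x False by auto
      moreover have "E u h \<longleftrightarrow> E u h'" using twin[of h h' u] that h x False by auto
      ultimately show ?thesis by simp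
    qed
    moreover have "E u h' \<longleftrightarrow> E h h'"
    proof (cases "u = h")
      case False
      have "u \<noteq> h'" "h \<noteq> h'" using that x by auto
      have "E h u \<longleftrightarrow> E h h'" using twin[of u h' h] that h x False \<open>h \<noteq> h'\<close> by auto
      moreover have "E u h \<longleftrightarrow> E u h'" using twin[of h h' u] that h x False \<open>u \<noteq> h'\<close> by auto
      ultimately show ?thesis using sym by metis
    qed simp
    ultimately show ?thesis by simp
  qed
  consider "E p x" "E q x" | "E p x" "\<not> E q x" | "\<not> E p x" "E q x" | "\<not> E p x" "\<not> E q x" by blast
  then show ?thesis
  proof cases
    case 1
    then have "p \<noteq> h'" using x by auto
    have "E p q \<longleftrightarrow> E p h'" using twin[of q h' p] 1 pq h x \<open>p \<noteq> h'\<close> by auto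
    then show ?thesis using sep[of p h'] 1 pq h x by simp
  next
    case 2
    then show ?thesis using sep pq by simp
  next
    case 3
    then show ?thesis using sep[of q p] pq sym by metis
  next
    case 4
    then have "p \<noteq> h" using x by auto
    have "E p h \<longleftrightarrow> E p q" using twin[of h q p] 4 pq h x \<open>p \<noteq> h\<close> by auto
    then show ?thesis using sep[of h p] 4 pq h x sym by metis
  qed
qed

text \<open>If \<open>x\<close> distinguishes \<open>h\<close> and \<open>h'\<close>, these two are twins inside the class. If they are not
adjacent, then an inner switch in their common neighbourhood produces a realization in which
they are no longer twins, although \<open>x\<close> still distinguishes them. If they are adjacent, the
rules for neighbours and non-neighbours outside the class force them to be adjacent to the
whole class, while each vertex of the lower level misses exactly one vertex, also of the lower
level. Such a non-adjacent pair then has too many neighbours outside the class to obey the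
same rules.\<close>

lemma upper_level_not_separated:
  assumes C: "degree_class V E M" and h: "h \<in> M" "h' \<in> M" "inner E M h = r" "inner E M h' = r"
    and l: "l \<in> M" "inner E M l + 1 = r" and x: "x \<notin> M" "E h x"
  shows "E h' x"
proof (rule ccontr)
  assume nx: "\<not> E h' x"
  have G: "graph_on V E" using C by (rule degree_class_graph)
  note sym = graph_on_sym[OF G]
  have ir: "\<not> E v v" for v using G by (rule graph_on_irrefl)
  have f: "finite (nbrs E v)" for v using finite_nbrs[OF G] .
  have fM: "finite M" using C by (rule degree_class_finite)
  have hh: "h \<noteq> h'" using x nx by auto
  have tw: "nbrs E h' \<inter> M - {h} = nbrs E h \<inter> M - {h'}"
    using separated_twins[OF C h(1,2) x nx] h by simp
  have lev: "inner E M m = r \<or> inner E M m + 1 = r" if "m \<in> M" for m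
    using inner_le_succ[OF C that l(1)] inner_le_succ[OF C h(1) that] h(3) l(2) by linarith
  show False
  proof (cases "E h h'")
    case False
    define N where "N = nbrs E h \<inter> M"
    have N: "nbrs E h \<inter> M = N" "nbrs E h' \<inter> M = N" "card N = r" "finite N"
      using tw False sym[of h h'] h f ir by (auto simp: N_def inner_def)
    have clique: "E p q" if pq: "p \<in> N" "q \<in> N" "p \<noteq> q" for p q
    proof (rule ccontr)
      assume npq: "\<not> E p q"
      have e: "E h p" "E h q" "E h' p" "E h' q" "p \<in> M" "q \<in> M" using pq N by auto
      have A: "alternating E h p h' q" using e False npq hh pq by (auto simp: alternating_def)
      \<comment> \<open>After this switch \<open>p\<close> distinguishes \<open>h\<close> and \<open>h'\<close>, and so does \<open>x\<close>, at unchanged inner degrees.\<close>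
      let ?S = "switch E h p h' q"
      have CS: "degree_class V ?S M" using C A by (rule degree_class_switch)
      have iS: "inner ?S M v = inner E M v" for v
        using inner_switch[OF C A] h e by simp
      have xS: "?S h x" "\<not> ?S h' x"
        using x nx h e by (auto simp: switch_def doubleton_eq_iff)
      have "nbrs ?S h' \<inter> M - {h} = nbrs ?S h \<inter> M - {h'}"
        using separated_twins[OF CS h(1,2) x(1) xS] iS h by simp
      moreover have "?S h' p" "\<not> ?S h p"
        using e pq hh ir by (auto simp: switch_def doubleton_eq_iff)
      moreover have "p \<noteq> h" using e(1) ir[of h] by metis
      ultimately show False using e(5) by (metis DiffE DiffI IntE IntI in_nbrs singletonD)
    qed
    have "N \<noteq> {}" using N(3) l(2) by auto
    then obtain p where p: "p \<in> N" by blast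
    have "E h p" "E h' p" "N \<subseteq> M" using p N(1,2) by auto
    then have "E p h" "E p h'" using sym by blast+
    moreover have "N - {p} \<subseteq> nbrs E p" using clique[OF p] unfolding subset_iff by (metis DiffE in_nbrs singletonI)
    ultimately have "insert h (insert h' (N - {p})) \<subseteq> nbrs E p \<inter> M"
      using h(1,2) \<open>N \<subseteq> M\<close> by auto
    then have "card (insert h (insert h' (N - {p}))) \<le> inner E M p"
      unfolding inner_def using f by (intro card_mono) auto
    moreover have "h \<notin> N" "h' \<notin> N" using False ir by (auto simp: N_def)
    ultimately have "r + 1 \<le> inner E M p"
      using p N hh l(2) by (simp add: card_Diff_singleton)
    moreover have "p \<in> M" using p N by auto
    ultimately show False using lev[of p] by linarith
  next
    case True
    let ?X = "nbrs E h - M" and ?Y = "nbrs E h' - M"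
    have XY: "card ?X = card ?Y" using inner_outer[OF C h(1,2)] h by simp
    have low: "card (nbrs E m - M) = card ?X + 1" if "m \<in> M" "inner E M m + 1 = r" for m
      using inner_outer[OF C h(1) that(1)] that h by linarith
    have lh: "E m h" if m: "m \<in> M" "inner E M m + 1 = r" for m
    proof (rule ccontr)
      assume "\<not> E m h"
      then have nm: "\<not> E h m" "m \<noteq> h" using sym m h by auto
      have "\<not> nbrs E m - M \<subseteq> ?X"
        using low[OF m] f by (metis Suc_eq_plus1 Suc_n_not_le_n card_mono finite_Diff)
      then obtain y where y: "y \<notin> M" "E m y" "\<not> E h y" by (auto simp: subset_iff)
      then have "E x y"
        using outer_neighbours_adjacent[OF C h(1) m(1) _ nm(1) x, of y] nm x by metis
      moreover have "\<not> E x y"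
        using outer_non_neighbours_not_adjacent[OF C h(2,1) _ x(1) nx y(1,3)] True sym by simp
      ultimately show False by simp
    qed
    \<comment> \<open>The level of \<open>h\<close> is a clique, since it is homogeneous and contains the edge \<open>h h'\<close>.\<close>
    have all: "E p h" if p: "p \<in> M" "p \<noteq> h" for p
    proof (cases "inner E M p = r")
      case True
      have "E p h \<longleftrightarrow> E h h'"
        by (rule separated_level_homogeneous[OF C, of "{m \<in> M. inner E M m = r}" h h' x])
          (use p h x nx True in auto)
      then show ?thesis using \<open>E h h'\<close> by simp
    qed (use lev[OF p(1)] lh p in auto)
    have star: "nbrs E h \<inter> M = M - {h}"
    proof
      show "nbrs E h \<inter> M \<subseteq> M - {h}" using ir[of h] by auto
      show "M - {h} \<subseteq> nbrs E h \<inter> M" using all sym[of h] unfolding subset_iff by (metis DiffE IntI in_nbrs singletonI)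
    qed
    have upper: "p = q \<or> E p q" if "p \<in> M" "inner E M p = r" "q \<in> M" for p q
    proof -
      have "r = card M - 1" using h star by (simp add: inner_def fM card_Diff_singleton)
      then have "card (nbrs E p \<inter> M) = card (M - {p})"
        using that by (simp add: inner_def fM card_Diff_singleton)
      then have "nbrs E p \<inter> M = M - {p}"
        using ir[of p] fM by (intro card_subset_eq) auto
      then show ?thesis using that(3) by (metis DiffI Int_iff in_nbrs singletonD)
    qed
    obtain k where k: "k \<in> M" "k \<noteq> l" "\<not> E l k"
    proof -
      have "r = card M - 1" using h star by (simp add: inner_def fM card_Diff_singleton)
      then have "card (nbrs E l \<inter> M) < card (M - {l})"
        using l by (simp add: inner_def fM card_Diff_singleton)
      then have "\<not> M - {l} \<subseteq> nbrs E l \<inter> M" using f by (metis card_mono finite_Int leD)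
      then obtain k where "k \<in> M - {l}" "k \<notin> nbrs E l \<inter> M" unfolding subset_iff by metis
      then show thesis using that[of k] by simp
    qed
    then have kl: "inner E M k + 1 = r" using upper[of k l] lev[of k] sym[of k l] l(1) by blast
    \<comment> \<open>A neighbour \<open>d\<close> of \<open>p\<close> elsewhere would be adjacent to all other outer neighbours of \<open>q\<close> as \<open>p\<close>, \<open>q\<close> are not adjacent, but
         to none outside \<open>?X \<inter> ?Y\<close> as \<open>h\<close>, \<open>h'\<close> are, so \<open>q\<close> would have too few of them.\<close>
    have noD: "nbrs E p - M \<subseteq> ?X \<union> ?Y"
      if pq: "p \<in> M" "inner E M p + 1 = r" "q \<in> M" "inner E M q + 1 = r" "p \<noteq> q" "\<not> E p q" for p q
    proof
      fix d assume d: "d \<in> nbrs E p - M"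
      show "d \<in> ?X \<union> ?Y"
      proof (rule ccontr)
        assume nd: "d \<notin> ?X \<union> ?Y"
        have "nbrs E q - M \<subseteq> insert d (?X \<inter> ?Y)"
        proof
          fix y assume y: "y \<in> nbrs E q - M"
          show "y \<in> insert d (?X \<inter> ?Y)"
          proof (rule ccontr)
            assume ny: "y \<notin> insert d (?X \<inter> ?Y)"
            have "E d y"
              using outer_neighbours_adjacent[OF C pq(1,3,5,6), of d y] d y ny by simp blast
            moreover have "\<not> E d y"
              using outer_non_neighbours_not_adjacent[OF C h(2,1), of d y]
                outer_non_neighbours_not_adjacent[OF C h(1,2), of d y] True sym[of h h'] d nd y ny
              by simp blast
            ultimately show False by simp
          qed
        qed
        then have "card (nbrs E q - M) \<le> card (insert d (?X \<inter> ?Y))"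
          using f by (intro card_mono) auto
        also have "\<dots> \<le> card (?X \<inter> ?Y) + 1" using f by (simp add: card_insert_if)
        also have "card (?X \<inter> ?Y) < card ?X"
          using f x nx by (intro psubset_card_mono) auto
        finally show False using low[OF pq(3,4)] by linarith
      qed
    qed
    have sub: "nbrs E l - M \<subseteq> ?X \<union> ?Y" "nbrs E k - M \<subseteq> ?X \<union> ?Y"
      using noD[OF l k(1) kl] noD[OF k(1) kl l] k sym[of k l] by simp_all
    have "\<not> nbrs E l - M \<subseteq> ?Y"
      using low[OF l] XY f by (metis Suc_eq_plus1 Suc_n_not_le_n card_mono finite_Diff)
    then obtain y where y: "y \<in> nbrs E l - M" "y \<notin> ?Y" by blast
    have "\<not> nbrs E k - M \<subseteq> ?X"
      using low[OF k(1) kl] f by (metis Suc_eq_plus1 Suc_n_not_le_n card_mono finite_Diff)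
    then obtain z where z: "z \<in> nbrs E k - M" "z \<notin> ?X" by blast
    have "y \<noteq> z" using sub y z by blast
    have "E y z"
      by (rule outer_neighbours_adjacent[OF C l(1) k(1)]) (use y z k \<open>y \<noteq> z\<close> in auto)
    moreover have "\<not> E y z"
      by (rule outer_non_neighbours_not_adjacent[OF C h(2,1)]) (use y z True sym[of h h'] in auto)
    ultimately show False by simp
  qed
qed

text \<open>Complementation exchanges the two levels.\<close>

lemma lower_level_not_separated:
  assumes C: "degree_class V E M" and l: "l \<in> M" "l' \<in> M" "inner E M l + 1 = r" "inner E M l' + 1 = r"
    and h: "h \<in> M" "inner E M h = r" and x: "x \<notin> M" "E l x"
  shows "E l' x"
proof (rule ccontr)
  assume nx: "\<not> E l' x"
  let ?C = "complement V E"
  have CC: "degree_class V ?C M" using C by (rule degree_class_complement)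
  have i: "inner ?C M m + inner E M m + 1 = card M" if "m \<in> M" for m
    using inner_complement[OF C that] .
  have V: "x \<in> V" "l \<in> V" "l' \<in> V"
    using x l graph_on_in[OF degree_class_graph[OF C]] degree_class_subset[OF C] by auto
  have "?C l' x" using nx V x l by (auto simp: complement_def)
  then have "?C l x"
    using upper_level_not_separated[OF CC l(2,1) _ _ h(1), of "card M - r" x]
      i[OF l(1)] i[OF l(2)] i[OF h(1)] l h x by linarith
  then show False using x by (simp add: complement_def)
qed

text \<open>Otherwise a switch that moves \<open>x\<close> from \<open>h\<close> to \<open>l\<close> leaves the inner edges unchanged but makes
\<open>x\<close> distinguish two vertices of the same level, as soon as the class has a third vertex.\<close>

lemma upper_neighbour_is_lower_neighbour:
  assumes C: "degree_class V E M" and h: "h \<in> M" "inner E M h = r"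
    and l: "l \<in> M" "inner E M l + 1 = r" and x: "x \<notin> M" "E h x"
  shows "E l x"
proof (rule ccontr)
  assume nx: "\<not> E l x"
  have G: "graph_on V E" using C by (rule degree_class_graph)
  note sym = graph_on_sym[OF G]
  have ir: "\<not> E v v" for v using G by (rule graph_on_irrefl)
  have f: "finite (nbrs E v)" for v using finite_nbrs[OF G] .
  have hl: "h \<noteq> l" using x nx by auto
  have "card (nbrs E l - M) = card (nbrs E h - M) + 1"
    using inner_outer[OF C h(1) l(1)] h l by linarith
  then have "\<not> nbrs E l - M \<subseteq> nbrs E h - M"
    using f by (metis Suc_eq_plus1 Suc_n_not_le_n card_mono finite_Diff)
  then obtain z where z: "z \<notin> M" "E l z" "\<not> E h z" by (auto simp: subset_iff)
  have A: "alternating E h x z l" using x nx z h l sym by (auto simp: alternating_def)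
  let ?S = "switch E h x z l"
  have CS: "degree_class V ?S M" using C A by (rule degree_class_switch)
  have iS: "inner ?S M v = inner E M v" for v using inner_switch[OF C A] h l x z by simp
  have S: "?S l x" "\<not> ?S h x"
    using x z h l ir by (auto simp: switch_def doubleton_eq_iff)
  have "M \<noteq> {h, l}"
  proof
    assume "M = {h, l}"
    then have "nbrs E h \<inter> M = (if E h l then {l} else {})" "nbrs E l \<inter> M = (if E h l then {h} else {})"
      using ir sym by auto
    then show False using h l by (auto simp: inner_def split: if_splits)
  qed
  then obtain m where m: "m \<in> M" "m \<noteq> h" "m \<noteq> l" using h l by blast
  have Sm: "?S m x \<longleftrightarrow> E m x" using m x h(1) l(1) by (auto simp: switch_def doubleton_eq_iff)
  have "inner E M m = r \<or> inner E M m + 1 = r"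
    using inner_le_succ[OF C m(1) l(1)] inner_le_succ[OF C h(1) m(1)] h l by linarith
  then show False
  proof
    assume r: "inner E M m = r"
    then have "E m x" using upper_level_not_separated[OF C h(1) m(1) h(2) r l x] by simp
    then have "?S h x"
      using upper_level_not_separated[OF CS m(1) h(1), of r l x] iS r h l x Sm by simp
    then show False using S by simp
  next
    assume r: "inner E M m + 1 = r"
    have "?S m x" using lower_level_not_separated[OF CS l(1) m(1), of r h x] iS r h l x S by simp
    then have "E l x" using lower_level_not_separated[OF C m(1) l(1) r l(2) h x(1)] Sm by simp
    then show False using nx by simp
  qed
qed

text \<open>The vertex \<open>o'\<close> is the one possible exception; if there is none, its value is arbitrary. If
all inner degrees are equal, \<open>r\<close> can be this degree or the next one. This freedom makes the
notion invariant under complementation, with \<open>card M - r\<close> in place of \<open>r\<close>.\<close>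

definition nearly_regular_class ::
    "'a set \<Rightarrow> ('a \<Rightarrow> 'a \<Rightarrow> bool) \<Rightarrow> 'a set \<Rightarrow> nat \<Rightarrow> 'a \<Rightarrow> bool" where
  "nearly_regular_class V E M r o' \<longleftrightarrow> degree_class V E M \<and>
     (\<forall>m\<in>M. inner E M m = r \<or> inner E M m + 1 = r) \<and>
     (\<forall>x\<in>V - M. (\<forall>m\<in>M. E m x) \<or> (\<forall>m\<in>M. \<not> E m x) \<or>
        (x = o' \<and> (\<forall>m\<in>M. E m x \<longleftrightarrow> inner E M m + 1 = r)))"

text \<open>If there are two levels, a vertex outside the class sees each level as a whole, and whatever
sees the upper level sees the lower one. A vertex of the lower level has exactly one more
neighbour outside the class than one of the upper level, so there is only one exceptional
vertex.\<close>

lemma nearly_regular_class_exists: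
  assumes C: "degree_class V E M" and e: "p \<in> M" "q \<in> M" "E p q"
    and n: "p' \<in> M" "q' \<in> M" "p' \<noteq> q'" "\<not> E p' q'"
  obtains r o' where "nearly_regular_class V E M r o'"
proof (cases "\<forall>m\<in>M. inner E M m = inner E M p")
  case True
  have "(\<forall>m\<in>M. E m x) \<or> (\<forall>m\<in>M. \<not> E m x)" if "x \<in> V - M" for x
  proof (rule ccontr)
    assume "\<not> ?thesis"
    then obtain h h' where h: "h \<in> M" "E h x" "h' \<in> M" "\<not> E h' x" by blast
    have "p \<noteq> q" using e graph_on_irrefl[OF degree_class_graph[OF C]] by auto
    have "E u v \<longleftrightarrow> E h h'" if "u \<in> M" "v \<in> M" "u \<noteq> v" for u v
      using separated_level_homogeneous[OF C subset_refl, of h h' x u v] that h True \<open>x \<in> V - M\<close> by simp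
    then show False using e n \<open>p \<noteq> q\<close> by metis
  qed
  then have "nearly_regular_class V E M (inner E M p) p"
    unfolding nearly_regular_class_def using C True by blast
  then show thesis by (rule that)
next
  case False
  then obtain u where u: "u \<in> M" "inner E M u \<noteq> inner E M p" by blast
  have "\<exists>h l. h \<in> M \<and> l \<in> M \<and> inner E M l + 1 = inner E M h"
  proof -
    have "inner E M p = inner E M u + 1 \<or> inner E M u = inner E M p + 1"
      using inner_le_succ[OF C e(1) u(1)] inner_le_succ[OF C u(1) e(1)] u(2) by linarith
    then show ?thesis using u(1) e(1) by metis
  qed
  then obtain h l where hl: "h \<in> M" "l \<in> M" "inner E M l + 1 = inner E M h" by blast
  let ?r = "inner E M h"
  have lev: "inner E M m = ?r \<or> inner E M m + 1 = ?r" if "m \<in> M" for m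
    using inner_le_succ[OF C that hl(2)] inner_le_succ[OF C hl(1) that] hl(3) by linarith
  have f: "finite (nbrs E v)" for v using finite_nbrs[OF degree_class_graph[OF C]] .
  let ?mixed = "\<lambda>x. x \<notin> M \<and> E l x \<and> \<not> E h x"
  have hom: "(\<forall>m\<in>M. E m x) \<or> (\<forall>m\<in>M. \<not> E m x) \<or>
      (?mixed x \<and> (\<forall>m\<in>M. E m x \<longleftrightarrow> inner E M m + 1 = ?r))" if "x \<in> V - M" for x
  proof -
    have x: "x \<notin> M" using that by simp
    have up: "E m x \<longleftrightarrow> E h x" if "m \<in> M" "inner E M m = ?r" for m
      using upper_level_not_separated[OF C hl(1) that(1) refl that(2) hl(2,3) x]
        upper_level_not_separated[OF C that(1) hl(1) that(2) refl hl(2,3) x] by blast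
    have lo: "E m x \<longleftrightarrow> E l x" if "m \<in> M" "inner E M m + 1 = ?r" for m
      using lower_level_not_separated[OF C hl(2) that(1) hl(3) that(2) hl(1) refl x]
        lower_level_not_separated[OF C that(1) hl(2) that(2) hl(3) hl(1) refl x] by blast
    have "E h x \<longrightarrow> E l x"
      using upper_neighbour_is_lower_neighbour[OF C hl(1) refl hl(2,3) x] by blast
    then consider "E h x" "E l x" | "\<not> E h x" "\<not> E l x" | "\<not> E h x" "E l x" by blast
    then show ?thesis
    proof cases
      case 3
      have "E m x \<longleftrightarrow> inner E M m + 1 = ?r" if m: "m \<in> M" for m
      proof (cases "inner E M m = ?r")
        case True
        then show ?thesis using up[OF m True] 3 by simp
      next
        case False
        then have l: "inner E M m + 1 = ?r" using lev[OF m] by simp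
        then show ?thesis using lo[OF m l] 3 by simp
      qed
      then show ?thesis using 3 x by blast
    qed (use up lo lev in blast)+
  qed
  have uniq: "x = y" if "?mixed x" "?mixed y" for x y
  proof (rule ccontr)
    assume "x \<noteq> y"
    have "nbrs E h - M \<subseteq> nbrs E l - M"
      using upper_neighbour_is_lower_neighbour[OF C hl(1) refl hl(2,3)] by auto
    then have "insert x (insert y (nbrs E h - M)) \<subseteq> nbrs E l - M" using that by auto
    then have "card (insert x (insert y (nbrs E h - M))) \<le> card (nbrs E l - M)"
      using f by (intro card_mono) auto
    then have "card (nbrs E h - M) + 2 \<le> card (nbrs E l - M)"
      using that \<open>x \<noteq> y\<close> f by simp
    then show False using inner_outer[OF C hl(1,2)] hl(3) by linarith
  qed
  obtain o' where "\<And>x. ?mixed x \<Longrightarrow> x = o'" using uniq by (cases "\<exists>x. ?mixed x") blast+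
  then have "nearly_regular_class V E M ?r o'"
    unfolding nearly_regular_class_def using C lev hom by blast
  then show thesis by (rule that)
qed

section \<open>A large clique in a nearly regular class\<close>

lemma nearly_regular_class_degree_class: "nearly_regular_class V E M r o' \<Longrightarrow> degree_class V E M"
  by (simp add: nearly_regular_class_def)

lemma nearly_regular_class_switch:
  assumes N: "nearly_regular_class V E M r o'" and A: "alternating E a b c d"
    and m: "a \<in> M" "b \<in> M" "c \<in> M" "d \<in> M"
  shows "nearly_regular_class V (switch E a b c d) M r o'"
    and "inner (switch E a b c d) M x = inner E M x"
proof -
  have C: "degree_class V E M" using N by (rule nearly_regular_class_degree_class)
  have i: "inner (switch E a b c d) M x = inner E M x" for x
    using inner_switch[OF C A] m by simp
  show "inner (switch E a b c d) M x = inner E M x" by (rule i)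
  have "switch E a b c d m x \<longleftrightarrow> E m x" if "x \<notin> M" for m x
    using that m by (auto simp: switch_def doubleton_eq_iff)
  then show "nearly_regular_class V (switch E a b c d) M r o'"
    using N degree_class_switch[OF C A] i unfolding nearly_regular_class_def by simp
qed

text \<open>Among all realizations reachable by switches inside the class, one with as many edges in \<open>Q\<close>
as possible is taken. Two non-adjacent vertices \<open>x\<close>, \<open>y\<close> of \<open>Q\<close> have neighbours \<open>u\<close>, \<open>v\<close> in
\<open>M - Q\<close>, and as \<open>M - Q\<close> is large, it contains a vertex \<open>p\<close> not adjacent to \<open>u\<close>. By maximality
no sequence of one or two switches creates the edge \<open>xy\<close> without losing another one in \<open>Q\<close>.
This forces the inner neighbourhood of \<open>p\<close> into that of \<open>v\<close>, up to \<open>v\<close> itself, with at least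
two vertices to spare, but inner degrees differ by at most one.\<close>

lemma clique_realization:
  assumes N: "nearly_regular_class V E M r o'" and QM: "Q \<subseteq> M"
    and Q: "\<And>x. x \<in> Q \<Longrightarrow> card Q \<le> inner E M x + 1" and B: "r < card (M - Q)"
  obtains E' where "nearly_regular_class V E' M r o'" "\<And>x. inner E' M x = inner E M x"
    "\<And>x y. x \<in> Q \<Longrightarrow> y \<in> Q \<Longrightarrow> x \<noteq> y \<Longrightarrow> E' x y"
proof -
  define R where "R = (\<lambda>E'. nearly_regular_class V E' M r o' \<and> (\<forall>x. inner E' M x = inner E M x))"
  define e where "e = (\<lambda>E' :: 'a \<Rightarrow> 'a \<Rightarrow> bool. card {(x, y). x \<in> Q \<and> y \<in> Q \<and> E' x y})"
  have fM: "finite M" using N nearly_regular_class_degree_class degree_class_finite by metis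
  have fQ: "finite Q" using QM fM by (rule finite_subset)
  have sub: "{(x, y). x \<in> Q \<and> y \<in> Q \<and> E' x y} \<subseteq> Q \<times> Q" for E' by auto
  have fin: "finite {(x, y). x \<in> Q \<and> y \<in> Q \<and> E' x y}" for E'
    using finite_subset[OF sub] fQ by blast
  have RG: "graph_on V E'" if "R E'" for E'
    using that by (auto simp: R_def nearly_regular_class_def intro: degree_class_graph)
  have Rswitch: "R (switch E' a b c d)"
    if "R E'" "alternating E' a b c d" "a \<in> M" "b \<in> M" "c \<in> M" "d \<in> M" for E' a b c d
    using that nearly_regular_class_switch[of V E' M r o' a b c d] by (simp add: R_def)
  have "e E' \<le> card (Q \<times> Q)" for E'
    unfolding e_def using fQ sub by (intro card_mono) auto
  then have "\<forall>E'. R E' \<longrightarrow> e E' < card (Q \<times> Q) + 1" by (simp add: less_Suc_eq_le)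
  moreover have "R E" using N by (simp add: R_def)
  ultimately obtain E' where R: "R E'" and max: "\<And>E''. R E'' \<Longrightarrow> e E'' \<le> e E'"
    using ex_has_greatest_nat[of R E e "card (Q \<times> Q) + 1"] by blast
  have gain: "\<exists>E2. R E2 \<and> e E1 < e E2"
    if R1: "R E1" and xy: "x \<in> Q" "y \<in> Q" "x \<noteq> y" "\<not> E1 x y"
      and uv: "u \<in> M - Q" "v \<in> M - Q" "E1 x u" "E1 y v" "u \<noteq> v" "\<not> E1 u v" for E1 x y u v
  proof -
    have A: "alternating E1 x u y v" using xy uv by (auto simp: alternating_def)
    let ?S = "switch E1 x u y v"
    have "{(x, y). x \<in> Q \<and> y \<in> Q \<and> E1 x y} \<subset> {(x, y). x \<in> Q \<and> y \<in> Q \<and> ?S x y}"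
    proof
      show "{(x, y). x \<in> Q \<and> y \<in> Q \<and> E1 x y} \<subseteq> {(x, y). x \<in> Q \<and> y \<in> Q \<and> ?S x y}"
        using uv by (auto simp: switch_def doubleton_eq_iff)
      have "?S x y" by (simp add: switch_def)
      then show "{(x, y). x \<in> Q \<and> y \<in> Q \<and> E1 x y} \<noteq> {(x, y). x \<in> Q \<and> y \<in> Q \<and> ?S x y}"
        using xy by auto
    qed
    then have "e E1 < e ?S" unfolding e_def by (rule psubset_card_mono[OF fin])
    moreover have "R ?S" using Rswitch[OF R1 A] xy uv QM by blast
    ultimately show ?thesis by blast
  qed
  have max': False if "x \<in> Q" "y \<in> Q" "x \<noteq> y" "\<not> E' x y" "u \<in> M - Q" "v \<in> M - Q"
    "E' x u" "E' y v" "u \<noteq> v" "\<not> E' u v" for x y u v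
    using gain[OF R that] max by (meson leD)
  have C: "degree_class V E' M" using R by (simp add: R_def nearly_regular_class_def)
  have G: "graph_on V E'" using R by (rule RG)
  note sym = graph_on_sym[OF G]
  have ir: "\<not> E' v v" for v using G by (rule graph_on_irrefl)
  have f: "finite (nbrs E' v)" for v using finite_nbrs[OF G] .
  have lev: "inner E' M m \<le> r" if "m \<in> M" for m
    using R that by (auto simp: R_def nearly_regular_class_def)
  have outside: "\<exists>u\<in>M - Q. E' x u" if xy: "x \<in> Q" "y \<in> Q" "x \<noteq> y" "\<not> E' x y" for x y
  proof (rule ccontr)
    assume "\<not> ?thesis"
    then have "nbrs E' x \<inter> M \<subseteq> Q - {x, y}" using xy ir by auto
    then have "inner E' M x \<le> card (Q - {x, y})" unfolding inner_def using fQ by (intro card_mono) auto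
    also have "\<dots> = card Q - 2" using xy fQ by (simp add: card_Diff_subset)
    finally have "inner E M x \<le> card Q - 2" using R by (simp add: R_def)
    moreover have "2 \<le> card Q" using xy fQ card_mono[of Q "{x, y}"] by auto
    ultimately show False using Q[OF xy(1)] by linarith
  qed
  have "E' x y" if xy: "x \<in> Q" "y \<in> Q" "x \<noteq> y" for x y
  proof (rule ccontr)
    assume nxy: "\<not> E' x y"
    obtain u where u: "u \<in> M - Q" "E' x u" using outside[OF xy nxy] by blast
    obtain v where v: "v \<in> M - Q" "E' y v" using outside[of y x] xy nxy sym by metis
    have uv: "u = v \<or> E' u v" using max'[OF xy nxy u(1) v(1) u(2) v(2)] by blast
    have "card (insert u (nbrs E' u \<inter> M - {x})) \<le> r"
    proof -
      have "x \<in> nbrs E' u \<inter> M" using u xy QM sym by auto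
      then have "card (nbrs E' u \<inter> M - {x}) < inner E' M u"
        unfolding inner_def using f by (intro psubset_card_mono) auto
      then show ?thesis using lev[of u] u f by (simp add: card_insert_if)
    qed
    then have "\<not> M - Q \<subseteq> insert u (nbrs E' u \<inter> M - {x})"
      using B f by (metis card_mono finite.insertI finite_Diff finite_Int leD le_trans)
    then obtain p where p: "p \<in> M - Q" "p \<noteq> u" "\<not> E' u p"
      unfolding subset_iff using xy(1) by (metis DiffD1 DiffD2 DiffI IntI in_nbrs insert_iff singletonD)
    have yp: "\<not> E' y p" using max'[OF xy nxy u(1) p(1) u(2)] p by blast
    have sub: "q = v \<or> E' q v" if q: "q \<in> M" "E' p q" for q
    proof (rule ccontr)
      assume nq: "\<not> ?thesis"
      have A: "alternating E' y v p q"
        using v q yp nq p xy sym by (auto simp: alternating_def)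
      \<comment> \<open>This switch keeps the edges in \<open>Q\<close> and makes \<open>p\<close> a neighbour of \<open>y\<close>, so that a second one creates \<open>xy\<close>.\<close>
      let ?S = "switch E' y v p q"
      have RS: "R ?S" using Rswitch[OF R A] xy v p q QM by blast
      have "?S x u" "?S y p" "\<not> ?S x y" "\<not> ?S u p"
        using u v p q xy nxy nq sym ir by (auto simp: switch_def doubleton_eq_iff)
      then obtain E2 where "R E2" "e ?S < e E2" using gain[OF RS xy _ u(1) p(1)] p by blast
      moreover have "{(x, y). x \<in> Q \<and> y \<in> Q \<and> ?S x y} = {(x, y). x \<in> Q \<and> y \<in> Q \<and> E' x y}"
        using v p by (auto simp: switch_def doubleton_eq_iff)
      ultimately show False using max by (auto simp: e_def dest: leD)
    qed
    have le: "inner E' M p + 2 \<le> inner E' M v"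
    proof (cases "E' p v")
      case True
      then have "u \<noteq> v" using p sym by auto
      then have "E' u v" using uv by simp
      have "nbrs E' p \<inter> M \<subseteq> insert v (nbrs E' v \<inter> M - {u, y, p})"
      proof
        fix q assume q: "q \<in> nbrs E' p \<inter> M"
        then have "q \<noteq> u" "q \<noteq> y" "q \<noteq> p" using p yp ir sym[of p] by auto
        then show "q \<in> insert v (nbrs E' v \<inter> M - {u, y, p})" using q sub[of q] sym[of q v] by auto
      qed
      then have "inner E' M p \<le> card (insert v (nbrs E' v \<inter> M - {u, y, p}))"
        unfolding inner_def using f by (intro card_mono) auto
      moreover have "{u, y, p} \<subseteq> nbrs E' v \<inter> M"
        using \<open>E' u v\<close> v True u p xy QM sym by auto
      moreover have "u \<noteq> y" "y \<noteq> p" using u p xy by auto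
      then have "card {u, y, p} = 3" using p(2) by simp
      ultimately show ?thesis
        using f card_mono[of "nbrs E' v \<inter> M" "{u, y, p}"]
        by (simp add: inner_def card_Diff_subset card_insert_if split: if_splits)
    next
      case False
      have pv: "p \<noteq> v" using uv p by auto
      define w where "w = (if u = v then x else u)"
      have w: "w \<in> M" "E' w v" "\<not> E' p w" "w \<noteq> y"
      proof -
        show "w \<in> M" "E' w v" "w \<noteq> y" using u uv xy QM by (auto simp: w_def)
        have "\<not> E' x p" if "u = v" using max'[OF xy nxy p(1) v(1) _ v(2) pv False] by blast
        then show "\<not> E' p w" using p sym by (auto simp: w_def)
      qed
      have "nbrs E' p \<inter> M \<subseteq> nbrs E' v \<inter> M - {y, w}"
      proof
        fix q assume q: "q \<in> nbrs E' p \<inter> M"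
        then have "q \<noteq> v" "q \<noteq> y" "q \<noteq> w" using False yp w sym[of p] by auto
        then show "q \<in> nbrs E' v \<inter> M - {y, w}" using q sub[of q] sym[of q v] by auto
      qed
      then have "inner E' M p \<le> card (nbrs E' v \<inter> M - {y, w})"
        unfolding inner_def using f by (intro card_mono) auto
      moreover have "{y, w} \<subseteq> nbrs E' v \<inter> M" using w v xy QM sym by auto
      ultimately show ?thesis
        using f w(4) card_mono[of "nbrs E' v \<inter> M" "{y, w}"]
        by (simp add: inner_def card_Diff_subset)
    qed
    have "inner E' M v \<le> inner E' M p + 1"
      using inner_le_succ[OF C, of v p] v p by simp
    then show False using le by simp
  qed
  then show thesis using that R by (auto simp: R_def)
qed

text \<open>The switch takes an edge of a clique and an edge outside it. A vertex \<open>x0\<close> of the clique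
loses the triangle with \<open>ab\<close> and gains none. Vertices outside \<open>M\<close> do not compensate for it:
each is adjacent to both or neither of \<open>a\<close> and \<open>b\<close>, so its term is not negative.\<close>

lemma clique_switch_changes_triangles:
  assumes N: "nearly_regular_class V E M r o'" and QM: "Q \<subseteq> M"
    and Q: "\<And>x y. x \<in> Q \<Longrightarrow> y \<in> Q \<Longrightarrow> x \<noteq> y \<Longrightarrow> E x y"
    and ab: "a \<in> Q" "b \<in> Q" "a \<noteq> b" "inner E M a = inner E M b"
    and cd: "c \<in> M - Q" "d \<in> M - Q" "E c d" "\<not> E a c" "\<not> E b d"
    and x0: "x0 \<in> Q" "x0 \<noteq> a" "x0 \<noteq> b" "\<not> E x0 c" "\<not> E x0 d"
    and nonneg: "\<And>x. x \<in> M - Q \<Longrightarrow> x \<noteq> c \<Longrightarrow> x \<noteq> d \<Longrightarrow> (0::int) \<le> (of_bool (E x a) - of_bool (E x d)) *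
        (of_bool (E x b) - of_bool (E x c))"
  shows False
proof -
  have C: "degree_class V E M" using N by (rule nearly_regular_class_degree_class)
  have G: "graph_on V E" using C by (rule degree_class_graph)
  note sym = graph_on_sym[OF G]
  have A: "alternating E a b c d" using ab cd Q by (auto simp: alternating_def)
  let ?F = "\<lambda>x. (of_bool (E x a) - of_bool (E x d)) * (of_bool (E x b) - of_bool (E x c)) :: int"
  have "0 < sum ?F (V - {a, b, c, d})"
  proof (rule sum_pos2[of _ x0])
    show "finite (V - {a, b, c, d})" using graph_on_finite[OF G] by simp
    show "x0 \<in> V - {a, b, c, d}" using x0 cd QM degree_class_subset[OF C] by auto
    show "0 < ?F x0" using Q[OF x0(1) ab(1)] Q[OF x0(1) ab(2)] x0 by simp
    fix x assume x: "x \<in> V - {a, b, c, d}"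
    consider "x \<in> Q" | "x \<in> M - Q" | "x \<in> V - M" using x by blast
    then show "0 \<le> ?F x"
    proof cases
      case 1
      then show ?thesis using Q[OF 1 ab(1)] Q[OF 1 ab(2)] x by simp
    next
      case 2
      then show ?thesis using nonneg x by simp
    next
      case 3
      have m: "a \<in> M" "b \<in> M" "c \<in> M" "d \<in> M" using ab cd QM by auto
      consider "\<forall>m\<in>M. E m x" | "\<forall>m\<in>M. \<not> E m x" | "\<forall>m\<in>M. E m x \<longleftrightarrow> inner E M m + 1 = r"
        using N 3 unfolding nearly_regular_class_def by blast
      then show ?thesis
      proof cases
        case 3
        then have "E x a \<longleftrightarrow> E x b" using m ab(4) sym by metis
        then show ?thesis by simp
      qed (use m sym[of x] in auto)
    qed
  qed
  then show False using alternating_triangles[OF degree_class_unique[OF C] A] by simp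
qed

lemma three_distinct:
  assumes "3 \<le> card Q"
  obtains a b c where "a \<in> Q" "b \<in> Q" "c \<in> Q" "a \<noteq> b" "a \<noteq> c" "b \<noteq> c"
proof -
  obtain T where "T \<subseteq> Q" "card T = 3" using assms by (meson obtain_subset_with_card_n)
  then show thesis using that by (auto simp: card_3_iff)
qed

lemma no_clique_component:
  assumes N: "nearly_regular_class V E M r o'" and r: "3 \<le> r" and QM: "Q \<subseteq> M"
    and Q: "\<And>x y. x \<in> Q \<Longrightarrow> y \<in> Q \<Longrightarrow> x \<noteq> y \<Longrightarrow> E x y"
    and i: "\<And>x. x \<in> Q \<Longrightarrow> inner E M x + 1 = card Q" and c3: "3 \<le> card Q" and B: "M - Q \<noteq> {}"
  shows False
proof -
  have C: "degree_class V E M" using N by (rule nearly_regular_class_degree_class)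
  have G: "graph_on V E" using C by (rule degree_class_graph)
  note sym = graph_on_sym[OF G]
  have ir: "\<not> E v v" for v using G by (rule graph_on_irrefl)
  have f: "finite (nbrs E v)" for v using finite_nbrs[OF G] .
  have fQ: "finite Q" using QM degree_class_finite[OF C] by (rule finite_subset)
  have out: "\<not> E x u" if "x \<in> Q" "u \<in> M - Q" for x u
  proof -
    have "Q - {x} \<subseteq> nbrs E x \<inter> M"
      using Q[OF that(1)] QM unfolding subset_iff by (metis DiffE IntI in_nbrs singletonI)
    moreover have "card (nbrs E x \<inter> M) = card (Q - {x})"
      using i[OF that(1)] that(1) fQ by (simp add: inner_def)
    ultimately have "Q - {x} = nbrs E x \<inter> M" using f by (intro card_subset_eq) auto
    then show ?thesis using that(2) by (metis DiffD1 DiffD2 IntI in_nbrs)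
  qed
  obtain c where c: "c \<in> M - Q" using B by blast
  have "inner E M c \<noteq> 0" using N c r by (auto simp: nearly_regular_class_def)
  then have "nbrs E c \<inter> M \<noteq> {}" by (auto simp: inner_def)
  then obtain d where d: "d \<in> M" "E c d" by auto
  then have "d \<notin> Q" using out c sym by blast
  obtain a b x0 where q: "a \<in> Q" "b \<in> Q" "x0 \<in> Q" "a \<noteq> b" "a \<noteq> x0" "b \<noteq> x0"
    using c3 by (rule three_distinct)
  show False
  proof (rule clique_switch_changes_triangles[OF N QM Q q(1,2,4)])
    show "inner E M a = inner E M b" using i[OF q(1)] i[OF q(2)] by simp
    show "(0::int) \<le> (of_bool (E x a) - of_bool (E x d)) * (of_bool (E x b) - of_bool (E x c))"
      if "x \<in> M - Q" for x
      using out[OF q(1) that] out[OF q(2) that] sym by simp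
    show "d \<in> M - Q" "c \<in> M - Q" using c d \<open>d \<notin> Q\<close> by auto
    then show "\<not> E a c" "\<not> E b d" "\<not> E x0 c" "\<not> E x0 d" using q out by blast+
  qed (use d q in auto)
qed

text \<open>Here \<open>g x\<close> is the only neighbour of \<open>x\<close> in \<open>M - Q\<close>. The edge \<open>cd\<close> in \<open>M - Q\<close> is chosen such
that the terms of \<open>g a\<close> and \<open>g b\<close> in the triangle count are not negative. If \<open>g\<close> is injective,
two adjacent values of \<open>g\<close> serve or, failing that, a value of \<open>g\<close> and any of its neighbours in
\<open>M - Q\<close>. If \<open>g a = g b\<close>, every edge of \<open>M - Q\<close> that avoids \<open>g a\<close> and \<open>g x\<close> serves; without
such an edge, \<open>g a\<close> has too many neighbours.\<close>

lemma no_clique_with_pendant_edges: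
  assumes N: "nearly_regular_class V E M r o'" and r: "3 \<le> r" and QM: "Q \<subseteq> M"
    and Q: "\<And>x y. x \<in> Q \<Longrightarrow> y \<in> Q \<Longrightarrow> x \<noteq> y \<Longrightarrow> E x y"
    and i: "\<And>x. x \<in> Q \<Longrightarrow> inner E M x = card Q" and c3: "3 \<le> card Q" "card Q \<le> r"
    and B: "r < card (M - Q)"
  shows False
proof -
  have C: "degree_class V E M" using N by (rule nearly_regular_class_degree_class)
  have G: "graph_on V E" using C by (rule degree_class_graph)
  note sym = graph_on_sym[OF G]
  have ir: "\<not> E v v" for v using G by (rule graph_on_irrefl)
  have f: "finite (nbrs E v)" for v using finite_nbrs[OF G] .
  have fM: "finite M" using degree_class_finite[OF C] .
  have fQ: "finite Q" using QM fM by (rule finite_subset)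
  have lev: "inner E M m \<le> r" "r \<le> inner E M m + 1" if "m \<in> M" for m
    using N that by (auto simp: nearly_regular_class_def)
  have "\<exists>u. nbrs E x \<inter> M - Q = {u}" if x: "x \<in> Q" for x
  proof -
    have "nbrs E x \<inter> M \<inter> Q = Q - {x}" using Q x QM ir by auto
    then have "card (nbrs E x \<inter> M \<inter> Q) = card Q - 1" using x fQ by simp
    then have "card (nbrs E x \<inter> M - Q) = 1"
      using i[OF x] f c3 card_Int_Diff[of "nbrs E x \<inter> M" Q] by (simp add: inner_def)
    then show ?thesis by (meson card_1_singletonE)
  qed
  then obtain g where g: "\<And>x. x \<in> Q \<Longrightarrow> nbrs E x \<inter> M - Q = {g x}" by metis
  have gB: "g x \<in> M - Q" if "x \<in> Q" for x using g[OF that] by auto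
  have ge: "E x u \<longleftrightarrow> u = g x" "E u x \<longleftrightarrow> u = g x" if "x \<in> Q" "u \<in> M - Q" for x u
    using g[OF that(1)] that(2) sym by auto
  have same: "inner E M x = inner E M y" if "x \<in> Q" "y \<in> Q" for x y using i that by simp
  show False
  proof (cases "inj_on g Q")
    case inj: True
    then have gi: "g x = g y \<longleftrightarrow> x = y" if "x \<in> Q" "y \<in> Q" for x y using that by (auto simp: inj_on_def)
    show False
    proof (cases "\<exists>a\<in>Q. \<exists>b\<in>Q. a \<noteq> b \<and> E (g a) (g b)")
      case True
      then obtain a b where ab: "a \<in> Q" "b \<in> Q" "a \<noteq> b" "E (g a) (g b)" by blast
      have "\<not> Q \<subseteq> {a, b}" using c3 card_mono[of "{a, b}" Q] ab(3) by auto
      then obtain x where x: "x \<in> Q" "x \<noteq> a" "x \<noteq> b" by blast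
      show False
      proof (rule clique_switch_changes_triangles[OF N QM Q ab(1-3) same[OF ab(1,2)]])
        show "g b \<in> M - Q" "g a \<in> M - Q" "E (g b) (g a)" using gB ab sym by auto
        show "\<not> E a (g b)" "\<not> E b (g a)" "\<not> E x (g a)" "\<not> E x (g b)"
          using ge gB gi ab x by auto
        show "x \<in> Q" "x \<noteq> a" "x \<noteq> b" using x by auto
        show "(0::int) \<le> (of_bool (E z a) - of_bool (E z (g a))) * (of_bool (E z b) - of_bool (E z (g b)))"
          if "z \<in> M - Q" "z \<noteq> g b" "z \<noteq> g a" for z
          using ge(2)[OF ab(1) that(1)] ge(2)[OF ab(2) that(1)] that by simp
      qed
    next
      case False
      obtain a b x where q: "a \<in> Q" "b \<in> Q" "x \<in> Q" "a \<noteq> b" "a \<noteq> x" "b \<noteq> x"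
        using c3(1) by (rule three_distinct)
      have "\<not> nbrs E (g a) \<inter> M \<subseteq> {a}"
      proof
        assume "nbrs E (g a) \<inter> M \<subseteq> {a}"
        then have "inner E M (g a) \<le> 1" unfolding inner_def using card_mono[of "{a}"] by fastforce
        then show False using lev(2)[of "g a"] gB[OF q(1)] r by simp
      qed
      then obtain c where c: "E (g a) c" "c \<in> M" "c \<noteq> a"
        unfolding subset_iff by (metis Int_iff in_nbrs insertI1)
      have cQ: "c \<in> M - Q" using c ge(1)[of c "g a"] gB[OF q(1)] gi q(1) sym by auto
      have cg: "c \<noteq> g z" if "z \<in> Q" for z
        using False that q(1) c(1) ir[of "g a"] by metis
      show False
      proof (rule clique_switch_changes_triangles[OF N QM Q q(1,2,4) same[OF q(1,2)]])
        show "c \<in> M - Q" "g a \<in> M - Q" "E c (g a)" using cQ gB q c sym by auto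
        show "\<not> E a c" "\<not> E b (g a)" "\<not> E x (g a)" "\<not> E x c"
          using ge gB gi q cQ cg by auto
        show "x \<in> Q" "x \<noteq> a" "x \<noteq> b" using q by auto
        show "(0::int) \<le> (of_bool (E z a) - of_bool (E z (g a))) * (of_bool (E z b) - of_bool (E z c))"
          if "z \<in> M - Q" "z \<noteq> c" "z \<noteq> g a" for z
        proof (cases "z = g b")
          case True
          then have "\<not> E z (g a)" using False q by auto
          then show ?thesis using ge(2)[OF q(1) that(1)] that by simp
        next
          case False
          then show ?thesis using ge(2)[OF q(1) that(1)] ge(2)[OF q(2) that(1)] that by simp
        qed
      qed
    qed
  next
    case False
    then obtain a b where ab: "a \<in> Q" "b \<in> Q" "a \<noteq> b" "g a = g b" by (auto simp: inj_on_def)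
    have "\<not> Q \<subseteq> {a, b}" using c3 card_mono[of "{a, b}" Q] ab(3) by auto
    then obtain x where x: "x \<in> Q" "x \<noteq> a" "x \<noteq> b" by blast
    have edge: "\<not> (E c d \<and> c \<noteq> g a \<and> d \<noteq> g a \<and> c \<noteq> g x \<and> d \<noteq> g x)"
      if cd: "c \<in> M - Q" "d \<in> M - Q" for c d
    proof
      assume e: "E c d \<and> c \<noteq> g a \<and> d \<noteq> g a \<and> c \<noteq> g x \<and> d \<noteq> g x"
      show False
      proof (rule clique_switch_changes_triangles[OF N QM Q ab(1-3) same[OF ab(1,2)] cd _ _ _ x])
        show "E c d" "\<not> E a c" "\<not> E b d" "\<not> E x c" "\<not> E x d"
          using e ge cd ab x by auto
        show "(0::int) \<le> (of_bool (E z a) - of_bool (E z d)) * (of_bool (E z b) - of_bool (E z c))"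
          if "z \<in> M - Q" for z
          using ge(2)[OF ab(1) that] ge(2)[OF ab(2) that] ab(4) by simp
      qed
    qed
    \<comment> \<open>Since \<open>g\<close> is not injective, at least two vertices of \<open>M - Q\<close> have no neighbour in \<open>Q\<close>.\<close>
    let ?W = "M - Q - g ` Q"
    have "card (g ` Q) < card Q"
      using False fQ by (metis card_image_le eq_card_imp_inj_on le_neq_implies_less)
    moreover have "g ` Q \<subseteq> M - Q" using gB by blast
    ultimately have "2 \<le> card ?W" using B c3(2) fQ by (simp add: card_Diff_subset)
    then obtain v w where vw: "v \<in> ?W" "w \<in> ?W" "v \<noteq> w"
      using card_le_Suc0_iff_eq[of ?W] fM by force
    have nb: "nbrs E z \<inter> M = {g a, g x} \<and> g a \<noteq> g x \<and> r = 3" if z: "z \<in> ?W" for z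
    proof -
      have "y = g a \<or> y = g x" if y: "y \<in> M" "E z y" for y
      proof -
        have "y \<notin> Q" using ge(2)[of y z] y z by blast
        then show ?thesis using edge[of z y] y z ab(1) x(1) by blast
      qed
      then have sub: "nbrs E z \<inter> M \<subseteq> {g a, g x}"
        unfolding subset_iff by (metis IntE in_nbrs insertCI)
      have two: "2 \<le> card (nbrs E z \<inter> M)" "r \<le> card (nbrs E z \<inter> M) + 1"
        using lev(2)[of z] z r by (auto simp: inner_def)
      have le: "card (nbrs E z \<inter> M) \<le> card {g a, g x}" using sub by (intro card_mono) auto
      have ne: "g a \<noteq> g x"
      proof
        assume "g a = g x"
        then show False using le two(1) by simp
      qed
      then have two': "card {g a, g x} = 2" by simp
      then have "nbrs E z \<inter> M = {g a, g x}" using two(1) le sub by (intro card_subset_eq) auto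
      moreover have "r = 3" using two(2) le two' r by linarith
      ultimately show ?thesis using ne by blast
    qed
    have "{a, b, v, w} \<subseteq> nbrs E (g a) \<inter> M"
      using nb[OF vw(1)] nb[OF vw(2)] ge(2)[OF ab(1) gB[OF ab(1)]] ge(2)[OF ab(2) gB[OF ab(1)]] ab QM vw sym
      by auto
    then have "card {a, b, v, w} \<le> inner E M (g a)" unfolding inner_def using f by (intro card_mono) auto
    moreover have "a \<noteq> v" "a \<noteq> w" "b \<noteq> v" "b \<noteq> w" using ab vw by auto
    then have "card {a, b, v, w} = 4" using ab(3) vw(3) by simp
    ultimately show False using lev(1)[of "g a"] gB[OF ab(1)] nb[OF vw(1)] by simp
  qed
qed

text \<open>To turn \<open>Q\<close> into a clique, \<open>clique_realization\<close> needs more than \<open>r\<close> vertices of \<open>M\<close> outside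
\<open>Q\<close>. Hence \<open>Q\<close> has \<open>r\<close> vertices if \<open>card M\<close> exceeds \<open>2 * r\<close>, and \<open>r - 1\<close> vertices if it is
equal to \<open>2 * r\<close>. In the latter case \<open>r = 3\<close> would leave a clique of two vertices, too small
for the triangle count.\<close>

lemma nearly_regular_class_sparse:
  assumes N: "nearly_regular_class V E M r o'" and r: "3 \<le> r" and M: "2 * r \<le> card M"
    and L: "card M = 2 * r \<Longrightarrow> r \<le> card {m \<in> M. inner E M m + 1 = r}"
    and six: "\<not> (r = 3 \<and> card M = 6)"
  shows False
proof -
  let ?H = "{m \<in> M. inner E M m = r}" and ?L = "{m \<in> M. inner E M m + 1 = r}"
  have fM: "finite M" using N nearly_regular_class_degree_class degree_class_finite by metis
  have "card M = card ?H + card ?L"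
  proof -
    have "M = ?H \<union> ?L" using N by (auto simp: nearly_regular_class_def)
    moreover have "?H \<inter> ?L = {}" by auto
    ultimately show ?thesis using card_Un_disjoint[of ?H ?L] fM by (metis finite_Un)
  qed
  moreover have clique: "\<exists>Q E'. Q \<subseteq> T \<and> card Q = q \<and> r < card (M - Q) \<and>
      nearly_regular_class V E' M r o' \<and> (\<forall>x. inner E' M x = inner E M x) \<and>
      (\<forall>x\<in>Q. \<forall>y\<in>Q. x \<noteq> y \<longrightarrow> E' x y)"
    if T: "T \<subseteq> M" "q \<le> card T" "\<And>x. x \<in> T \<Longrightarrow> q \<le> inner E M x + 1" "r + q < card M" for T q
  proof -
    obtain Q where Q: "Q \<subseteq> T" "card Q = q" using T(2) by (meson obtain_subset_with_card_n)
    then have QM: "Q \<subseteq> M" using T(1) by blast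
    have B: "r < card (M - Q)" using Q T(4) fM QM by (simp add: card_Diff_subset finite_subset)
    have "card Q \<le> inner E M x + 1" if "x \<in> Q" for x using Q T(3) that by blast
    from clique_realization[OF N QM this B] show ?thesis using Q B by metis
  qed
  ultimately consider "2 * r < card M" "r \<le> card ?H" | "2 * r < card M" "r \<le> card ?L"
    | "2 * r = card M" "r \<le> card ?L"
    using M L by linarith
  then show False
  proof cases
    case 1
    then obtain Q E' where Q: "Q \<subseteq> ?H" "card Q = r" "r < card (M - Q)" and E': "nearly_regular_class V E' M r o'"
        "\<And>x. inner E' M x = inner E M x" "\<And>x y. x \<in> Q \<Longrightarrow> y \<in> Q \<Longrightarrow> x \<noteq> y \<Longrightarrow> E' x y"
      using clique[of ?H r] by auto
    then have "Q \<subseteq> M" by blast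
    then show False
      by (rule no_clique_with_pendant_edges[OF E'(1) r _ E'(3) _ _ _ Q(3)]) (use Q E'(2) r in auto)
  next
    case 2
    then obtain Q E' where Q: "Q \<subseteq> ?L" "card Q = r" "r < card (M - Q)" and E': "nearly_regular_class V E' M r o'"
        "\<And>x. inner E' M x = inner E M x" "\<And>x y. x \<in> Q \<Longrightarrow> y \<in> Q \<Longrightarrow> x \<noteq> y \<Longrightarrow> E' x y"
      using clique[of ?L r] by auto
    then have "Q \<subseteq> M" "M - Q \<noteq> {}" by (blast, metis card.empty not_less_zero)
    then show False
      by (intro no_clique_component[OF E'(1) r _ E'(3)]) (use Q E'(2) r in auto)
  next
    case 3
    then have "r - 1 \<le> card ?L" "r + (r - 1) < card M" using r by linarith+
    then obtain Q E' where Q: "Q \<subseteq> ?L" "card Q = r - 1" "r < card (M - Q)"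
      and E': "nearly_regular_class V E' M r o'"
        "\<And>x. inner E' M x = inner E M x" "\<And>x y. x \<in> Q \<Longrightarrow> y \<in> Q \<Longrightarrow> x \<noteq> y \<Longrightarrow> E' x y"
      using clique[of ?L "r - 1"] by auto
    then have "Q \<subseteq> M" "4 \<le> r" using r six 3(1) by auto
    then show False
      by (intro no_clique_with_pendant_edges[OF E'(1) r _ E'(3) _ _ _ Q(3)]) (use Q E'(2) in auto)
  qed
qed

section \<open>Split subgraphs of graphs with a unique realization\<close>

text \<open>The last part excludes a decomposition \<open>(K1, S1) \<circ> (K - K1, S - S1)\<close> with nonempty parts. In
contrast to \<open>indecomposable\<close> it speaks about subsets of a larger graph, without passing to an
induced subgraph.\<close>

definition indecomposable_split :: "('a \<Rightarrow> 'a \<Rightarrow> bool) \<Rightarrow> 'a set \<Rightarrow> 'a set \<Rightarrow> bool" where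
  "indecomposable_split E K S \<longleftrightarrow> K \<inter> S = {} \<and> (\<forall>x\<in>K. \<forall>y\<in>K. x \<noteq> y \<longrightarrow> E x y) \<and>
     (\<forall>x\<in>S. \<forall>y\<in>S. \<not> E x y) \<and>
     (\<forall>K1 S1. K1 \<subseteq> K \<and> S1 \<subseteq> S \<and> (\<forall>x\<in>K1. \<forall>y\<in>S - S1. E x y) \<and> (\<forall>x\<in>S1. \<forall>y\<in>K - K1. \<not> E x y) \<longrightarrow>
        K1 \<union> S1 = {} \<or> K1 \<union> S1 = K \<union> S)"

lemma indecomposable_splitD:
  assumes "indecomposable_split E K S"
  shows "x \<in> K \<Longrightarrow> x \<in> S \<Longrightarrow> False" "x \<in> K \<Longrightarrow> y \<in> K \<Longrightarrow> x \<noteq> y \<Longrightarrow> E x y"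
    "x \<in> S \<Longrightarrow> y \<in> S \<Longrightarrow> \<not> E x y"
    "K1 \<subseteq> K \<Longrightarrow> S1 \<subseteq> S \<Longrightarrow> (\<And>x y. x \<in> K1 \<Longrightarrow> y \<in> S \<Longrightarrow> y \<notin> S1 \<Longrightarrow> E x y) \<Longrightarrow>
       (\<And>x y. x \<in> S1 \<Longrightarrow> y \<in> K \<Longrightarrow> y \<notin> K1 \<Longrightarrow> \<not> E x y) \<Longrightarrow> K1 \<union> S1 = {} \<or> K1 \<union> S1 = K \<union> S"
proof -
  note d = assms[unfolded indecomposable_split_def]
  show "x \<in> K \<Longrightarrow> x \<in> S \<Longrightarrow> False" using d[THEN conjunct1] by blast
  show "x \<in> K \<Longrightarrow> y \<in> K \<Longrightarrow> x \<noteq> y \<Longrightarrow> E x y" using d[THEN conjunct2, THEN conjunct1] by blast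
  show "x \<in> S \<Longrightarrow> y \<in> S \<Longrightarrow> \<not> E x y"
    using d[THEN conjunct2, THEN conjunct2, THEN conjunct1] by blast
  assume h: "K1 \<subseteq> K" "S1 \<subseteq> S" "\<And>x y. x \<in> K1 \<Longrightarrow> y \<in> S \<Longrightarrow> y \<notin> S1 \<Longrightarrow> E x y"
    "\<And>x y. x \<in> S1 \<Longrightarrow> y \<in> K \<Longrightarrow> y \<notin> K1 \<Longrightarrow> \<not> E x y"
  then have "(\<forall>x\<in>K1. \<forall>y\<in>S - S1. E x y) \<and> (\<forall>x\<in>S1. \<forall>y\<in>K - K1. \<not> E x y)" by simp
  then show "K1 \<union> S1 = {} \<or> K1 \<union> S1 = K \<union> S" using d[THEN conjunct2, THEN conjunct2, THEN conjunct2] h(1,2) by simp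
qed

lemma indecomposable_split_neighbours:
  assumes I: "indecomposable_split E K S" and ne: "K \<noteq> {}" "S \<noteq> {}" and sym: "\<And>x y. E x y \<longleftrightarrow> E y x"
  shows "k \<in> K \<Longrightarrow> \<exists>s\<in>S. E k s" "k \<in> K \<Longrightarrow> \<exists>s\<in>S. \<not> E k s"
    "s \<in> S \<Longrightarrow> \<exists>k\<in>K. E k s" "s \<in> S \<Longrightarrow> \<exists>k\<in>K. \<not> E k s"
proof -
  note D = indecomposable_splitD[OF I]
  show "\<exists>s\<in>S. E k s" if k: "k \<in> K"
  proof (rule ccontr)
    assume n: "\<not> ?thesis"
    have "(K - {k}) \<union> S = {} \<or> (K - {k}) \<union> S = K \<union> S"
      by (rule D(4)) (use n sym in auto)
    then show False using k ne D(1)[of k] by auto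
  qed
  show "\<exists>s\<in>S. \<not> E k s" if k: "k \<in> K"
  proof (rule ccontr)
    assume n: "\<not> ?thesis"
    have "{k} \<union> {} = {} \<or> {k} \<union> {} = K \<union> S" by (rule D(4)) (use n k in auto)
    then have "S \<subseteq> {k}" by auto
    then show False using k ne(2) D(1)[of k] by auto
  qed
  show "\<exists>k\<in>K. E k s" if s: "s \<in> S"
  proof (rule ccontr)
    assume n: "\<not> ?thesis"
    have "{} \<union> {s} = {} \<or> {} \<union> {s} = K \<union> S"
      by (rule D(4)) (use n s sym in auto)
    then have "K \<subseteq> {s}" by auto
    then show False using s ne(1) D(1)[of s] by auto
  qed
  show "\<exists>k\<in>K. \<not> E k s" if s: "s \<in> S"
  proof (rule ccontr)
    assume n: "\<not> ?thesis"
    have "K \<union> (S - {s}) = {} \<or> K \<union> (S - {s}) = K \<union> S"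
      by (rule D(4)) (use n in auto)
    then show False using s ne D(1)[of s] by auto
  qed
qed

lemma indecomposable_split_complement:
  assumes I: "indecomposable_split E K S" and V: "K \<subseteq> V" "S \<subseteq> V" and G: "graph_on V E"
  shows "indecomposable_split (complement V E) S K"
proof -
  note D = indecomposable_splitD[OF I]
  note sym = graph_on_sym[OF G]
  have c: "complement V E x y \<longleftrightarrow> \<not> E x y" if "x \<in> K \<union> S" "y \<in> K \<union> S" "x \<noteq> y" for x y
    using that V by (auto simp: complement_def)
  have dec: "S1 \<union> K1 = {} \<or> S1 \<union> K1 = S \<union> K"
    if h: "S1 \<subseteq> S" "K1 \<subseteq> K" "\<forall>x\<in>S1. \<forall>y\<in>K - K1. complement V E x y"
      "\<forall>x\<in>K1. \<forall>y\<in>S - S1. \<not> complement V E x y" for S1 K1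
  proof -
    have "K1 \<union> S1 = {} \<or> K1 \<union> S1 = K \<union> S"
    proof (rule D(4))
      show "E x y" if "x \<in> K1" "y \<in> S" "y \<notin> S1" for x y
      proof -
        have "x \<noteq> y" "x \<in> K" using that h(2) D(1) by blast+
        then show ?thesis using that h(4) c[of x y] by blast
      qed
      show "\<not> E x y" if "x \<in> S1" "y \<in> K" "y \<notin> K1" for x y
      proof -
        have "x \<noteq> y" "x \<in> S" using that h(1) D(1) by blast+
        then show ?thesis using that h(3) c[of x y] by blast
      qed
    qed (use h in auto)
    then show ?thesis by blast
  qed
  show ?thesis
    unfolding indecomposable_split_def
  proof (intro conjI allI impI ballI)
    show "S \<inter> K = {}" using D(1) by blast
    show "complement V E x y" if "x \<in> S" "y \<in> S" "x \<noteq> y" for x y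
      using that c[of x y] D(3)[of x y] by blast
    show "\<not> complement V E x y" if "x \<in> K" "y \<in> K" for x y
      using that D(2)[of x y] by (auto simp: complement_def)
  qed (elim conjE, rule dec)
qed

text \<open>Here \<open>p\<close> and \<open>q\<close> are adjacent vertices of \<open>K\<close> and \<open>S\<close> that are not adjacent to \<open>s\<close>. Both are
neighbours of \<open>k\<close>, so by equality of degrees \<open>s\<close> has two neighbours \<open>w\<close>, \<open>w'\<close> that are not
adjacent to \<open>k\<close>. All four lie outside the class, and the edge \<open>pq\<close> without any edges between
\<open>p, q\<close> and \<open>w, w'\<close> contradicts \<open>four_private_neighbours\<close>.\<close>

lemma clique_class_no_split:
  assumes C: "degree_class V E M" and M: "\<And>x y. x \<in> M \<Longrightarrow> y \<in> M \<Longrightarrow> x \<noteq> y \<Longrightarrow> E x y"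
    and I: "indecomposable_split E K S" and k: "k \<in> K" "k \<in> M" and s: "s \<in> S" "s \<in> M"
  shows False
proof -
  note D = indecomposable_splitD[OF I]
  have G: "graph_on V E" using C by (rule degree_class_graph)
  note sym = graph_on_sym[OF G]
  have f: "finite (nbrs E v)" for v using finite_nbrs[OF G] .
  have ir: "\<not> E v v" for v using G by (rule graph_on_irrefl)
  have ne: "K \<noteq> {}" "S \<noteq> {}" using k s by auto
  note N = indecomposable_split_neighbours[OF I ne sym]
  have ks: "k \<noteq> s" "E k s" using k s D(1) M by blast+
  obtain p where p: "p \<in> K" "\<not> E p s" using N(4) s by blast
  have pk: "p \<noteq> k" "p \<noteq> s" "p \<notin> M" using p ks M s D(1) by blast+
  obtain q where q: "q \<in> S" "E p q" using N(1) p by blast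
  have qs: "q \<noteq> s" "q \<notin> M" "q \<noteq> p" using q p M s D(3) ir by blast+
  have "E k q"
  proof (rule ccontr)
    assume "\<not> E k q"
    then have "\<not> E q p"
      using outer_non_neighbours_not_adjacent[OF C k(2) s(2) ks(2) qs(2) _ pk(3)] p sym by blast
    then show False using q sym by blast
  qed
  have kp: "E k p" using D(2) k p pk by blast
  have "card (nbrs E s - nbrs E k) = card (nbrs E k - nbrs E s)"
  proof -
    have "card (nbrs E k \<inter> nbrs E s) + card (nbrs E k - nbrs E s) = deg E k"
      "card (nbrs E s \<inter> nbrs E k) + card (nbrs E s - nbrs E k) = deg E s"
      unfolding deg_def using f card_Int_Diff by metis+
    then show ?thesis using degree_class_same[OF C k(2) s(2)] by (simp add: Int_commute)
  qed
  moreover have "card {s, p, q} \<le> card (nbrs E k - nbrs E s)"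
    using f ks kp \<open>E k q\<close> ir p q s D(3) sym[of s p] by (intro card_mono) auto
  ultimately have "3 \<le> card (nbrs E s - nbrs E k)" using pk qs by simp
  then obtain a b c where "a \<in> nbrs E s - nbrs E k" "b \<in> nbrs E s - nbrs E k" "c \<in> nbrs E s - nbrs E k"
      "a \<noteq> b" "a \<noteq> c" "b \<noteq> c" by (rule three_distinct)
  then obtain w w' where w: "E s w" "\<not> E k w" "w \<noteq> k" "E s w'" "\<not> E k w'" "w' \<noteq> k" "w \<noteq> w'"
    by (metis Diff_iff in_nbrs)
  have wM: "w \<notin> M" "w' \<notin> M" using w M k by blast+
  have "of_bool (E p q) + of_bool (E w w') = (of_bool (E p w') + of_bool (E q w) :: int)"
    by (rule four_private_neighbours[OF degree_class_unique[OF C], of k _ _ _ _ s])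
      (use kp \<open>E k q\<close> w p q s qs pk D(3) sym[of s p] in auto)
  moreover have "\<not> E p w'"
    using outer_non_neighbours_not_adjacent[OF C s(2) k(2) _ pk(3) _ wM(2) w(5)] ks p sym by blast
  moreover have "\<not> E q w"
    using outer_non_neighbours_not_adjacent[OF C s(2) k(2) _ qs(2) _ wM(1) w(2)] ks q s D(3) sym by blast
  moreover have "(0::int) \<le> of_bool (E w w')" by simp
  ultimately show False using q by simp
qed

lemma nearly_regular_class_complement:
  assumes N: "nearly_regular_class V E M r o'"
  shows "nearly_regular_class V (complement V E) M (card M - r) o'"
proof -
  have C: "degree_class V E M" using N by (rule nearly_regular_class_degree_class)
  note MV = degree_class_subset[OF C]
  have lev: "inner E M m = r \<or> inner E M m + 1 = r" if "m \<in> M" for m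
    using N that by (auto simp: nearly_regular_class_def)
  note i = inner_complement[OF C]
  have c: "complement V E m x \<longleftrightarrow> \<not> E m x" if "m \<in> M" "x \<in> V - M" for m x
    using that MV by (auto simp: complement_def)
  show ?thesis
    unfolding nearly_regular_class_def
  proof (intro conjI ballI)
    show "degree_class V (complement V E) M" using C by (rule degree_class_complement)
    show "inner (complement V E) M m = card M - r \<or> inner (complement V E) M m + 1 = card M - r"
      if "m \<in> M" for m using lev[OF that] i[OF that] by linarith
    have l: "inner (complement V E) M m + 1 = card M - r \<longleftrightarrow> inner E M m + 1 \<noteq> r" if "m \<in> M" for m
      using lev[OF that] i[OF that] by linarith
    fix x assume x: "x \<in> V - M"
    have "(\<forall>m\<in>M. E m x) \<or> (\<forall>m\<in>M. \<not> E m x) \<or> (x = o' \<and> (\<forall>m\<in>M. E m x \<longleftrightarrow> inner E M m + 1 = r))"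
      using N x unfolding nearly_regular_class_def by blast
    then show "(\<forall>m\<in>M. complement V E m x) \<or> (\<forall>m\<in>M. \<not> complement V E m x) \<or>
        (x = o' \<and> (\<forall>m\<in>M. complement V E m x \<longleftrightarrow> inner (complement V E) M m + 1 = card M - r))"
      using c[OF _ x] l by simp blast
  qed
qed

text \<open>The vertices of \<open>K\<close> and of \<open>S\<close> outside \<open>M\<close> that see \<open>M\<close> as a whole would be the outer part of
a decomposition: those in \<open>K\<close> are adjacent to \<open>k\<close>, hence to all of \<open>M\<close>, those in \<open>S\<close> to
nothing in \<open>M\<close>. If one of them had the wrong adjacency to the exceptional vertex, there would
be an alternating four-cycle whose opposite pairs both consist of a vertex of \<open>M\<close> and one
outside \<open>M\<close>.\<close>

lemma split_in_nearly_regular_class: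
  assumes N: "nearly_regular_class V E M r o'" and I: "indecomposable_split E K S"
    and V: "K \<subseteq> V" "S \<subseteq> V" and k: "k \<in> K" "k \<in> M" and s: "s \<in> S" "s \<in> M"
    and x: "x \<in> K \<union> S" "x \<notin> M"
  shows "x = o' \<and> (\<forall>m\<in>M. E m x \<longleftrightarrow> inner E M m + 1 = r)"
proof -
  have C: "degree_class V E M" using N by (rule nearly_regular_class_degree_class)
  note D = indecomposable_splitD[OF I]
  have G: "graph_on V E" using C by (rule degree_class_graph)
  note sym = graph_on_sym[OF G]
  note MV = degree_class_subset[OF C]
  have ir: "\<not> E v v" for v using G by (rule graph_on_irrefl)
  have fM: "finite M" using C by (rule degree_class_finite)
  let ?hom = "\<lambda>x. x \<notin> M \<and> ((\<forall>m\<in>M. E m x) \<or> (\<forall>m\<in>M. \<not> E m x))"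
  let ?K1 = "{x \<in> K. ?hom x}" and ?S1 = "{x \<in> S. ?hom x}"
  have mixed: "\<exists>h\<in>M. \<exists>l\<in>M. E l y \<and> \<not> E h y \<and> inner E M l + 1 = r \<and> inner E M h = r"
    if "y \<in> V - M" "\<not> ?hom y" for y
    using that N unfolding nearly_regular_class_def by blast
  have K1: "E m x" if "x \<in> ?K1" "m \<in> M" for x m using that D(2)[OF k(1), of x] k by auto
  have S1: "\<not> E m x" if "x \<in> ?S1" "m \<in> M" for x m using that D(3)[OF s(1), of x] s by auto
  have no_alt: False if "alternating E a b c d" "a \<in> V - M" "c \<in> V - M \<longleftrightarrow> b \<in> M" "b \<in> V - M \<longleftrightarrow> c \<in> M" "d \<in> M" for a b c d
    using alternating_same_degree[OF degree_class_unique[OF C] that(1)] degree_class_differ[OF C] that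
      alternating_distinct[OF G that(1)] by (metis DiffI)
  have "?K1 \<union> ?S1 = {} \<or> ?K1 \<union> ?S1 = K \<union> S"
  proof (rule D(4))
    fix x y assume xy: "x \<in> ?K1" "y \<in> S" "y \<notin> ?S1"
    show "E x y"
    proof (rule ccontr)
      assume n: "\<not> E x y"
      have yM: "y \<notin> M" using K1[OF xy(1)] n sym by blast
      then have "y \<in> V - M" "\<not> ?hom y" using xy V by auto
      then obtain h l where hl: "h \<in> M" "l \<in> M" "E l y" "\<not> E h y" "inner E M l + 1 = r" "inner E M h = r"
        using mixed by blast
      have "nbrs E h \<inter> M \<subseteq> M - {h}" using ir[of h] by auto
      then have "card (nbrs E h \<inter> M) \<le> card (M - {h})" using fM by (intro card_mono) auto
      then have "inner E M h \<le> card (M - {l})" using hl fM by (simp add: inner_def)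
      then have "card (nbrs E l \<inter> M) < card (M - {l})" using hl by (simp add: inner_def)
      then have "\<not> M - {l} \<subseteq> nbrs E l \<inter> M" using fM by (metis card_mono finite_Int leD)
      then obtain z where z: "z \<in> M" "z \<noteq> l" "\<not> E l z"
        unfolding subset_iff by (metis DiffE IntI in_nbrs singletonI)
      have "x \<noteq> y" using xy D(1)[of x] by auto
      then have "alternating E x z y l"
        using K1[OF xy(1) z(1)] hl(3) z(2,3) n sym[of x z] sym[of y l] sym[of z l]
        unfolding alternating_def by blast
      moreover have "x \<in> V - M" using xy V by auto
      ultimately show False using no_alt[of x z y l] \<open>y \<in> V - M\<close> z hl yM by blast
    qed
  next
    fix x y assume xy: "x \<in> ?S1" "y \<in> K" "y \<notin> ?K1"
    show "\<not> E x y"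
    proof
      assume n: "E x y"
      have yM: "y \<notin> M" using S1[OF xy(1)] n sym by blast
      then have "y \<in> V - M" "\<not> ?hom y" using xy V by auto
      then obtain h l where hl: "h \<in> M" "l \<in> M" "E l y" "\<not> E h y" "inner E M l + 1 = r" "inner E M h = r"
        using mixed by blast
      have "nbrs E h \<inter> M \<noteq> {}" using hl by (auto simp: inner_def)
      then obtain z where z: "z \<in> M" "E h z" by auto
      have "x \<noteq> z" "y \<noteq> h" using xy z hl yM by auto
      then have "alternating E x y z h"
        using S1[OF xy(1) z(1)] hl(4) z(2) n sym[of x z] sym[of y h] sym[of z h]
        unfolding alternating_def by blast
      moreover have "x \<in> V - M" using xy V by auto
      ultimately show False using no_alt[of x y z h] \<open>y \<in> V - M\<close> z hl yM by blast
    qed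
  qed auto
  moreover have "k \<notin> ?K1 \<union> ?S1" using k by blast
  ultimately have "?K1 \<union> ?S1 = {}" using k by blast
  then have "\<not> ?hom x" using x by blast
  moreover have "x \<in> V - M" using x V by blast
  ultimately show ?thesis using N unfolding nearly_regular_class_def by blast
qed

text \<open>A vertex of \<open>K\<close> has at least three neighbours in \<open>K \<union> S\<close>. If one of them is the exceptional
vertex, then only two are known to lie in \<open>M\<close>, but the inner degree is then \<open>r - 1\<close>.\<close>

lemma split_in_nearly_regular_class_degree:
  assumes N: "nearly_regular_class V E M r o'" and I: "indecomposable_split E K S"
    and c: "3 \<le> card K" and S: "S \<noteq> {}"
    and out: "\<And>x. x \<in> K \<union> S \<Longrightarrow> x \<notin> M \<Longrightarrow> x = o' \<and> (\<forall>m\<in>M. E m x \<longleftrightarrow> inner E M m + 1 = r)"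
  shows "3 \<le> r"
proof -
  have C: "degree_class V E M" using N by (rule nearly_regular_class_degree_class)
  note D = indecomposable_splitD[OF I]
  have G: "graph_on V E" using C by (rule degree_class_graph)
  note sym = graph_on_sym[OF G]
  have f: "finite (nbrs E v)" for v using finite_nbrs[OF G] .
  have ne: "K \<noteq> {}" using c by auto
  note NB = indecomposable_split_neighbours[OF I ne S sym]
  have lev: "inner E M m \<le> r" if "m \<in> M" for m using N that by (auto simp: nearly_regular_class_def)
  obtain a b d where q: "a \<in> K" "b \<in> K" "d \<in> K" "a \<noteq> b" "a \<noteq> d" "b \<noteq> d" using c by (rule three_distinct)
  show ?thesis
  proof (cases "K \<subseteq> M")
    case True
    obtain s where s: "s \<in> S" "E a s" using NB(1) q by blast
    have sK: "s \<noteq> b" "s \<noteq> d" using s q D(1) by blast+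
    have e: "E a b" "E a d" using D(2) q by blast+
    show ?thesis
    proof (cases "s \<in> M")
      case sM: True
      have "card {s, b, d} \<le> inner E M a"
        unfolding inner_def using f e s q True sM by (intro card_mono) auto
      then show ?thesis using lev[of a] q True sK by auto
    next
      case False
      then have "inner E M a + 1 = r" using out[of s] s q True by blast
      moreover have "card {b, d} \<le> inner E M a"
        unfolding inner_def using f e q True by (intro card_mono) auto
      ultimately show ?thesis using q by simp
    qed
  next
    case False
    then obtain x where x: "x \<in> K" "x \<notin> M" by blast
    then have xo: "x = o'" using out by blast
    obtain u v where uv: "u \<in> K" "v \<in> K" "u \<noteq> x" "v \<noteq> x" "u \<noteq> v" using q by metis
    have uM: "u \<in> M" "v \<in> M" using uv out[of u] out[of v] xo by blast+
    obtain s where s: "s \<in> S" "E u s" using NB(1) uv by blast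
    have "s \<noteq> x" "s \<noteq> v" using s x uv D(1) by blast+
    then have sM: "s \<in> M" using s out[of s] xo by blast
    have "E u x" "E u v" using D(2) uv x by blast+
    then have "inner E M u + 1 = r" using out[of x] x uM by blast
    moreover have "card {s, v} \<le> inner E M u"
      unfolding inner_def using f \<open>E u v\<close> s sM uM by (intro card_mono) auto
    ultimately show ?thesis using \<open>s \<noteq> v\<close> by simp
  qed
qed

text \<open>Double counting of the edges between \<open>S\<close> and the rest of \<open>M\<close>: each vertex of \<open>S\<close> has at least
two neighbours there, but each vertex of \<open>K\<close> in \<open>M\<close> has at most one neighbour in \<open>S\<close>, and at
most one further vertex of \<open>M\<close> remains.\<close>

lemma split_in_nearly_regular_class_six:
  assumes N: "nearly_regular_class V E M 3 o'" and six: "card M = 6" and I: "indecomposable_split E K S"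
    and c: "3 \<le> card K" "3 \<le> card S" and SM: "S \<subseteq> M"
    and out: "\<And>x. x \<in> K \<Longrightarrow> x \<notin> M \<Longrightarrow> x = o' \<and> (\<forall>m\<in>M. E m x \<longleftrightarrow> inner E M m + 1 = 3)"
  shows False
proof -
  have C: "degree_class V E M" using N by (rule nearly_regular_class_degree_class)
  note D = indecomposable_splitD[OF I]
  have G: "graph_on V E" using C by (rule degree_class_graph)
  note sym = graph_on_sym[OF G]
  have f: "finite (nbrs E v)" for v using finite_nbrs[OF G] .
  have fM: "finite M" using C by (rule degree_class_finite)
  have lev: "inner E M m \<le> 3" "2 \<le> inner E M m" if "m \<in> M" for m
    using N that by (auto simp: nearly_regular_class_def)
  let ?K = "K \<inter> M"
  have fK: "finite K" using c card.infinite by fastforce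
  have one': "card (K - M) \<le> 1"
  proof -
    have "K - M \<subseteq> {o'}" using out by blast
    then show ?thesis using card_mono[of "{o'}" "K - M"] by simp
  qed
  have K2: "2 \<le> card ?K" "K - M \<noteq> {} \<or> 3 \<le> card ?K"
  proof -
    have "card K = card ?K + card (K - M)" by (rule card_Int_Diff[OF fK])
    then show "2 \<le> card ?K" using one' c(1) by linarith
    show "K - M \<noteq> {} \<or> 3 \<le> card ?K"
      using \<open>card K = card ?K + card (K - M)\<close> c(1) by (metis add.right_neutral card.empty)
  qed
  have one: "card (nbrs E k \<inter> S) \<le> 1" if k: "k \<in> ?K" for k
  proof -
    have "E k y" if "y \<in> ?K - {k}" for y using D(2)[of k y] k that by blast
    then have "?K - {k} \<subseteq> nbrs E k" unfolding subset_iff in_nbrs by blast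
    then have "(nbrs E k \<inter> S) \<union> (?K - {k}) \<subseteq> nbrs E k \<inter> M" using SM by blast
    then have "card ((nbrs E k \<inter> S) \<union> (?K - {k})) \<le> inner E M k"
      unfolding inner_def using f by (intro card_mono) auto
    moreover have "(nbrs E k \<inter> S) \<inter> (?K - {k}) = {}" using D(1) by blast
    ultimately have le: "card (nbrs E k \<inter> S) + (card ?K - 1) \<le> inner E M k"
      using k f fK by (simp add: card_Un_disjoint)
    show ?thesis
    proof (cases "K - M = {}")
      case True
      then have "3 \<le> card ?K" using K2 by blast
      then show ?thesis using le lev(1)[of k] k by simp
    next
      case False
      then obtain x where x: "x \<in> K" "x \<notin> M" by blast
      then have "E k x" using D(2)[of k x] k by blast
      moreover have "k \<in> M" using k by blast
      ultimately have "inner E M k + 1 = 3" using out[OF x] by blast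
      then show ?thesis using le K2(1) by simp
    qed
  qed
  let ?B = "M - S"
  have e: "card (nbrs E m \<inter> T) = (\<Sum>t\<in>T. of_bool (E m t))" if "finite T" for m and T
    using that by (simp add: of_bool_def sum.If_cases Int_commute nbrs_def)
  have fS: "finite S" using SM fM by (rule finite_subset)
  have "2 * card S \<le> (\<Sum>s\<in>S. card (nbrs E s \<inter> ?B))"
  proof -
    have "2 \<le> card (nbrs E s \<inter> ?B)" if "s \<in> S" for s
    proof -
      have "nbrs E s \<inter> ?B = nbrs E s \<inter> M" using D(3)[OF that] by auto
      then show ?thesis using lev(2)[of s] that SM by (auto simp: inner_def)
    qed
    then show ?thesis using sum_mono[of S "\<lambda>_. 2" "\<lambda>s. card (nbrs E s \<inter> ?B)"] by simp
  qed
  also have "(\<Sum>s\<in>S. card (nbrs E s \<inter> ?B)) = (\<Sum>m\<in>?B. card (nbrs E m \<inter> S))"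
  proof -
    have "(\<Sum>s\<in>S. card (nbrs E s \<inter> ?B)) = (\<Sum>s\<in>S. \<Sum>m\<in>?B. of_bool (E s m))"
      using fM by (simp only: e finite_Diff)
    also have "\<dots> = (\<Sum>m\<in>?B. \<Sum>s\<in>S. of_bool (E m s))"
      by (subst sum.swap) (rule sum.cong[OF refl], rule sum.cong[OF refl], subst sym, rule refl)
    also have "\<dots> = (\<Sum>m\<in>?B. card (nbrs E m \<inter> S))" using fS by (simp only: e)
    finally show ?thesis .
  qed
  also have "\<dots> = (\<Sum>m\<in>?K. card (nbrs E m \<inter> S)) + (\<Sum>m\<in>?B - ?K. card (nbrs E m \<inter> S))"
    using fM D(1) by (subst sum.subset_diff[of ?K ?B]) auto
  also have "\<dots> \<le> card ?K * 1 + card (?B - ?K) * card S"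
  proof (rule add_mono)
    show "(\<Sum>m\<in>?K. card (nbrs E m \<inter> S)) \<le> card ?K * 1"
      using sum_bounded_above[of ?K "\<lambda>m. card (nbrs E m \<inter> S)" 1] one by simp
    show "(\<Sum>m\<in>?B - ?K. card (nbrs E m \<inter> S)) \<le> card (?B - ?K) * card S"
      using sum_bounded_above[of "?B - ?K" "\<lambda>m. card (nbrs E m \<inter> S)" "card S"] fS
      by (simp add: card_mono)
  qed
  finally have main: "2 * card S \<le> card ?K + card (?B - ?K) * card S" by simp
  have "?K \<subseteq> ?B" using D(1) by blast
  then have "card (?B - ?K) + card ?K + card S = 6"
    using fM fS SM six card_mono[of ?B ?K] card_mono[OF fM SM]
    by (simp add: card_Diff_subset finite_subset)
  then consider "card S = 3" "card ?K = 2" "card (?B - ?K) = 1" | "card S = 3" "card ?K = 3" "card (?B - ?K) = 0"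
    | "card S = 4" "card ?K = 2" "card (?B - ?K) = 0"
    using c K2 by linarith
  then show False using main by cases auto
qed

text \<open>Otherwise the common degree class of \<open>k\<close> and \<open>s\<close> is nearly regular, and it is not a clique,
nor, by complementation, stable. Since \<open>K \<union> S\<close> lies in it up to one vertex, it satisfies the
size conditions of \<open>nearly_regular_class_sparse\<close>, either in the graph or in its complement.\<close>

lemma split_degrees_disjoint:
  assumes U: "uniquely_realized V E" and I: "indecomposable_split E K S" and V: "K \<subseteq> V" "S \<subseteq> V"
    and c: "3 \<le> card K" "3 \<le> card S" and k: "k \<in> K" and s: "s \<in> S"
  shows "deg E k \<noteq> deg E s"
proof
  assume eq: "deg E k = deg E s"
  define M where "M = {v \<in> V. deg E v = deg E k}"
  have C: "degree_class V E M" using U k V unfolding degree_class_def M_def by blast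
  have kM: "k \<in> M" and sM: "s \<in> M" using k s V eq by (auto simp: M_def)
  have G: "graph_on V E" using U by (rule uniquely_realized_graph)
  let ?E = "complement V E"
  have CC: "degree_class V ?E M" using C by (rule degree_class_complement)
  have IC: "indecomposable_split ?E S K" using indecomposable_split_complement[OF I V G] .
  have "\<exists>p\<in>M. \<exists>q\<in>M. p \<noteq> q \<and> \<not> E p q" using clique_class_no_split[OF C _ I k kM s sM] by blast
  moreover have "\<exists>p\<in>M. \<exists>q\<in>M. E p q"
  proof (rule ccontr)
    assume "\<not> ?thesis"
    then have "?E x y" if "x \<in> M" "y \<in> M" "x \<noteq> y" for x y
      using that degree_class_subset[OF C] by (auto simp: complement_def)
    then show False using clique_class_no_split[OF CC _ IC s sM k kM] by blast
  qed
  ultimately obtain r o' where N: "nearly_regular_class V E M r o'"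
    using nearly_regular_class_exists[OF C] by metis
  have NC: "nearly_regular_class V ?E M (card M - r) o'" using N by (rule nearly_regular_class_complement)
  note out = split_in_nearly_regular_class[OF N I V k kM s sM]
  note outC = split_in_nearly_regular_class[OF NC IC V(2,1) s sM k kM]
  have ne: "K \<noteq> {}" "S \<noteq> {}" using k s by auto
  have r: "3 \<le> r" using split_in_nearly_regular_class_degree[OF N I c(1) ne(2) out] .
  have rC: "3 \<le> card M - r" using split_in_nearly_regular_class_degree[OF NC IC c(2) ne(1) outC] .
  have six: "\<not> (r = 3 \<and> card M = 6)"
  proof
    assume h: "r = 3 \<and> card M = 6"
    then have N3: "nearly_regular_class V E M 3 o'" and NC3: "nearly_regular_class V ?E M 3 o'"
      using N NC by simp_all
    show False
    proof (cases "S \<subseteq> M")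
      case True
      have "x = o' \<and> (\<forall>m\<in>M. E m x \<longleftrightarrow> inner E M m + 1 = 3)" if "x \<in> K" "x \<notin> M" for x
        using out[of x] that unfolding conjunct1[OF h] by blast
      then show False using split_in_nearly_regular_class_six[OF N3 _ I c True] h by blast
    next
      case False
      then obtain y where y: "y \<in> S" "y \<notin> M" by blast
      have KM: "K \<subseteq> M"
      proof
        fix x assume x: "x \<in> K"
        show "x \<in> M"
        proof (rule ccontr)
          assume "x \<notin> M"
          then have "x = y" using out[of x] out[of y] x y by blast
          then show False using x y indecomposable_splitD(1)[OF I] by blast
        qed
      qed
      have r3: "card M - r = 3" using h by simp
      have "x = o' \<and> (\<forall>m\<in>M. ?E m x \<longleftrightarrow> inner ?E M m + 1 = 3)" if "x \<in> S" "x \<notin> M" for x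
        using outC[of x, unfolded r3] that by blast
      then show False using split_in_nearly_regular_class_six[OF NC3 _ IC c(2,1) KM] h by blast
    qed
  qed
  have i: "inner ?E M m + inner E M m + 1 = card M" if "m \<in> M" for m
    using inner_complement[OF C that] .
  let ?L = "{m \<in> M. inner E M m + 1 = r}" and ?H = "{m \<in> M. inner ?E M m + 1 = card M - r}"
  have HL0: "?H \<inter> ?L = {}" "M = ?H \<union> ?L"
  proof -
    have "inner E M m + 1 = r \<longleftrightarrow> inner ?E M m + 1 \<noteq> card M - r" if "m \<in> M" for m
      using N that i[OF that] rC by (auto simp: nearly_regular_class_def)
    then show "?H \<inter> ?L = {}" "M = ?H \<union> ?L" by blast+
  qed
  have "finite ?H" "finite ?L" using degree_class_finite[OF C] by auto
  then have "card (?H \<union> ?L) = card ?H + card ?L" using HL0(1) by (rule card_Un_disjoint)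
  then have HL: "card M = card ?H + card ?L" unfolding HL0(2)[symmetric] .
  consider "2 * r \<le> card M" "card M = 2 * r \<Longrightarrow> r \<le> card ?L"
    | "2 * (card M - r) \<le> card M" "card M = 2 * (card M - r) \<Longrightarrow> card M - r \<le> card ?H"
  proof -
    consider "2 * r < card M" | "2 * r > card M" | "2 * r = card M" "r \<le> card ?L" | "2 * r = card M" "r \<le> card ?H"
      using HL by linarith
    then show thesis by cases (use that in auto)
  qed
  then show False
  proof cases
    case 1
    then show False using nearly_regular_class_sparse[OF N r _ _ six] by blast
  next
    case 2
    have "\<not> (card M - r = 3 \<and> card M = 6)" using six by auto
    then show False using nearly_regular_class_sparse[OF NC rC _ _] 2 by blast
  qed
qed

section \<open>Bipartite graphs with a unique realization\<close>

text \<open>In contrast to unigraphs, the isomorphisms have to respect the two sides; this is what lets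
them extend to compositions.\<close>

definition bipartite_unique :: "'a set \<Rightarrow> 'b set \<Rightarrow> ('a \<Rightarrow> 'b \<Rightarrow> bool) \<Rightarrow> bool" where
  "bipartite_unique A B J \<longleftrightarrow> finite A \<and> finite B \<and>
     (\<forall>J'. (\<forall>a\<in>A. card {b \<in> B. J' a b} = card {b \<in> B. J a b}) \<and>
           (\<forall>b\<in>B. card {a \<in> A. J' a b} = card {a \<in> A. J a b}) \<longrightarrow>
        (\<exists>f g. bij_betw f A A \<and> bij_betw g B B \<and> (\<forall>a\<in>A. \<forall>b\<in>B. J a b \<longleftrightarrow> J' (f a) (g b))))"

lemma bipartite_uniqueD:
  assumes "bipartite_unique A B J" "\<And>a. a \<in> A \<Longrightarrow> card {b \<in> B. J' a b} = card {b \<in> B. J a b}"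
    "\<And>b. b \<in> B \<Longrightarrow> card {a \<in> A. J' a b} = card {a \<in> A. J a b}"
  shows "\<exists>f g. bij_betw f A A \<and> bij_betw g B B \<and> (\<forall>a\<in>A. \<forall>b\<in>B. J a b \<longleftrightarrow> J' (f a) (g b))"
  using assms(1)[unfolded bipartite_unique_def, THEN conjunct2, THEN conjunct2, THEN spec, of J']
    assms(2,3) by simp

lemma bipartite_unique_empty:
  assumes "finite A" "finite B" "A = {} \<or> B = {}"
  shows "bipartite_unique A B J"
  unfolding bipartite_unique_def using assms by (auto intro!: exI[of _ id] bij_betw_id)

lemma bipartite_unique_swap:
  assumes "bipartite_unique B A (\<lambda>b a. J a b)"
  shows "bipartite_unique A B J"
  unfolding bipartite_unique_def
proof (intro conjI allI impI)
  show "finite A" "finite B" using assms by (auto simp: bipartite_unique_def)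
  fix J' assume "(\<forall>a\<in>A. card {b \<in> B. J' a b} = card {b \<in> B. J a b}) \<and>
    (\<forall>b\<in>B. card {a \<in> A. J' a b} = card {a \<in> A. J a b})"
  then have "\<exists>f g. bij_betw f B B \<and> bij_betw g A A \<and> (\<forall>b\<in>B. \<forall>a\<in>A. J a b \<longleftrightarrow> J' (g a) (f b))"
    using bipartite_uniqueD[OF assms, of "\<lambda>b a. J' a b"] by simp
  then show "\<exists>f g. bij_betw f A A \<and> bij_betw g B B \<and> (\<forall>a\<in>A. \<forall>b\<in>B. J a b \<longleftrightarrow> J' (f a) (g b))"
    by blast
qed

text \<open>Such a graph is a disjoint union of stars with centres in \<open>A\<close>, and the degrees of the centres
are the sizes of the stars.\<close>

lemma bipartite_unique_leaves:
  assumes fin: "finite A" "finite B" and one: "\<And>b. b \<in> B \<Longrightarrow> card {a \<in> A. J a b} = 1"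
  shows "bipartite_unique A B J"
  unfolding bipartite_unique_def
proof (intro conjI allI impI fin)
  fix J' assume h: "(\<forall>a\<in>A. card {b \<in> B. J' a b} = card {b \<in> B. J a b}) \<and>
    (\<forall>b\<in>B. card {a \<in> A. J' a b} = card {a \<in> A. J a b})"
  have "\<exists>p. {a \<in> A. J a b} = {p}" if "b \<in> B" for b
    using one[OF that] by (meson card_1_singletonE)
  then obtain p where p: "\<And>b. b \<in> B \<Longrightarrow> {a \<in> A. J a b} = {p b}" by metis
  have "\<exists>p. {a \<in> A. J' a b} = {p}" if "b \<in> B" for b
    using one[OF that] h that by (metis card_1_singletonE)
  then obtain p' where p': "\<And>b. b \<in> B \<Longrightarrow> {a \<in> A. J' a b} = {p' b}" by metis
  have J: "J a b \<longleftrightarrow> a = p b" and J': "J' a b \<longleftrightarrow> a = p' b" if "a \<in> A" "b \<in> B" for a b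
    using p[OF that(2)] p'[OF that(2)] that(1) by blast+
  have pA: "p b \<in> A" if "b \<in> B" for b using p[OF that] by blast
  have "\<exists>h. bij_betw h {b \<in> B. J a b} {b \<in> B. J' a b}" if "a \<in> A" for a
    using fin h that by (intro finite_same_card_bij) auto
  then obtain q where q: "\<And>a. a \<in> A \<Longrightarrow> bij_betw (q a) {b \<in> B. J a b} {b \<in> B. J' a b}" by metis
  define g where "g b = q (p b) b" for b
  have g: "g b \<in> B" "p' (g b) = p b" if "b \<in> B" for b
  proof -
    have "b \<in> {c \<in> B. J (p b) c}" using that J[OF pA[OF that] that] by simp
    then have "g b \<in> {c \<in> B. J' (p b) c}" unfolding g_def using q[OF pA[OF that]] bij_betwE by blast
    then show "g b \<in> B" "p' (g b) = p b" using J'[OF pA[OF that], of "g b"] by auto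
  qed
  have inj: "inj_on g B"
  proof (rule inj_onI)
    fix b c assume bc: "b \<in> B" "c \<in> B" "g b = g c"
    then have e: "p b = p c" using g(2) by metis
    have "b \<in> {d \<in> B. J (p b) d}" "c \<in> {d \<in> B. J (p b) d}"
      using bc J[OF pA[OF bc(1)]] e by auto
    then show "b = c" using q[OF pA[OF bc(1)]] bc(3) e unfolding g_def bij_betw_def inj_on_def by metis
  qed
  have "bij_betw g B B"
    unfolding bij_betw_def using inj endo_inj_surj[OF fin(2) _ inj] g(1) by blast
  moreover have "J a b \<longleftrightarrow> J' (id a) (g b)" if "a \<in> A" "b \<in> B" for a b
    using J[OF that] J'[OF that(1) g(1)[OF that(2)]] g(2)[OF that(2)] by simp
  ultimately show "\<exists>f g. bij_betw f A A \<and> bij_betw g B B \<and> (\<forall>a\<in>A. \<forall>b\<in>B. J a b \<longleftrightarrow> J' (f a) (g b))"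
    using bij_betw_id by blast
qed

text \<open>A bipartite graph with the same degrees extends, by the edges of \<open>E\<close> inside \<open>A\<close> and inside
\<open>B\<close>, to a realization of the degrees of \<open>E\<close>. An isomorphism between the two preserves degrees
and therefore maps \<open>A\<close> to \<open>A\<close> and \<open>B\<close> to \<open>B\<close>.\<close>

lemma bipartite_unique_degrees_disjoint:
  assumes U: "uniquely_realized V E" and AB: "A \<union> B = V" "A \<inter> B = {}"
    and d: "\<And>a b. a \<in> A \<Longrightarrow> b \<in> B \<Longrightarrow> deg E a \<noteq> deg E b"
  shows "bipartite_unique A B E"
  unfolding bipartite_unique_def
proof (intro conjI allI impI)
  have G: "graph_on V E" using U by (rule uniquely_realized_graph)
  note sym = graph_on_sym[OF G]
  have f: "finite (nbrs E v)" for v using finite_nbrs[OF G] .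
  have fV: "finite V" using G by (rule graph_on_finite)
  show fA: "finite A" and fB: "finite B" using AB fV by auto
  fix J assume h: "(\<forall>a\<in>A. card {b \<in> B. J a b} = card {b \<in> B. E a b}) \<and>
    (\<forall>b\<in>B. card {a \<in> A. J a b} = card {a \<in> A. E a b})"
  define E' where "E' x y \<longleftrightarrow> (if x \<in> A \<and> y \<in> B then J x y else if x \<in> B \<and> y \<in> A then J y x else E x y)" for x y
  have ir: "\<not> E v v" for v using G by (rule graph_on_irrefl)
  have "E' y x" if "E' x y" for x y
    using that AB(2) sym[of x y] by (auto simp: E'_def split: if_splits)
  moreover have "x \<in> V \<and> y \<in> V" if "E' x y" for x y
    using that graph_on_in[OF G, of x y] AB(1) by (auto simp: E'_def split: if_splits)
  moreover have "\<not> E' x x" for x using ir AB(2) by (auto simp: E'_def)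
  ultimately have G': "graph_on V E'" using fV unfolding graph_on_def by blast
  have "deg E' x = deg E x" if x: "x \<in> V" for x
  proof (cases "x \<in> A")
    case True
    have "nbrs E' x = {b \<in> B. J x b} \<union> (nbrs E x - B)" "nbrs E x = {b \<in> B. E x b} \<union> (nbrs E x - B)"
      using True AB by (auto simp: E'_def split: if_splits)
    moreover have "card ({b \<in> B. J x b} \<union> (nbrs E x - B)) = card {b \<in> B. J x b} + card (nbrs E x - B)"
      "card ({b \<in> B. E x b} \<union> (nbrs E x - B)) = card {b \<in> B. E x b} + card (nbrs E x - B)"
      using fB f by (auto intro!: card_Un_disjoint)
    ultimately show ?thesis unfolding deg_def using h True by metis
  next
    case False
    then have xB: "x \<in> B" using x AB by blast
    have "nbrs E' x = {a \<in> A. J a x} \<union> (nbrs E x - A)" "nbrs E x = {a \<in> A. E a x} \<union> (nbrs E x - A)"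
      using xB False AB sym[of x] by (auto simp: E'_def split: if_splits)
    moreover have "card ({a \<in> A. J a x} \<union> (nbrs E x - A)) = card {a \<in> A. J a x} + card (nbrs E x - A)"
      "card ({a \<in> A. E a x} \<union> (nbrs E x - A)) = card {a \<in> A. E a x} + card (nbrs E x - A)"
      using fA f by (auto intro!: card_Un_disjoint)
    ultimately show ?thesis unfolding deg_def using h xB by metis
  qed
  note D = this
  then obtain F where F: "bij_betw F V V" "\<forall>x\<in>V. \<forall>y\<in>V. E x y \<longleftrightarrow> E' (F x) (F y)"
    using U G' unfolding uniquely_realized_def by blast
  have FV: "F x \<in> V" if "x \<in> V" for x using F(1) that by (rule bij_betw_apply)
  have Fd: "deg E (F x) = deg E x" if "x \<in> V" for x
    using isomorphism_deg[OF G G' F that] D[OF FV[OF that]] by simp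
  have FA: "F ` A \<subseteq> A" using FV Fd d AB by (metis UnE UnI1 image_subsetI)
  have FB: "F ` B \<subseteq> B" using FV Fd d AB by (metis UnE UnI2 image_subsetI)
  have inj: "inj_on F V" using F(1) by (rule bij_betw_imp_inj_on)
  have iA: "inj_on F A" and iB: "inj_on F B" using inj AB(1) by (auto intro: inj_on_subset)
  have "bij_betw F A A" "bij_betw F B B"
    using endo_inj_surj[OF fA FA iA] endo_inj_surj[OF fB FB iB] iA iB by (auto simp: bij_betw_def)
  moreover have "E a b \<longleftrightarrow> J (F a) (F b)" if ab: "a \<in> A" "b \<in> B" for a b
  proof -
    have "E a b \<longleftrightarrow> E' (F a) (F b)" using F(2) ab AB by blast
    moreover have "F a \<in> A" "F b \<in> B" using FA FB ab by auto
    ultimately show ?thesis by (simp add: E'_def)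
  qed
  ultimately show "\<exists>f g. bij_betw f A A \<and> bij_betw g B B \<and> (\<forall>a\<in>A. \<forall>b\<in>B. E a b \<longleftrightarrow> J (f a) (g b))"
    by blast
qed


section \<open>Compositions with a unique realization\<close>

text \<open>The shape of a composition: \<open>A\<close> and \<open>B\<close> are the clique and the stable set of the outer
factor, and \<open>C\<close> is the vertex set of the inner one.\<close>

definition composed :: "'a set \<Rightarrow> 'a set \<Rightarrow> 'a set \<Rightarrow> ('a \<Rightarrow> 'a \<Rightarrow> bool) \<Rightarrow> bool" where
  "composed A B C E \<longleftrightarrow> (\<forall>a\<in>A. \<forall>x\<in>A \<union> C. x \<noteq> a \<longrightarrow> E a x) \<and> (\<forall>b\<in>B. \<forall>x\<in>B \<union> C. \<not> E b x)"

lemma composedD: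
  assumes "composed A B C E"
  shows "a \<in> A \<Longrightarrow> x \<in> A \<union> C \<Longrightarrow> x \<noteq> a \<Longrightarrow> E a x" "b \<in> B \<Longrightarrow> x \<in> B \<union> C \<Longrightarrow> \<not> E b x"
  using assms unfolding composed_def by blast+

text \<open>The degree sum over \<open>A\<close> minus the one over \<open>B\<close> counts adjacencies of \<open>A\<close> with \<open>A \<union> C\<close> minus
adjacencies of \<open>B\<close> with \<open>B \<union> C\<close>, since the edges between \<open>A\<close> and \<open>B\<close> cancel. A composition
attains the largest possible value of this difference, and nothing else does.\<close>

lemma composed_degrees:
  assumes G: "graph_on V E" and V: "V = A \<union> B \<union> C" "A \<inter> B = {}" "A \<inter> C = {}" "B \<inter> C = {}"
    and P: "composed A B C E" and G': "graph_on V E'" and D: "\<And>x. x \<in> V \<Longrightarrow> deg E' x = deg E x"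
  shows "composed A B C E'"
proof -
  have fin: "finite A" "finite B" "finite C" using graph_on_finite[OF G] V by auto
  define p where "p E x = card (nbrs E x \<inter> (A \<union> C))" for E and x :: 'a
  define q where "q E x = card (nbrs E x \<inter> (B \<union> C))" for E and x :: 'a
  have main: "sum (deg F) A + sum (q F) B = sum (deg F) B + sum (p F) A" if GF: "graph_on V F" for F
  proof -
    have f: "finite (nbrs F v)" for v using finite_nbrs[OF GF] .
    have nV: "nbrs F v \<subseteq> A \<union> B \<union> C" for v using nbrs_subset[OF GF] V(1) by blast
    have a: "deg F x = p F x + card (nbrs F x \<inter> B)" for x
    proof -
      have "nbrs F x = nbrs F x \<inter> (A \<union> C) \<union> nbrs F x \<inter> B" using nV[of x] by blast
      moreover have "card (nbrs F x \<inter> (A \<union> C) \<union> nbrs F x \<inter> B) = p F x + card (nbrs F x \<inter> B)"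
        unfolding p_def using f V by (intro card_Un_disjoint) auto
      ultimately show ?thesis unfolding deg_def by simp
    qed
    have b: "deg F x = q F x + card (nbrs F x \<inter> A)" for x
    proof -
      have "nbrs F x = nbrs F x \<inter> (B \<union> C) \<union> nbrs F x \<inter> A" using nV[of x] by blast
      moreover have "card (nbrs F x \<inter> (B \<union> C) \<union> nbrs F x \<inter> A) = q F x + card (nbrs F x \<inter> A)"
        unfolding q_def using f V by (intro card_Un_disjoint) auto
      ultimately show ?thesis unfolding deg_def by simp
    qed
    have e: "card (nbrs F m \<inter> T) = (\<Sum>t\<in>T. of_bool (F m t))" if "finite T" for m and T
      using that by (simp add: of_bool_def sum.If_cases Int_commute nbrs_def)
    have "(\<Sum>x\<in>A. card (nbrs F x \<inter> B)) = (\<Sum>x\<in>B. card (nbrs F x \<inter> A))"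
    proof -
      have "(\<Sum>x\<in>A. card (nbrs F x \<inter> B)) = (\<Sum>x\<in>A. \<Sum>y\<in>B. of_bool (F x y))"
        using fin by (simp only: e)
      also have "\<dots> = (\<Sum>y\<in>B. \<Sum>x\<in>A. of_bool (F y x))"
        by (subst sum.swap)
          (rule sum.cong[OF refl], rule sum.cong[OF refl], subst graph_on_sym[OF GF], rule refl)
      also have "\<dots> = (\<Sum>x\<in>B. card (nbrs F x \<inter> A))" using fin by (simp only: e)
      finally show ?thesis .
    qed
    moreover have "sum (deg F) A = sum (p F) A + (\<Sum>x\<in>A. card (nbrs F x \<inter> B))"
      using a by (simp add: sum.distrib)
    moreover have "sum (deg F) B = sum (q F) B + (\<Sum>x\<in>B. card (nbrs F x \<inter> A))"
      using b by (simp add: sum.distrib)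
    ultimately show ?thesis by linarith
  qed
  have ir: "\<not> E v v" "\<not> E' v v" for v using G G' by (auto dest: graph_on_irrefl)
  have pE: "nbrs E x \<inter> (A \<union> C) = A \<union> C - {x}" if "x \<in> A" for x
    using P that ir unfolding composed_def by auto
  have "nbrs E x \<inter> (B \<union> C) = {}" if "x \<in> B" for x using P that unfolding composed_def by auto
  then have "sum (q E) B = 0" by (simp add: q_def)
  moreover have "sum (deg E') A = sum (deg E) A" "sum (deg E') B = sum (deg E) B"
    using D V(1) by (auto intro!: sum.cong)
  ultimately have eq: "sum (p E') A = sum (p E) A + sum (q E') B"
    using main[OF G] main[OF G'] by linarith
  have sub: "nbrs E' x \<inter> (A \<union> C) \<subseteq> A \<union> C - {x}" for x using ir by auto
  have le: "p E' x \<le> p E x" if "x \<in> A" for x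
    unfolding p_def pE[OF that] using fin sub by (intro card_mono) auto
  have "sum (p E') A \<le> sum (p E) A" using le by (rule sum_mono)
  then have q0: "sum (q E') B = 0" and pp: "sum (p E') A = sum (p E) A" using eq by auto
  have peq: "p E' x = p E x" if "x \<in> A" for x
    using sum_strict_mono_ex1[of A "p E'" "p E"] le that fin(1) pp by (metis le_neq_implies_less nat_less_le)
  show ?thesis
    unfolding composed_def
  proof (intro conjI ballI impI)
    fix a x assume ax: "a \<in> A" "x \<in> A \<union> C" "x \<noteq> a"
    have "nbrs E' a \<inter> (A \<union> C) = A \<union> C - {a}"
      using peq[OF ax(1)] fin sub unfolding p_def pE[OF ax(1)] by (intro card_subset_eq) auto
    then have "x \<in> nbrs E' a \<inter> (A \<union> C)" using ax by simp
    then show "E' a x" by simp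
  next
    fix b x assume bx: "b \<in> B" "x \<in> B \<union> C"
    have "q E' b = 0" using q0 fin bx(1) by simp
    then have "nbrs E' b \<inter> (B \<union> C) = {}" using fin by (simp add: q_def)
    then show "\<not> E' b x" using bx(2) by auto
  qed
qed

fun sum_compose :: "'a set \<Rightarrow> 'b set \<Rightarrow> 'c set \<Rightarrow> ('a \<Rightarrow> 'b \<Rightarrow> bool) \<Rightarrow> ('c \<Rightarrow> 'c \<Rightarrow> bool) \<Rightarrow>
    ('a + 'b) + 'c \<Rightarrow> ('a + 'b) + 'c \<Rightarrow> bool" where
  "sum_compose A B C J E (Inl (Inl a)) (Inl (Inl a')) \<longleftrightarrow> a \<in> A \<and> a' \<in> A \<and> a \<noteq> a'"
| "sum_compose A B C J E (Inl (Inl a)) (Inl (Inr b)) \<longleftrightarrow> a \<in> A \<and> b \<in> B \<and> J a b"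
| "sum_compose A B C J E (Inl (Inr b)) (Inl (Inl a)) \<longleftrightarrow> a \<in> A \<and> b \<in> B \<and> J a b"
| "sum_compose A B C J E (Inl (Inr b)) (Inl (Inr b')) \<longleftrightarrow> False"
| "sum_compose A B C J E (Inl (Inl a)) (Inr c) \<longleftrightarrow> a \<in> A \<and> c \<in> C"
| "sum_compose A B C J E (Inr c) (Inl (Inl a)) \<longleftrightarrow> a \<in> A \<and> c \<in> C"
| "sum_compose A B C J E (Inl (Inr b)) (Inr c) \<longleftrightarrow> False"
| "sum_compose A B C J E (Inr c) (Inl (Inr b)) \<longleftrightarrow> False"
| "sum_compose A B C J E (Inr c) (Inr c') \<longleftrightarrow> c \<in> C \<and> c' \<in> C \<and> E c c'"

lemma card_Inl_Inr:
  assumes "finite A" "finite B" "finite C"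
  shows "card (Inl ` Inl ` A \<union> Inl ` Inr ` B \<union> Inr ` C) = card A + card B + card C"
  using assms by (subst card_Un_disjoint; (subst card_Un_disjoint)?) (auto simp: card_image)

text \<open>In a realization of the same degrees, which again has the shape of a composition, the
bipartite part and the inner factor have the degrees that they have in the original graph.
Isomorphisms of these two parts, which exist by assumption, combine to an isomorphism of the
whole.\<close>

lemma uniquely_realized_sum_compose:
  fixes A :: "'a set" and B :: "'b set" and C :: "'c set"
  assumes J: "bipartite_unique A B J" and U: "uniquely_realized C E"
  shows "uniquely_realized (Inl ` Inl ` A \<union> Inl ` Inr ` B \<union> Inr ` C) (sum_compose A B C J E)"
    (is "uniquely_realized ?V ?E")
proof -
  have GC: "graph_on C E" using U by (rule uniquely_realized_graph)
  have fin: "finite A" "finite B" "finite C"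
    using J graph_on_finite[OF GC] by (auto simp: bipartite_unique_def)
  have cases: "(\<exists>a. x = Inl (Inl a)) \<or> (\<exists>b. x = Inl (Inr b)) \<or> (\<exists>c. x = Inr c)" for x :: "('a + 'b) + 'c"
    by (metis sum.exhaust)
  have G: "graph_on ?V ?E"
    unfolding graph_on_def
  proof (intro conjI allI impI)
    fix x y assume e: "?E x y"
    show "x \<in> ?V" "y \<in> ?V" "?E y x"
      using e cases[of x] cases[of y] graph_on_sym[OF GC] by auto
  next
    show "\<not> ?E x x" for x using cases[of x] graph_on_irrefl[OF GC] by auto
  qed (use fin in auto)
  let ?A = "Inl ` Inl ` A :: (('a + 'b) + 'c) set" and ?B = "Inl ` Inr ` B :: (('a + 'b) + 'c) set"
    and ?C = "Inr ` C :: (('a + 'b) + 'c) set"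
  have comp: "composed ?A ?B ?C ?E" by (auto simp: composed_def)
  have form: "(\<forall>a\<in>A. deg F (Inl (Inl a)) = card A - 1 + card {b \<in> B. F (Inl (Inl a)) (Inl (Inr b))} + card C) \<and>
      (\<forall>b\<in>B. deg F (Inl (Inr b)) = card {a \<in> A. F (Inl (Inl a)) (Inl (Inr b))}) \<and>
      (\<forall>c\<in>C. deg F (Inr c) = card A + deg (\<lambda>c c'. F (Inr c) (Inr c')) c)"
    if GF: "graph_on ?V F" and c: "composed ?A ?B ?C F" for F
  proof (intro conjI ballI)
    note sym = graph_on_sym[OF GF]
    have inV: "y \<in> ?V" if "F x y" for x y using graph_on_in[OF GF that] by simp
    have ir: "\<not> F x x" for x using graph_on_irrefl[OF GF] .
    have FA: "F (Inl (Inl a)) x" if "a \<in> A" "x \<in> ?A \<union> ?C" "x \<noteq> Inl (Inl a)" for a x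
      by (rule composedD(1)[OF c]) (use that in auto)
    fix a assume a: "a \<in> A"
    have "nbrs F (Inl (Inl a)) = Inl ` Inl ` (A - {a}) \<union> Inl ` Inr ` {b \<in> B. F (Inl (Inl a)) (Inl (Inr b))} \<union> Inr ` C"
      (is "?l = ?r")
    proof
      show "?l \<subseteq> ?r"
      proof
        fix y assume "y \<in> ?l"
        then have "F (Inl (Inl a)) y" "y \<noteq> Inl (Inl a)" using ir by auto
        then show "y \<in> ?r" using inV[of "Inl (Inl a)" y] by blast
      qed
      have "F (Inl (Inl a)) (Inl (Inl a'))" if "a' \<in> A" "a' \<noteq> a" for a'
        using FA[OF a, of "Inl (Inl a')"] that by simp
      moreover have "F (Inl (Inl a)) (Inr c)" if "c \<in> C" for c
        using FA[OF a, of "Inr c"] that by simp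
      ultimately show "?r \<subseteq> ?l"
        unfolding image_image Un_subset_iff image_subset_iff in_nbrs by blast
    qed
    then show "deg F (Inl (Inl a)) = card A - 1 + card {b \<in> B. F (Inl (Inl a)) (Inl (Inr b))} + card C"
      unfolding deg_def using fin a by (simp add: card_Inl_Inr)
  next
    note sym = graph_on_sym[OF GF]
    fix b assume b: "b \<in> B"
    have "nbrs F (Inl (Inr b)) = Inl ` Inl ` {a \<in> A. F (Inl (Inl a)) (Inl (Inr b))} \<union> Inl ` Inr ` {} \<union> Inr ` {}"
      (is "?l = ?r")
    proof
      show "?l \<subseteq> ?r"
      proof
        fix y assume y: "y \<in> ?l"
        then have "y \<in> ?V" "\<not> y \<in> ?B \<union> ?C"
          using graph_on_in[OF GF, of "Inl (Inr b)" y] composedD(2)[OF c, of "Inl (Inr b)" y] b by auto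
        then have "y \<in> ?A" by blast
        then show "y \<in> ?r" using y sym[of "Inl (Inr b)" y] by auto
      qed
      show "?r \<subseteq> ?l" using sym by auto
    qed
    then show "deg F (Inl (Inr b)) = card {a \<in> A. F (Inl (Inl a)) (Inl (Inr b))}"
      unfolding deg_def using fin by (simp add: card_image inj_on_def)
  next
    note sym = graph_on_sym[OF GF]
    fix v assume v: "v \<in> C"
    have FB: "\<not> F (Inr v) (Inl (Inr b))" if "b \<in> B" for b
      using composedD(2)[OF c, of "Inl (Inr b)" "Inr v"] v that sym[of "Inr v"] by auto
    have FA: "F (Inr v) (Inl (Inl a))" if "a \<in> A" for a
      using composedD(1)[OF c, of "Inl (Inl a)" "Inr v"] v that sym[of "Inr v"] by auto
    have "nbrs F (Inr v) = Inl ` Inl ` A \<union> Inl ` Inr ` {} \<union> Inr ` nbrs (\<lambda>c c'. F (Inr c) (Inr c')) v"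
      (is "?l = ?r")
    proof
      show "?l \<subseteq> ?r"
      proof
        fix y assume y: "y \<in> ?l"
        then have "y \<in> ?V" "\<not> y \<in> ?B"
          using graph_on_in[OF GF, of "Inr v" y] FB by auto
        then show "y \<in> ?r" using y by auto
      qed
      show "?r \<subseteq> ?l" using FA by auto
    qed
    moreover have "nbrs (\<lambda>c c'. F (Inr c) (Inr c')) v \<subseteq> C"
    proof
      fix y assume "y \<in> nbrs (\<lambda>c c'. F (Inr c) (Inr c')) v"
      then have "Inr y \<in> ?V" using graph_on_in[OF GF, of "Inr v" "Inr y"] by simp
      then show "y \<in> C" by auto
    qed
    then have "finite (nbrs (\<lambda>c c'. F (Inr c) (Inr c')) v)" using fin(3) by (rule finite_subset)
    ultimately show "deg F (Inr v) = card A + deg (\<lambda>c c'. F (Inr c) (Inr c')) v"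
      unfolding deg_def using fin card_Inl_Inr[of A "{}" "nbrs (\<lambda>c c'. F (Inr c) (Inr c')) v"] by simp
  qed
  show ?thesis
    unfolding uniquely_realized_def
  proof (intro conjI allI impI G)
    fix E' assume h: "graph_on ?V E' \<and> (\<forall>x\<in>?V. deg E' x = deg ?E x)"
    then have G': "graph_on ?V E'" and D: "\<And>x. x \<in> ?V \<Longrightarrow> deg E' x = deg ?E x" by auto
    note sym' = graph_on_sym[OF G']
    have comp': "composed ?A ?B ?C E'"
      by (rule composed_degrees[OF G refl _ _ _ comp G' D]) auto
    note fE = form[OF G comp, THEN conjunct1, rule_format]
      form[OF G comp, THEN conjunct2, THEN conjunct1, rule_format]
      form[OF G comp, THEN conjunct2, THEN conjunct2, rule_format]
    note fE' = form[OF G' comp', THEN conjunct1, rule_format]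
      form[OF G' comp', THEN conjunct2, THEN conjunct1, rule_format]
      form[OF G' comp', THEN conjunct2, THEN conjunct2, rule_format]
    let ?J = "\<lambda>a b. E' (Inl (Inl a)) (Inl (Inr b))" and ?EC = "\<lambda>c c'. E' (Inr c) (Inr c')"
    have "card {b \<in> B. ?J a b} = card {b \<in> B. J a b}" if "a \<in> A" for a
    proof -
      have "{b \<in> B. ?E (Inl (Inl a)) (Inl (Inr b))} = {b \<in> B. J a b}" using that by auto
      moreover have "deg E' (Inl (Inl a)) = deg ?E (Inl (Inl a))" using D that by simp
      ultimately show ?thesis using fE(1)[OF that] fE'(1)[OF that] by simp
    qed
    moreover have "card {a \<in> A. ?J a b} = card {a \<in> A. J a b}" if "b \<in> B" for b
    proof -
      have "{a \<in> A. ?E (Inl (Inl a)) (Inl (Inr b))} = {a \<in> A. J a b}" using that by auto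
      moreover have "deg E' (Inl (Inr b)) = deg ?E (Inl (Inr b))" using D that by simp
      ultimately show ?thesis using fE(2)[OF that] fE'(2)[OF that] by simp
    qed
    ultimately obtain f g where fg: "bij_betw f A A" "bij_betw g B B"
        "\<forall>a\<in>A. \<forall>b\<in>B. J a b \<longleftrightarrow> ?J (f a) (g b)"
      using J[THEN bipartite_uniqueD, of ?J] by blast
    have GEC: "graph_on C ?EC"
      unfolding graph_on_def
    proof (intro conjI allI impI fin(3))
      fix c c' assume e: "?EC c c'"
      then have "Inr c \<in> ?V" "Inr c' \<in> ?V" using graph_on_in[OF G'] by blast+
      then show "c \<in> C" "c' \<in> C" by auto
      show "?EC c' c" using e sym' by blast
    next
      show "\<not> ?EC c c" for c using graph_on_irrefl[OF G'] .
    qed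
    have "deg ?EC c = deg E c" if "c \<in> C" for c
    proof -
      have "deg E' (Inr c) = deg ?E (Inr c)" using D that by simp
      moreover have "(\<lambda>c c'. ?E (Inr c) (Inr c')) = E"
        using graph_on_in[OF GC] by (auto simp: fun_eq_iff)
      ultimately show ?thesis using fE(3)[OF that] fE'(3)[OF that] by simp
    qed
    then obtain k where k: "bij_betw k C C" "\<forall>x\<in>C. \<forall>y\<in>C. E x y \<longleftrightarrow> ?EC (k x) (k y)"
      using U GEC unfolding uniquely_realized_def by blast
    let ?m = "map_sum (map_sum f g) k"
    have fi: "f a = f a' \<longleftrightarrow> a = a'" if "a \<in> A" "a' \<in> A" for a a'
      using that bij_betw_imp_inj_on[OF fg(1)] by (simp add: inj_on_eq_iff)
    have gi: "g b = g b' \<longleftrightarrow> b = b'" if "b \<in> B" "b' \<in> B" for b b'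
      using that bij_betw_imp_inj_on[OF fg(2)] by (simp add: inj_on_eq_iff)
    have ki: "k c = k c' \<longleftrightarrow> c = c'" if "c \<in> C" "c' \<in> C" for c c'
      using that bij_betw_imp_inj_on[OF k(1)] by (simp add: inj_on_eq_iff)
    have inj: "inj_on ?m ?V"
    proof (rule inj_onI)
      fix x y assume "x \<in> ?V" "y \<in> ?V" "?m x = ?m y"
      then show "x = y" by (elim UnE imageE) (simp_all add: fi gi ki)
    qed
    have into: "?m x \<in> ?V" if "x \<in> ?V" for x
      using that bij_betwE[OF fg(1)] bij_betwE[OF fg(2)] bij_betwE[OF k(1)] by auto
    have "finite ?V" using fin by simp
    moreover have "?m ` ?V \<subseteq> ?V" using into by (rule image_subsetI)
    ultimately have "?m ` ?V = ?V" using inj by (rule endo_inj_surj)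
    then have bij: "bij_betw ?m ?V ?V" using inj by (simp add: bij_betw_def)
    have hom: "?E x y \<longleftrightarrow> E' (?m x) (?m y)" if xy: "x \<in> ?V" "y \<in> ?V" for x y
    proof -
      have A': "E' (Inl (Inl a)) z" if "a \<in> A" "z \<in> ?A \<union> ?C" "z \<noteq> Inl (Inl a)" for a z
        by (rule composedD(1)[OF comp']) (use that in auto)
      have B': "\<not> E' (Inl (Inr b)) z" if "b \<in> B" "z \<in> ?B \<union> ?C" for b z
        by (rule composedD(2)[OF comp']) (use that in auto)
      have fA: "f a \<in> A" if "a \<in> A" for a using fg(1) that by (rule bij_betw_apply)
      have gB: "g b \<in> B" if "b \<in> B" for b using fg(2) that by (rule bij_betw_apply)
      have kC: "k c \<in> C" if "c \<in> C" for c using k(1) that by (rule bij_betw_apply)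
      have ir: "\<not> E' z z" for z using graph_on_irrefl[OF G'] .
      have aa: "E' (Inl (Inl (f a))) (Inl (Inl (f a'))) \<longleftrightarrow> a \<noteq> a'" if "a \<in> A" "a' \<in> A" for a a'
        using A'[of "f a" "Inl (Inl (f a'))"] that fA fi ir by auto
      have ab: "E' (Inl (Inl (f a))) (Inl (Inr (g b))) \<longleftrightarrow> J a b" if "a \<in> A" "b \<in> B" for a b
        using fg(3) that by simp
      have ac: "E' (Inl (Inl (f a))) (Inr (k c))" if "a \<in> A" "c \<in> C" for a c
        using A' that fA kC by simp
      have bb: "\<not> E' (Inl (Inr (g b))) (Inl (Inr (g b')))" if "b \<in> B" "b' \<in> B" for b b'
        using B' that gB by simp
      have bc: "\<not> E' (Inl (Inr (g b))) (Inr (k c))" if "b \<in> B" "c \<in> C" for b c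
        using B' that gB kC by simp
      have ba: "E' (Inl (Inr (g b))) (Inl (Inl (f a))) \<longleftrightarrow> J a b" if "a \<in> A" "b \<in> B" for a b
        using ab[OF that] sym' by blast
      have ca: "E' (Inr (k c)) (Inl (Inl (f a)))" if "a \<in> A" "c \<in> C" for a c
        using ac[OF that] sym' by blast
      have cb: "\<not> E' (Inr (k c)) (Inl (Inr (g b)))" if "b \<in> B" "c \<in> C" for b c
        using bc[OF that] sym' by blast
      have cc: "E' (Inr (k c)) (Inr (k c')) \<longleftrightarrow> E c c'" if "c \<in> C" "c' \<in> C" for c c'
        using k(2) that by simp
      from xy show ?thesis
        by (elim UnE imageE) (simp_all add: aa ab ac ba bb bc ca cb cc)
    qed
    show "\<exists>f. bij_betw f ?V ?V \<and> (\<forall>x\<in>?V. \<forall>y\<in>?V. ?E x y \<longleftrightarrow> E' (f x) (f y))"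
      by (intro exI[of _ ?m] conjI ballI bij hom)
  qed
qed

section \<open>Induced subgraphs of unigraphs\<close>

lemma simple_graph_graph_on: "simple_graph G \<longleftrightarrow> graph_on (verts G) (adj G)"
  by (auto simp: simple_graph_def graph_on_def)

lemma degree_deg: "simple_graph G \<Longrightarrow> degree G v = deg (adj G) v"
  by (auto simp: simple_graph_def degree_def deg_def nbrs_def intro!: arg_cong[of _ _ card])

lemma bij_betw_of_image_mset_eq:
  assumes "finite A" "finite B" "image_mset f (mset_set A) = image_mset g (mset_set B)"
  shows "\<exists>h. bij_betw h A B \<and> (\<forall>x\<in>A. g (h x) = f x)"
  using assms
proof (induction A arbitrary: B rule: finite_induct)
  case empty
  then have "B = {}" by (simp add: mset_set_empty_iff)
  then show ?case by (auto simp: bij_betw_def)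
next
  case (insert a A)
  have e: "image_mset g (mset_set B) = add_mset (f a) (image_mset f (mset_set A))"
    using insert.prems(2) insert.hyps by simp
  then have "f a \<in># image_mset g (mset_set B)" by simp
  then obtain b where b: "b \<in> B" "g b = f a" using insert.prems(1) by auto
  have "mset_set B = add_mset b (mset_set (B - {b}))"
    using b(1) insert.prems(1) by (simp add: mset_set.remove)
  then have "image_mset f (mset_set A) = image_mset g (mset_set (B - {b}))"
    using e b(2) by simp
  then obtain h where h: "bij_betw h A (B - {b})" "\<forall>x\<in>A. g (h x) = f x"
    using insert.IH[of "B - {b}"] insert.prems by auto
  have "bij_betw (h(a := b)) A (B - {b})"
    using h(1) insert.hyps(2) by (metis bij_betw_cong fun_upd_other)
  then have "bij_betw (h(a := b)) (A \<union> {a}) ((B - {b}) \<union> {(h(a := b)) a})"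
    using notIn_Un_bij_betw3[of a A "h(a := b)" "B - {b}"] insert.hyps(2) by simp
  moreover have "A \<union> {a} = insert a A" "(B - {b}) \<union> {(h(a := b)) a} = B" using b(1) by auto
  ultimately have "bij_betw (h(a := b)) (insert a A) B" by simp
  moreover have "\<forall>x\<in>insert a A. g ((h(a := b)) x) = f x" using h(2) b(2) by simp
  ultimately show ?case by blast
qed

text \<open>A degree-preserving bijection of the vertices carries \<open>F\<close> to a graph on \<open>V\<close>.\<close>

lemma uniquely_realized_isomorphic:
  assumes U: "uniquely_realized V E" and H: "graph_on W F"
    and d: "image_mset (deg E) (mset_set V) = image_mset (deg F) (mset_set W)"
  obtains f where "bij_betw f V W" "\<And>x y. x \<in> V \<Longrightarrow> y \<in> V \<Longrightarrow> E x y \<longleftrightarrow> F (f x) (f y)"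
proof -
  have G: "graph_on V E" using U by (rule uniquely_realized_graph)
  obtain h where h: "bij_betw h V W" "\<forall>x\<in>V. deg F (h x) = deg E x"
    using bij_betw_of_image_mset_eq[OF _ _ d] graph_on_finite[OF G] graph_on_finite[OF H] by blast
  define E' where "E' x y \<longleftrightarrow> x \<in> V \<and> y \<in> V \<and> F (h x) (h y)" for x y
  have G': "graph_on V E'"
    using graph_on_finite[OF G] graph_on_sym[OF H] graph_on_irrefl[OF H] by (auto simp: graph_on_def E'_def)
  have e: "\<forall>x\<in>V. \<forall>y\<in>V. E' x y \<longleftrightarrow> F (h x) (h y)" by (simp add: E'_def)
  have "\<forall>x\<in>V. deg E' x = deg E x" using isomorphism_deg[OF G' H h(1) e] h(2) by simp
  then obtain f where f: "bij_betw f V V" "\<forall>x\<in>V. \<forall>y\<in>V. E x y \<longleftrightarrow> E' (f x) (f y)"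
    using U G' unfolding uniquely_realized_def by blast
  show thesis
  proof (rule that)
    show "bij_betw (h \<circ> f) V W" using f(1) h(1) by (rule bij_betw_trans)
    show "E x y \<longleftrightarrow> F ((h \<circ> f) x) ((h \<circ> f) y)" if "x \<in> V" "y \<in> V" for x y
      using f(2) that bij_betw_apply[OF f(1)] by (simp add: E'_def)
  qed
qed

text \<open>The vertex type of the surrounding graph is arbitrary here: a finite graph can be numbered.
This is what allows compositions to be built on sum types.\<close>

lemma HCU_I:
  assumes S: "simple_graph G" and U: "uniquely_realized V E" and f: "inj_on f (verts G)" "f ` verts G \<subseteq> V"
    and adj: "\<And>x y. x \<in> verts G \<Longrightarrow> y \<in> verts G \<Longrightarrow> adj G x y \<longleftrightarrow> E (f x) (f y)"
  shows "G \<in> HCU"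
proof -
  have GE: "graph_on V E" using U by (rule uniquely_realized_graph)
  obtain e where e: "bij_betw e V {0..<card V}"
    using ex_bij_betw_finite_nat[OF graph_on_finite[OF GE]] by blast
  let ?i = "inv_into V e"
  have i: "bij_betw ?i {0..<card V} V" using e by (rule bij_betw_inv_into)
  have ie: "?i (e x) = x" if "x \<in> V" for x using e that by (simp add: bij_betw_inv_into_left)
  define U where "U = \<lparr>verts = {0..<card V}, adj = (\<lambda>x y. x < card V \<and> y < card V \<and> E (?i x) (?i y))\<rparr>"
  have GU: "graph_on (verts U) (adj U)"
    using graph_on_sym[OF GE] graph_on_irrefl[OF GE] by (auto simp: graph_on_def U_def)
  have ei: "bij_betw ?i (verts U) V" using i by (simp add: U_def)
  have ea: "\<forall>x\<in>verts U. \<forall>y\<in>verts U. adj U x y \<longleftrightarrow> E (?i x) (?i y)" by (simp add: U_def)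
  have "unigraph U"
    unfolding unigraph_def
  proof (intro conjI allI impI)
    show "simple_graph U" using GU by (simp add: simple_graph_graph_on)
    fix H :: "nat graph" assume H: "simple_graph H \<and> degree_sequence H = degree_sequence U"
    then have GH: "graph_on (verts H) (adj H)" by (simp add: simple_graph_graph_on)
    have "degree_sequence U = image_mset (deg E) (mset_set V)"
    proof -
      have "degree_sequence U = image_mset (\<lambda>x. deg E (?i x)) (mset_set (verts U))"
        unfolding degree_sequence_def
      proof (rule image_mset_cong)
        fix x assume "x \<in># mset_set (verts U)"
        then have "x \<in> verts U" using graph_on_finite[OF GU] by simp
        then show "degree U x = deg E (?i x)"
          using isomorphism_deg[OF GU GE ei ea] degree_deg[of U] GU by (simp add: simple_graph_graph_on)
      qed
      also have "\<dots> = image_mset (deg E) (image_mset ?i (mset_set (verts U)))"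
        by (simp add: image_mset.compositionality comp_def)
      also have "image_mset ?i (mset_set (verts U)) = mset_set V"
        using ei by (simp add: image_mset_mset_set bij_betw_def)
      finally show ?thesis .
    qed
    moreover have "degree_sequence H = image_mset (deg (adj H)) (mset_set (verts H))"
      unfolding degree_sequence_def using H degree_deg[of H] by (intro image_mset_cong) simp
    ultimately obtain g where g: "bij_betw g V (verts H)"
        "\<And>x y. x \<in> V \<Longrightarrow> y \<in> V \<Longrightarrow> E x y \<longleftrightarrow> adj H (g x) (g y)"
      using uniquely_realized_isomorphic[OF U GH] H by metis
    have "bij_betw (g \<circ> ?i) (verts U) (verts H)" using ei g(1) by (rule bij_betw_trans)
    moreover have "adj U x y \<longleftrightarrow> adj H ((g \<circ> ?i) x) ((g \<circ> ?i) y)" if "x \<in> verts U" "y \<in> verts U" for x y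
      using ea that g(2) bij_betw_apply[OF ei] by simp
    ultimately show "isomorphic U H" unfolding isomorphic_def by blast
  qed
  moreover have "e ` f ` verts G \<subseteq> verts U" using f(2) e by (auto simp: U_def bij_betw_def)
  moreover have "isomorphic G (induced_subgraph U (e ` f ` verts G))"
    unfolding isomorphic_def
  proof (intro exI conjI ballI)
    have "inj_on e (f ` verts G)" using e f(2) by (auto simp: bij_betw_def intro: inj_on_subset)
    then have "inj_on (e \<circ> f) (verts G)" using f(1) by (simp add: comp_inj_on)
    then show "bij_betw (e \<circ> f) (verts G) (verts (induced_subgraph U (e ` f ` verts G)))"
      by (simp add: bij_betw_def induced_subgraph_def image_comp)
    fix x y assume xy: "x \<in> verts G" "y \<in> verts G"
    then have "f x \<in> V" "f y \<in> V" using f(2) by auto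
    moreover from this have "e (f x) < card V" "e (f y) < card V" using bij_betw_apply[OF e] by auto
    ultimately show "adj G x y \<longleftrightarrow> adj (induced_subgraph U (e ` f ` verts G)) ((e \<circ> f) x) ((e \<circ> f) y)"
      using adj[OF xy] ie xy by (simp add: induced_subgraph_def U_def)
  qed
  ultimately show ?thesis unfolding HCU_def using S by blast
qed

lemma unigraph_uniquely_realized:
  fixes U :: "nat graph"
  assumes "unigraph U"
  shows "uniquely_realized (verts U) (adj U)"
  unfolding uniquely_realized_def
proof (intro conjI allI impI)
  have S: "simple_graph U" using assms by (simp add: unigraph_def)
  then show "graph_on (verts U) (adj U)" by (simp add: simple_graph_graph_on)
  fix E' assume E': "graph_on (verts U) E' \<and> (\<forall>x\<in>verts U. deg E' x = deg (adj U) x)"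
  let ?H = "\<lparr>verts = verts U, adj = E'\<rparr>"
  have H: "simple_graph ?H" using E' by (simp add: simple_graph_graph_on)
  have "degree_sequence ?H = degree_sequence U"
    unfolding degree_sequence_def
    using E' S degree_deg[OF H] degree_deg[OF S] graph_on_finite[of "verts U" E']
    by (auto intro!: image_mset_cong)
  then have "isomorphic U ?H" using assms H by (simp add: unigraph_def)
  then show "\<exists>f. bij_betw f (verts U) (verts U) \<and>
      (\<forall>x\<in>verts U. \<forall>y\<in>verts U. adj U x y \<longleftrightarrow> E' (f x) (f y))"
    by (simp add: isomorphic_def)
qed

lemma HCU_E:
  assumes "G \<in> HCU"
  obtains V and E :: "nat \<Rightarrow> nat \<Rightarrow> bool" and f where "simple_graph G" "uniquely_realized V E"
    "inj_on f (verts G)" "f ` verts G \<subseteq> V"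
    "\<And>x y. x \<in> verts G \<Longrightarrow> y \<in> verts G \<Longrightarrow> adj G x y \<longleftrightarrow> E (f x) (f y)"
proof -
  obtain U :: "nat graph" and W where U: "simple_graph G" "unigraph U" "W \<subseteq> verts U"
      "isomorphic G (induced_subgraph U W)"
    using assms unfolding HCU_def by blast
  then obtain f where f: "bij_betw f (verts G) W"
      "\<forall>x\<in>verts G. \<forall>y\<in>verts G. adj G x y \<longleftrightarrow> adj (induced_subgraph U W) (f x) (f y)"
    unfolding isomorphic_def by (auto simp: induced_subgraph_def)
  show thesis
  proof (rule that[OF U(1) unigraph_uniquely_realized[OF U(2)]])
    show "inj_on f (verts G)" "f ` verts G \<subseteq> verts U" using f(1) U(3) by (auto simp: bij_betw_def)
    show "adj G x y \<longleftrightarrow> adj U (f x) (f y)" if "x \<in> verts G" "y \<in> verts G" for x y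
      using f that bij_betw_apply[OF f(1)] by (simp add: induced_subgraph_def)
  qed
qed

lemma HCU_embed:
  assumes "G \<in> HCU" "simple_graph H" "inj_on h (verts H)" "h ` verts H \<subseteq> verts G"
    "\<And>x y. x \<in> verts H \<Longrightarrow> y \<in> verts H \<Longrightarrow> adj H x y \<longleftrightarrow> adj G (h x) (h y)"
  shows "H \<in> HCU"
proof -
  obtain V and E :: "nat \<Rightarrow> nat \<Rightarrow> bool" and f where f: "uniquely_realized V E"
    "inj_on f (verts G)" "f ` verts G \<subseteq> V"
    "\<And>x y. x \<in> verts G \<Longrightarrow> y \<in> verts G \<Longrightarrow> adj G x y \<longleftrightarrow> E (f x) (f y)"
    using assms(1) by (rule HCU_E) blast
  show ?thesis
  proof (rule HCU_I[OF assms(2) f(1), of "f \<circ> h"])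
    show "inj_on (f \<circ> h) (verts H)"
      using assms(3) inj_on_subset[OF f(2) assms(4)] by (rule comp_inj_on)
    show "(f \<circ> h) ` verts H \<subseteq> V" using f(3) assms(4) by auto
    show "adj H x y \<longleftrightarrow> E ((f \<circ> h) x) ((f \<circ> h) y)" if "x \<in> verts H" "y \<in> verts H" for x y
    proof -
      have "h x \<in> verts G" "h y \<in> verts G" using assms(4) that by auto
      then show ?thesis using assms(5)[OF that] f(4) by simp
    qed
  qed
qed

lemma HCU_isomorphic:
  assumes "G \<in> HCU" "simple_graph H" "isomorphic H G"
  shows "H \<in> HCU"
proof -
  obtain h where "bij_betw h (verts H) (verts G)"
      "\<forall>x\<in>verts H. \<forall>y\<in>verts H. adj H x y \<longleftrightarrow> adj G (h x) (h y)"
    using assms(3) unfolding isomorphic_def by blast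
  then show ?thesis using HCU_embed[OF assms(1,2), of h] by (auto simp: bij_betw_def)
qed

lemma isomorphic_sym:
  assumes "isomorphic G H"
  shows "isomorphic H G"
proof -
  obtain h where h: "bij_betw h (verts G) (verts H)"
      "\<forall>x\<in>verts G. \<forall>y\<in>verts G. adj G x y \<longleftrightarrow> adj H (h x) (h y)"
    using assms unfolding isomorphic_def by blast
  let ?i = "inv_into (verts G) h"
  have i: "bij_betw ?i (verts H) (verts G)" using h(1) by (rule bij_betw_inv_into)
  have "adj H x y \<longleftrightarrow> adj G (?i x) (?i y)" if "x \<in> verts H" "y \<in> verts H" for x y
    using h that bij_betw_apply[OF i] by (simp add: bij_betw_inv_into_right)
  then show ?thesis using i unfolding isomorphic_def by blast
qed


section \<open>Compositions in the hereditary closure\<close>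

lemma simple_graph_compose:
  assumes "simple_graph P" "simple_graph Q" "verts P \<inter> verts Q = {}" "K \<subseteq> verts P"
  shows "simple_graph (compose P K Q)"
  using assms by (auto simp: simple_graph_def compose_def)

lemma HCU_compose_bipartite_unique:
  assumes P: "simple_graph P" and KS: "KS_partition P K S" and Q: "Q \<in> HCU"
    and disj: "verts P \<inter> verts Q = {}" and J: "bipartite_unique A B J"
    and i: "inj_on i K" "i ` K \<subseteq> A" and j: "inj_on j S" "j ` S \<subseteq> B"
    and adj: "\<And>x y. x \<in> K \<Longrightarrow> y \<in> S \<Longrightarrow> adj P x y \<longleftrightarrow> J (i x) (j y)"
  shows "compose P K Q \<in> HCU"
proof -
  obtain V and E :: "nat \<Rightarrow> nat \<Rightarrow> bool" and f where f: "simple_graph Q" "uniquely_realized V E"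
    "inj_on f (verts Q)" "f ` verts Q \<subseteq> V"
    "\<And>x y. x \<in> verts Q \<Longrightarrow> y \<in> verts Q \<Longrightarrow> adj Q x y \<longleftrightarrow> E (f x) (f y)"
    using Q by (rule HCU_E) blast
  have vP: "verts P = K \<union> S" "K \<inter> S = {}" using KS by (auto simp: KS_partition_def)
  define g where "g x = (if x \<in> K then Inl (Inl (i x)) else if x \<in> S then Inl (Inr (j x)) else Inr (f x))" for x
  have gK: "g x = Inl (Inl (i x))" if "x \<in> K" for x using that by (simp add: g_def)
  have gS: "g x = Inl (Inr (j x))" if "x \<in> S" for x using that vP by (auto simp: g_def)
  have gQ: "g x = Inr (f x)" if "x \<in> verts Q" for x using that vP disj by (auto simp: g_def)
  have vC: "verts (compose P K Q) = K \<union> S \<union> verts Q" by (simp add: compose_def vP)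
  show ?thesis
  proof (rule HCU_I[OF _ uniquely_realized_sum_compose[OF J f(2)], of _ g])
    show "simple_graph (compose P K Q)" using simple_graph_compose[OF P f(1) disj] vP by simp
    show "inj_on g (verts (compose P K Q))"
    proof (rule inj_onI)
      fix x y assume "x \<in> verts (compose P K Q)" "y \<in> verts (compose P K Q)" and e: "g x = g y"
      then have "x \<in> K \<or> x \<in> S \<or> x \<in> verts Q" "y \<in> K \<or> y \<in> S \<or> y \<in> verts Q" using vC by auto
      then show "x = y"
        using e by (elim disjE) (simp_all add: gK gS gQ inj_on_eq_iff[OF i(1)] inj_on_eq_iff[OF j(1)]
            inj_on_eq_iff[OF f(3)])
    qed
    show "g ` verts (compose P K Q) \<subseteq> Inl ` Inl ` A \<union> Inl ` Inr ` B \<union> Inr ` V"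
      unfolding vC image_Un using i(2) j(2) f(4) by (intro Un_mono image_subsetI) (auto simp: gK gS gQ)
    fix x y assume xy: "x \<in> verts (compose P K Q)" "y \<in> verts (compose P K Q)"
    have PV: "u \<in> K \<union> S \<and> v \<in> K \<union> S" if "adj P u v" for u v
      using P that vP by (auto simp: simple_graph_def)
    have QV: "u \<in> verts Q \<and> v \<in> verts Q" if "adj Q u v" for u v
      using f(1) that by (auto simp: simple_graph_def)
    have Psym: "adj P u v \<longleftrightarrow> adj P v u" and Pir: "\<not> adj P u u" for u v
      using P by (auto simp: simple_graph_def)
    have cK: "adj P u v" if "u \<in> K" "v \<in> K" "u \<noteq> v" for u v
      using KS that by (auto simp: KS_partition_def clique_def)
    have cS: "\<not> adj P u v" if "u \<in> S" "v \<in> S" for u v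
      using KS that by (auto simp: KS_partition_def stable_def)
    have KQ: "u \<notin> verts Q" "u \<notin> S" if "u \<in> K" for u using that disj vP by auto
    have SQ: "u \<notin> verts Q" "u \<notin> K" if "u \<in> S" for u using that disj vP by auto
    have QK: "u \<notin> K" "u \<notin> S" if "u \<in> verts Q" for u using that disj vP by auto
    have a: "adj (compose P K Q) x y \<longleftrightarrow> adj P x y \<or> adj Q x y \<or>
        (x \<in> K \<and> y \<in> verts Q) \<or> (x \<in> verts Q \<and> y \<in> K)" by (simp add: compose_def)
    have "x \<in> K \<or> x \<in> S \<or> x \<in> verts Q" "y \<in> K \<or> y \<in> S \<or> y \<in> verts Q" using xy vC by auto
    then consider "x \<in> K" "y \<in> K" | "x \<in> K" "y \<in> S" | "x \<in> S" "y \<in> K" | "x \<in> S" "y \<in> S"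
      | "x \<in> verts Q" "y \<in> verts Q" | "x \<in> K" "y \<in> verts Q" | "x \<in> verts Q" "y \<in> K"
      | "x \<in> S" "y \<in> verts Q" | "x \<in> verts Q" "y \<in> S" by argo
    then show "adj (compose P K Q) x y \<longleftrightarrow> sum_compose A B V J E (g x) (g y)"
    proof cases
      case 1
      have "adj (compose P K Q) x y \<longleftrightarrow> x \<noteq> y" using a 1 cK[OF 1] Pir QV[of x y] KQ by metis
      then show ?thesis using 1 i(2) by (auto simp: gK inj_on_eq_iff[OF i(1)])
    next
      case 2
      have "adj (compose P K Q) x y \<longleftrightarrow> adj P x y" using a QV[of x y] KQ[OF 2(1)] SQ[OF 2(2)] by metis
      then show ?thesis using 2 i(2) j(2) adj[OF 2] by (auto simp: gK gS)
    next
      case 3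
      have "adj (compose P K Q) x y \<longleftrightarrow> adj P y x" using a QV[of x y] SQ[OF 3(1)] KQ[OF 3(2)] Psym by metis
      then show ?thesis using 3 i(2) j(2) adj[OF 3(2,1)] by (auto simp: gK gS)
    next
      case 4
      have "\<not> adj (compose P K Q) x y" using a QV[of x y] SQ[OF 4(1)] SQ[OF 4(2)] cS[OF 4] by metis
      then show ?thesis using 4 by (simp add: gS)
    next
      case 5
      have "adj (compose P K Q) x y \<longleftrightarrow> adj Q x y" using a PV[of x y] QK[OF 5(1)] QK[OF 5(2)] by blast
      moreover have "f x \<in> V" "f y \<in> V" using 5 f(4) by auto
      ultimately show ?thesis using 5 f(5)[OF 5] by (simp add: gQ)
    next
      case 6
      then show ?thesis using a i(2) f(4) by (auto simp: gK gQ)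
    next
      case 7
      then show ?thesis using a i(2) f(4) by (auto simp: gK gQ)
    next
      case 8
      have "\<not> adj (compose P K Q) x y" using a QV[of x y] PV[of x y] SQ[OF 8(1)] QK[OF 8(2)] by blast
      then show ?thesis using 8 by (simp add: gS gQ)
    next
      case 9
      have "\<not> adj (compose P K Q) x y" using a QV[of x y] PV[of x y] SQ[OF 9(2)] QK[OF 9(1)] by blast
      then show ?thesis using 9 by (simp add: gS gQ)
    qed
  qed
qed

lemma indecomposable_imp_indecomposable_split:
  assumes I: "indecomposable P" and KS: "KS_partition P K S"
  shows "indecomposable_split (adj P) K S"
proof -
  have P: "simple_graph P" using I by (simp add: indecomposable_def)
  have vP: "verts P = K \<union> S" "K \<inter> S = {}" using KS by (auto simp: KS_partition_def)
  have cK: "\<forall>u\<in>K. \<forall>v\<in>K. u \<noteq> v \<longrightarrow> adj P u v" and cS: "\<forall>u\<in>S. \<forall>v\<in>S. \<not> adj P u v"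
    using KS by (auto simp: KS_partition_def clique_def stable_def)
  have Psym: "adj P u v \<longleftrightarrow> adj P v u" for u v using P by (auto simp: simple_graph_def)
  have "K1 \<union> S1 = {} \<or> K1 \<union> S1 = K \<union> S"
    if h: "K1 \<subseteq> K" "S1 \<subseteq> S" "\<forall>x\<in>K1. \<forall>y\<in>S - S1. adj P x y" "\<forall>x\<in>S1. \<forall>y\<in>K - K1. \<not> adj P x y" for K1 S1
  proof (rule ccontr)
    assume n: "\<not> ?thesis"
    let ?V1 = "K1 \<union> S1" and ?V0 = "(K \<union> S) - (K1 \<union> S1)"
    let ?G1 = "induced_subgraph P ?V1" and ?G0 = "induced_subgraph P ?V0"
    have fin: "finite (K \<union> S)" using P vP by (simp add: simple_graph_def)
    have s: "simple_graph (induced_subgraph P W)" if "W \<subseteq> K \<union> S" for W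
      using P that finite_subset[OF that fin] by (auto simp: simple_graph_def induced_subgraph_def)
    have c: "adj (compose ?G1 K1 ?G0) x y \<longleftrightarrow> adj P x y" if xy: "x \<in> K \<union> S" "y \<in> K \<union> S" for x y
    proof -
      have cross: "adj P u v \<longleftrightarrow> u \<in> K1" if "u \<in> ?V1" "v \<in> ?V0" for u v
      proof (cases "u \<in> K1")
        case True
        have "v \<in> K \<or> v \<in> S - S1" using that(2) by blast
        moreover have "adj P u v" if "v \<in> S - S1" using h(3) True that by blast
        moreover have "adj P u v" if vK: "v \<in> K"
        proof -
          have "u \<in> K" "u \<noteq> v" using True h(1) \<open>v \<in> ?V0\<close> by auto
          then show ?thesis using cK vK by simp
        qed
        ultimately have "adj P u v" by (elim disjE)
        then show ?thesis using True by simp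
      next
        case False
        then have u: "u \<in> S1" "u \<in> S" using that(1) h(2) by blast+
        have "v \<in> K - K1 \<or> v \<in> S" using that(2) by blast
        moreover have "\<not> adj P u v" if "v \<in> K - K1" using h(4) u(1) that by blast
        moreover have "\<not> adj P u v" if "v \<in> S" using cS u(2) that by blast
        ultimately have "\<not> adj P u v" by (elim disjE)
        then show ?thesis using False by simp
      qed
      have a: "adj (compose ?G1 K1 ?G0) x y \<longleftrightarrow> (x \<in> ?V1 \<and> y \<in> ?V1 \<and> adj P x y) \<or>
          (x \<in> ?V0 \<and> y \<in> ?V0 \<and> adj P x y) \<or> (x \<in> K1 \<and> y \<in> ?V0) \<or> (x \<in> ?V0 \<and> y \<in> K1)"
        by (simp add: compose_def induced_subgraph_def)
      consider "x \<in> ?V1" "y \<in> ?V1" | "x \<in> ?V1" "y \<in> ?V0" | "x \<in> ?V0" "y \<in> ?V1" | "x \<in> ?V0" "y \<in> ?V0"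
        using xy by blast
      then show ?thesis
      proof cases
        case 1 then show ?thesis using a by blast
      next
        case 2 then show ?thesis using a cross[OF 2] by blast
      next
        case 3 then show ?thesis using a cross[OF 3(2,1)] Psym[of x y] by blast
      next
        case 4 then show ?thesis using a by blast
      qed
    qed
    have "isomorphic P (compose ?G1 K1 ?G0)"
      unfolding isomorphic_def
    proof (intro exI conjI ballI)
      have "verts (compose ?G1 K1 ?G0) = K \<union> S" using h by (auto simp: compose_def induced_subgraph_def)
      then show "bij_betw id (verts P) (verts (compose ?G1 K1 ?G0))" using vP by simp
      show "adj P x y \<longleftrightarrow> adj (compose ?G1 K1 ?G0) (id x) (id y)" if "x \<in> verts P" "y \<in> verts P" for x y
        using c[of x y] that vP by simp
    qed
    moreover have "KS_partition ?G1 K1 S1"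
    proof -
      have "\<forall>x\<in>K1. \<forall>y\<in>K1. x \<noteq> y \<longrightarrow> adj P x y" using cK h(1) by blast
      moreover have "\<forall>x\<in>S1. \<forall>y\<in>S1. \<not> adj P x y" using cS h(2) by blast
      moreover have "K1 \<inter> S1 = {}" using vP(2) h(1,2) by blast
      ultimately show ?thesis
        unfolding KS_partition_def clique_def stable_def induced_subgraph_def by simp
    qed
    moreover have "simple_graph ?G1" by (rule s) (use h(1,2) in blast)
    moreover have "simple_graph ?G0" by (rule s) (rule Diff_subset)
    moreover have "verts ?G1 \<noteq> {}" "verts ?G0 \<noteq> {}" "verts ?G1 \<inter> verts ?G0 = {}"
    proof -
      have v: "verts (induced_subgraph P W) = W" for W by (simp add: induced_subgraph_def)
      have "?V1 \<subseteq> K \<union> S" using h(1,2) by blast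
      then show "verts ?G1 \<noteq> {}" "verts ?G0 \<noteq> {}" "verts ?G1 \<inter> verts ?G0 = {}"
        unfolding v using n by blast+
    qed
    ultimately have "decomposable P"
      unfolding decomposable_def by (intro exI[of _ ?G1] exI[of _ K1] exI[of _ S1] exI[of _ ?G0] conjI)
    then show False using I by (simp add: indecomposable_def)
  qed
  then show ?thesis using vP cK cS unfolding indecomposable_split_def by simp
qed

lemma indecomposable_split_image:
  assumes I: "indecomposable_split D K S" and f: "inj_on f (K \<union> S)"
    and e: "\<And>x y. x \<in> K \<union> S \<Longrightarrow> y \<in> K \<union> S \<Longrightarrow> D x y \<longleftrightarrow> E (f x) (f y)"
  shows "indecomposable_split E (f ` K) (f ` S)"
  unfolding indecomposable_split_def
proof (intro conjI allI impI)
  note dI = indecomposable_splitD[OF I]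
  show "f ` K \<inter> f ` S = {}" using dI(1) f by (auto simp: inj_on_def)
  show "\<forall>x\<in>f ` K. \<forall>y\<in>f ` K. x \<noteq> y \<longrightarrow> E x y" using dI(2) e by blast
  show "\<forall>x\<in>f ` S. \<forall>y\<in>f ` S. \<not> E x y" using dI(3) e by blast
  fix K1 S1 assume h: "K1 \<subseteq> f ` K \<and> S1 \<subseteq> f ` S \<and> (\<forall>x\<in>K1. \<forall>y\<in>f ` S - S1. E x y) \<and>
    (\<forall>x\<in>S1. \<forall>y\<in>f ` K - K1. \<not> E x y)"
  let ?K = "{x \<in> K. f x \<in> K1}" and ?S = "{x \<in> S. f x \<in> S1}"
  have "K1 \<subseteq> f ` K" "S1 \<subseteq> f ` S" using h by simp_all
  then have im: "K1 = f ` ?K" "S1 = f ` ?S" by auto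
  define X where "X = ?K \<union> ?S"
  have dec: "X = {} \<or> X = K \<union> S"
    unfolding X_def
  proof (rule dI(4))
    show "D x y" if "x \<in> ?K" "y \<in> S" "y \<notin> ?S" for x y
    proof -
      have "f x \<in> K1" "f y \<in> f ` S - S1" using that by auto
      then have "E (f x) (f y)" using h by blast
      then show ?thesis using e[of x y] that by simp
    qed
    show "\<not> D x y" if "x \<in> ?S" "y \<in> K" "y \<notin> ?K" for x y
    proof -
      have "f x \<in> S1" "f y \<in> f ` K - K1" using that by auto
      then have "\<not> E (f x) (f y)" using h by blast
      then show ?thesis using e[of x y] that by simp
    qed
  qed auto
  have "K1 \<union> S1 = f ` X"
    unfolding X_def image_Un using im by (rule arg_cong2[of _ _ _ _ "(\<union>)"])
  then show "K1 \<union> S1 = {} \<or> K1 \<union> S1 = f ` K \<union> f ` S"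
    using dec by (elim disjE) (simp_all only: image_empty image_Un simp_thms)
qed

lemma card_proper_subset_pair:
  assumes "card K \<le> 2" "finite K" "T \<subseteq> K" "T \<noteq> {}" "T \<noteq> K"
  shows "card T = 1"
proof -
  have "card T < card K" using assms by (intro psubset_card_mono) auto
  moreover have "card T \<noteq> 0" using assms finite_subset[OF assms(3,2)] by auto
  ultimately show ?thesis using assms(1) by linarith
qed

text \<open>The cases provide the bipartite graph that \<open>HCU_compose_bipartite_unique\<close> requires: if \<open>K\<close> or
\<open>S\<close> has at most two vertices, \<open>P\<close> itself; otherwise the surrounding unigraph of \<open>P\<close>, split
into the vertices whose degree occurs in \<open>K\<close> and all others.\<close>

lemma HCU_compose:
  assumes P: "P \<in> HCU" "indecomposable P" and KS: "KS_partition P K S" and Q: "Q \<in> HCU"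
    and disj: "verts P \<inter> verts Q = {}"
  shows "compose P K Q \<in> HCU"
proof -
  have sP: "simple_graph P" using P(2) by (simp add: indecomposable_def)
  have vP: "verts P = K \<union> S" "K \<inter> S = {}" using KS by (auto simp: KS_partition_def)
  have fin: "finite K" "finite S" using sP vP by (auto simp: simple_graph_def)
  have Psym: "adj P u v \<longleftrightarrow> adj P v u" for u v using sP by (auto simp: simple_graph_def)
  have I: "indecomposable_split (adj P) K S" using indecomposable_imp_indecomposable_split[OF P(2) KS] .
  have self: "compose P K Q \<in> HCU" if "bipartite_unique K S (adj P)"
    by (rule HCU_compose_bipartite_unique[OF sP KS Q disj that, of id id]) auto
  show ?thesis
  proof (cases "K = {} \<or> S = {}")
    case True
    then show ?thesis using self bipartite_unique_empty[OF fin] by blast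
  next
    case False
    then have ne: "K \<noteq> {}" "S \<noteq> {}" by auto
    note N = indecomposable_split_neighbours[OF I ne Psym]
    consider "card K \<le> 2" | "card S \<le> 2" | "3 \<le> card K" "3 \<le> card S" by linarith
    then show ?thesis
    proof cases
      case 1
      have "card {k \<in> K. adj P k s} = 1" if "s \<in> S" for s
        by (rule card_proper_subset_pair[OF 1 fin(1)]) (use N(3,4)[OF that] in auto)
      then show ?thesis by (rule self[OF bipartite_unique_leaves[OF fin]])
    next
      case 2
      have "card {s \<in> S. adj P k s} = 1" if "k \<in> K" for k
        by (rule card_proper_subset_pair[OF 2 fin(2)]) (use N(1,2)[OF that] in auto)
      then have "bipartite_unique S K (\<lambda>s k. adj P k s)" by (rule bipartite_unique_leaves[OF fin(2,1)])
      then show ?thesis by (rule self[OF bipartite_unique_swap])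
    next
      case 3
      obtain V and E :: "nat \<Rightarrow> nat \<Rightarrow> bool" and f where f: "uniquely_realized V E"
        "inj_on f (verts P)" "f ` verts P \<subseteq> V"
        "\<And>x y. x \<in> verts P \<Longrightarrow> y \<in> verts P \<Longrightarrow> adj P x y \<longleftrightarrow> E (f x) (f y)"
        using P(1) by (rule HCU_E) blast
      have I': "indecomposable_split E (f ` K) (f ` S)"
        by (rule indecomposable_split_image[OF I]) (use f vP in auto)
      have inj: "inj_on f K" "inj_on f S" using f(2) vP by (auto intro: inj_on_subset)
      define A where "A = {v \<in> V. deg E v \<in> deg E ` f ` K}"
      have sub: "f ` K \<subseteq> V" "f ` S \<subseteq> V" using f(3) vP by auto
      have d: "deg E k \<noteq> deg E s" if "k \<in> f ` K" "s \<in> f ` S" for k s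
        using split_degrees_disjoint[OF f(1) I' sub _ _ that] 3 inj by (simp add: card_image)
      have "bipartite_unique A (V - A) E"
        by (rule bipartite_unique_degrees_disjoint[OF f(1)]) (auto simp: A_def)
      then show ?thesis
      proof (rule HCU_compose_bipartite_unique[OF sP KS Q disj _ inj(1) _ inj(2)])
        show "f ` K \<subseteq> A" using sub by (auto simp: A_def)
        show "f ` S \<subseteq> V - A" 
        proof
          fix s assume s: "s \<in> f ` S"
          have "s \<notin> A"
          proof
            assume "s \<in> A"
            then obtain k where "k \<in> f ` K" "deg E s = deg E k" unfolding A_def by blast
            then show False using d[of k s] s by simp
          qed
          then show "s \<in> V - A" using s sub(2) by blast
        qed
        show "adj P x y \<longleftrightarrow> E (f x) (f y)" if "x \<in> K" "y \<in> S" for x y using f(4) that vP by blast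
      qed
    qed
  qed
qed


section \<open>Tyshkevich decompositions\<close>

lemma iterated_compose_properties:
  assumes "\<forall>i\<le>n. simple_graph (P i)" "\<forall>i\<in>{1..n}. KS_partition (P i) (K i) (S i)"
    "\<forall>i\<le>n. \<forall>j\<le>n. i \<noteq> j \<longrightarrow> verts (P i) \<inter> verts (P j) = {}"
  shows "simple_graph (iterated_compose P K n) \<and>
    verts (iterated_compose P K n) = (\<Union>i\<le>n. verts (P i)) \<and>
    (\<forall>i\<le>n. \<forall>x\<in>verts (P i). \<forall>y\<in>verts (P i). adj (iterated_compose P K n) x y \<longleftrightarrow> adj (P i) x y)"
  using assms
proof (induction n)
  case 0
  then show ?case by simp
next
  case (Suc n)
  let ?I = "iterated_compose P K n" and ?Q = "P (Suc n)"
  have IH: "simple_graph ?I" "verts ?I = (\<Union>i\<le>n. verts (P i))"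
      "\<And>i x y. i \<le> n \<Longrightarrow> x \<in> verts (P i) \<Longrightarrow> y \<in> verts (P i) \<Longrightarrow> adj ?I x y \<longleftrightarrow> adj (P i) x y"
    using Suc.IH Suc.prems by auto
  have sQ: "simple_graph ?Q" using Suc.prems by simp
  have KQ: "K (Suc n) \<subseteq> verts ?Q" using Suc.prems(2) by (auto simp: KS_partition_def)
  have disj: "verts ?Q \<inter> verts (P i) = {}" if "i \<le> n" for i
    using Suc.prems(3) that by (metis Suc_n_not_le_n le_Suc_eq order_refl)
  then have dI: "verts ?Q \<inter> verts ?I = {}" using IH(2) by auto
  have inQ: "x \<in> verts ?Q \<and> y \<in> verts ?Q" if "adj ?Q x y" for x y using sQ that by (auto simp: simple_graph_def)
  have inI: "x \<in> verts ?I \<and> y \<in> verts ?I" if "adj ?I x y" for x y using IH(1) that by (auto simp: simple_graph_def)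
  have "simple_graph (compose ?Q (K (Suc n)) ?I)" using simple_graph_compose[OF sQ IH(1) dI KQ] .
  moreover have "verts (compose ?Q (K (Suc n)) ?I) = (\<Union>i\<le>Suc n. verts (P i))"
    using IH(2) by (auto simp: compose_def atMost_Suc)
  moreover have "adj (compose ?Q (K (Suc n)) ?I) x y \<longleftrightarrow> adj (P i) x y"
    if i: "i \<le> Suc n" and xy: "x \<in> verts (P i)" "y \<in> verts (P i)" for i x y
  proof (cases "i = Suc n")
    case True
    then have "x \<notin> verts ?I" "y \<notin> verts ?I" using xy dI by auto
    then show ?thesis using True inI[of x y] by (auto simp: compose_def)
  next
    case False
    then have "i \<le> n" using i by simp
    then have "x \<notin> verts ?Q" "y \<notin> verts ?Q" using xy disj by blast+
    then show ?thesis using inQ[of x y] KQ IH(3)[OF \<open>i \<le> n\<close> xy] by (auto simp: compose_def)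
  qed
  ultimately show ?case by simp
qed

theorem theorem3p2:
  fixes G :: "'a graph"
    and P :: "nat \<Rightarrow> 'b graph"
    and K S :: "nat \<Rightarrow> 'b set"
    and n :: nat
  assumes "simple_graph G"
    and "tyshkevich_decomposition G n P K S"
  shows "G \<in> HCU \<longleftrightarrow> (\<forall>i\<in>{0..n}. P i \<in> \<I>)"
proof
  have D: "\<forall>i\<le>n. simple_graph (P i)" "\<forall>i\<le>n. indecomposable (P i)"
      "\<forall>i\<in>{1..n}. KS_partition (P i) (K i) (S i)"
      "\<forall>i\<le>n. \<forall>j\<le>n. i \<noteq> j \<longrightarrow> verts (P i) \<inter> verts (P j) = {}"
      "isomorphic G (iterated_compose P K n)"
    using assms(2) by (auto simp: tyshkevich_decomposition_def)
  note C = iterated_compose_properties[OF D(1,3,4)]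
  {
    assume "G \<in> HCU"
    then have H: "iterated_compose P K n \<in> HCU"
      using C[THEN conjunct1] isomorphic_sym[OF D(5)] by (rule HCU_isomorphic)
    show "\<forall>i\<in>{0..n}. P i \<in> \<I>"
    proof
      fix i assume "i \<in> {0..n}"
      then have i: "i \<le> n" by simp
      have "P i \<in> HCU"
        by (rule HCU_embed[OF H, of _ id]) (use C D(1) i in auto)
      then show "P i \<in> \<I>" using D(2) i by (simp add: indecomposable_HCU_def)
    qed
  next
    assume h: "\<forall>i\<in>{0..n}. P i \<in> \<I>"
    have "m \<le> n \<Longrightarrow> iterated_compose P K m \<in> HCU" for m
    proof (induction m)
      case 0
      then show ?case using h by (simp add: indecomposable_HCU_def)
    next
      case (Suc m)
      have "verts (iterated_compose P K m) = (\<Union>i\<le>m. verts (P i))"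
        using iterated_compose_properties[of m P K S] D Suc.prems by simp
      moreover have "verts (P (Suc m)) \<inter> verts (P i) = {}" if "i \<le> m" for i
        using D(4) that Suc.prems by (metis Suc_n_not_le_n le_SucI le_trans)
      ultimately have "verts (P (Suc m)) \<inter> verts (iterated_compose P K m) = {}" by auto
      moreover have "P (Suc m) \<in> HCU" using h Suc.prems by (simp add: indecomposable_HCU_def)
      moreover have "KS_partition (P (Suc m)) (K (Suc m)) (S (Suc m))" using D(3) Suc.prems by simp
      moreover have "iterated_compose P K m \<in> HCU" using Suc by simp
      moreover have "indecomposable (P (Suc m))" using D(2) Suc.prems by simp
      ultimately have "compose (P (Suc m)) (K (Suc m)) (iterated_compose P K m) \<in> HCU"
        by (intro HCU_compose)
      then show ?case by simp
    qed
    then show "G \<in> HCU" using HCU_isomorphic[OF _ assms(1) D(5)] by simp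
  }
qed

end
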